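(* Let $1\le p<\infty$ and let $\Omega\subsetneq\mathbb{R}^n$ be a domain. Then $\Omega$ admits the pointwise $p$-Hardy inequality, that is, there exists a constant $C>0$ such that $$|u(x)|\le C\,d(x,\partial\Omega)\bigl(\mathcal{M}_{2d(x,\partial\Omega)}|\nabla u|^p(x)\bigr)^{1/p}$$ for all $u\in C_0^\infty(\Omega)$ and every $x\in\Omega$, if and only if the complement $\mathbb{R}^n\setminus\Omega$ is uniformly $p$-fat.
   Context: $\mathbb{R}^n$ carries the Euclidean distance $d$ and Lebesgue measure. $B(x,r)$ is the open ball and $\overline B(x,r)$ the corresponding closed ball. A domain is a nonempty open connected set. For $R>0$ and locally integrable $f$, the restricted Hardy--Littlewood maximal function is $\mathcal{M}_R f(x)=\sup_{0<r\le R}\frac{1}{|B(x,r)|}\int_{B(x,r)}|f|\,dy$. Sobolev spaces are understood in the Newtonian sense. A curve is a nonconstant, rectifiable, continuous mapping from a compact interval. The $p$-modulus of a curve family $\Gamma$ is $\inf\int\rho^p\,dx$ over Borel $\rho\ge0$ with $\int_\gamma\rho\,ds\ge1$ for all $\gamma\in\Gamma$. A measurable $g\ge 0$ is a $p$-weak upper gradient of $u$ if, for all curves $\gamma$ (with endpoints $x,y$) outside a family of zero $p$-modulus, $|u(x)-u(y)|\le\int_\gamma g\,ds$ whenever $u(x),u(y)$ are both finite, and $\int_\gamma g\,ds=\infty$ otherwise. $N^{1,p}(\mathbb{R}^n)$ is the set of $u\in L^p(\mathbb{R}^n)$ having a $p$-weak upper gradient in $L^p(\mathbb{R}^n)$ (it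 coincides with $W^{1,p}(\mathbb{R}^n)$ up to choice of representatives, with $g_u=|\nabla u|$ the minimal $p$-weak upper gradient). For an open set $U$, $N_0^{1,p}(U)=\{u|_U: u\in N^{1,p}(\mathbb{R}^n),\ u=0\text{ in }\mathbb{R}^n\setminus U\}$. For $E\subset U$ with $U$ open, $\operatorname{cap}_p(E,U)=\inf\int_U g_u^p\,dx$, the infimum taken over all $u\in N_0^{1,p}(U)$ with $u|_E=1$ and their $p$-weak upper gradients $g_u$ ($=\infty$ if there is no such $u$). A set $E\subset\mathbb{R}^n$ is uniformly $p$-fat if there is a constant $c_0>0$ such that $\operatorname{cap}_p(E\cap\overline B(x,r),B(x,2r))\ge c_0\operatorname{cap}_p(\overline B(x,r),B(x,2r))$ for all $x\in E$ and all $r>0$. *)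

theory Defs
  imports "HOL-Analysis.Analysis"
begin

text \<open>Real powers on \<open>[0,\<infinity>]\<close>; only used with exponents \<open>a > 0\<close>, where \<open>0\<close> and \<open>\<infinity>\<close> are fixed.\<close>

definition ennreal_powr :: "ennreal \<Rightarrow> real \<Rightarrow> ennreal" where
  "ennreal_powr x a = (if x = \<infinity> then \<infinity> else ennreal (enn2real x powr a))"

primrec Ck :: "nat \<Rightarrow> ('a::euclidean_space \<Rightarrow> real) \<Rightarrow> bool" where
  "Ck 0 u \<longleftrightarrow> continuous_on UNIV u"
| "Ck (Suc k) u \<longleftrightarrow> (\<forall>x. u differentiable (at x)) \<and>
     (\<forall>b\<in>Basis. Ck k (\<lambda>x. frechet_derivative u (at x) b))"

text \<open>A function in \<open>C\<^sub>0\<^sup>\<infinity>(\<Omega>)\<close> is identified with its extension by zero to the whole space.\<close>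

definition C0_infty :: "'a::euclidean_space set \<Rightarrow> ('a \<Rightarrow> real) set" where
  "C0_infty \<Omega> = {u. (\<forall>k. Ck k u) \<and> compact (closure {x. u x \<noteq> 0}) \<and> closure {x. u x \<noteq> 0} \<subseteq> \<Omega>}"

definition gradient :: "('a::euclidean_space \<Rightarrow> real) \<Rightarrow> 'a \<Rightarrow> 'a" where
  "gradient u x = (\<Sum>b\<in>Basis. frechet_derivative u (at x) b *\<^sub>R b)"

definition restricted_maximal :: "real \<Rightarrow> ('a::euclidean_space \<Rightarrow> real) \<Rightarrow> 'a \<Rightarrow> ennreal" where
  "restricted_maximal R f x =
     (SUP r\<in>{0<..R}. (\<integral>\<^sup>+y\<in>ball x r. ennreal \<bar>f y\<bar> \<partial>lebesgue) / emeasure lebesgue (ball x r))"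

text \<open>The triple \<open>(a, b, \<gamma>)\<close> stands for the map \<open>\<gamma>\<close> restricted to \<open>[a,b]\<close>; the values of \<open>\<gamma>\<close>
  outside \<open>[a,b]\<close> are irrelevant.\<close>

type_synonym 'a curve = "real \<times> real \<times> (real \<Rightarrow> 'a)"

definition path_length :: "(real \<Rightarrow> 'a::metric_space) \<Rightarrow> real \<Rightarrow> real \<Rightarrow> ennreal" where
  "path_length \<gamma> a b =
     (SUP ts\<in>{ts. sorted ts \<and> set ts \<subseteq> {a..b}}.
        \<Sum>i<length ts - 1. ennreal (dist (\<gamma> (ts ! i)) (\<gamma> (ts ! Suc i))))"

definition is_curve :: "'a::metric_space curve \<Rightarrow> bool" where
  "is_curve = (\<lambda>(a, b, \<gamma>). a \<le> b \<and> continuous_on {a..b} \<gamma> \<and> \<not> \<gamma> constant_on {a..b}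
     \<and> path_length \<gamma> a b < \<infinity>)"

text \<open>The arc-length parametrization, defined on \<open>[0, \<ell>]\<close> with \<open>\<ell>\<close> the length of the curve.
  The chosen parameter \<open>t\<close> need not be unique, but the point \<open>\<gamma> t\<close> is.\<close>

definition arc_param :: "'a::metric_space curve \<Rightarrow> real \<Rightarrow> 'a" where
  "arc_param = (\<lambda>(a, b, \<gamma>) s. \<gamma> (SOME t. t \<in> {a..b} \<and> path_length \<gamma> a t = ennreal s))"

definition line_integral :: "('a::metric_space \<Rightarrow> ennreal) \<Rightarrow> 'a curve \<Rightarrow> ennreal" where
  "line_integral \<rho> = (\<lambda>(a, b, \<gamma>).
     \<integral>\<^sup>+s\<in>{0..enn2real (path_length \<gamma> a b)}. \<rho> (arc_param (a, b, \<gamma>) s) \<partial>lborel)"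

definition modulus :: "real \<Rightarrow> 'a::euclidean_space curve set \<Rightarrow> ennreal" where
  "modulus p \<Gamma> =
     (INF \<rho>\<in>{\<rho>. \<rho> \<in> borel_measurable borel \<and> (\<forall>\<gamma>\<in>\<Gamma>. 1 \<le> line_integral \<rho> \<gamma>)}.
        \<integral>\<^sup>+x. ennreal_powr (\<rho> x) p \<partial>lebesgue)"

text \<open>\<open>g\<close> is a \<open>p\<close>-weak upper gradient of the extended real-valued function \<open>u\<close> on the open set
  \<open>U\<close>. Only curves contained in \<open>U\<close> and the values of \<open>u\<close> and \<open>g\<close> on \<open>U\<close> matter.\<close>

definition weak_upper_gradient ::
  "real \<Rightarrow> 'a::euclidean_space set \<Rightarrow> ('a \<Rightarrow> ereal) \<Rightarrow> ('a \<Rightarrow> ennreal) \<Rightarrow> bool" where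
  "weak_upper_gradient p U u g \<longleftrightarrow> g \<in> borel_measurable (lebesgue_on U) \<and>
     (\<exists>\<Gamma>. \<Gamma> \<subseteq> Collect is_curve \<and> modulus p \<Gamma> = 0 \<and>
        (\<forall>a b \<gamma>. is_curve (a, b, \<gamma>) \<and> \<gamma> ` {a..b} \<subseteq> U \<and> (a, b, \<gamma>) \<notin> \<Gamma> \<longrightarrow>
           (if \<bar>u (\<gamma> a)\<bar> \<noteq> \<infinity> \<and> \<bar>u (\<gamma> b)\<bar> \<noteq> \<infinity>
            then e2ennreal \<bar>u (\<gamma> a) - u (\<gamma> b)\<bar> \<le> line_integral g (a, b, \<gamma>)
            else line_integral g (a, b, \<gamma>) = \<infinity>)))"

text \<open>Newtonian functions are defined at every point; they are not equivalence classes.\<close>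

definition newtonian :: "real \<Rightarrow> ('a::euclidean_space \<Rightarrow> ereal) set" where
  "newtonian p = {u. u \<in> borel_measurable lebesgue \<and>
     (\<integral>\<^sup>+x. ennreal_powr (e2ennreal \<bar>u x\<bar>) p \<partial>lebesgue) < \<infinity> \<and>
     (\<exists>g. weak_upper_gradient p UNIV u g \<and> (\<integral>\<^sup>+x. ennreal_powr (g x) p \<partial>lebesgue) < \<infinity>)}"

definition newtonian_zero :: "real \<Rightarrow> 'a::euclidean_space set \<Rightarrow> ('a \<Rightarrow> ereal) set" where
  "newtonian_zero p U = {restrict u U | u. u \<in> newtonian p \<and> (\<forall>x\<in>-U. u x = 0)}"

definition cap :: "real \<Rightarrow> 'a::euclidean_space set \<Rightarrow> 'a set \<Rightarrow> ennreal" where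
  "cap p E U =
     (INF (u, g)\<in>{(u, g). u \<in> newtonian_zero p U \<and> (\<forall>x\<in>E. u x = 1) \<and> weak_upper_gradient p U u g}.
        \<integral>\<^sup>+x\<in>U. ennreal_powr (g x) p \<partial>lebesgue)"

definition uniformly_fat :: "real \<Rightarrow> 'a::euclidean_space set \<Rightarrow> bool" where
  "uniformly_fat p E \<longleftrightarrow> (\<exists>c\<^sub>0::real. c\<^sub>0 > 0 \<and> (\<forall>x\<in>E. \<forall>r>0.
     cap p (E \<inter> cball x r) (ball x (2 * r)) \<ge> ennreal c\<^sub>0 * cap p (cball x r) (ball x (2 * r))))"

definition pointwise_hardy :: "real \<Rightarrow> 'a::euclidean_space set \<Rightarrow> bool" where
  "pointwise_hardy p \<Omega> \<longleftrightarrow> (\<exists>C::real. C > 0 \<and> (\<forall>u\<in>C0_infty \<Omega>. \<forall>x\<in>\<Omega>.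
     ennreal \<bar>u x\<bar> \<le> ennreal (C * infdist x (frontier \<Omega>)) *
       ennreal_powr (restricted_maximal (2 * infdist x (frontier \<Omega>))
         (\<lambda>y. norm (gradient u y) powr p) x) (1 / p)))"

end

theory Submission
  imports Defs "HOL-Complex_Analysis.Great_Picard"
begin

text \<open>
  Both directions compare the capacity with energies of smooth functions. The delicate point is that
  a Newtonian competitor for the capacity is only defined through curves. Its upper gradient,
  enlarged so as to dominate admissible densities of the exceptional families, has a lower
  semicontinuous majorant, the supremum of continuous functions \<open>h k\<close>. For large \<open>k\<close> the least
  \<open>h k\<close>-length of a path leaving the ball is a locally Lipschitz function that is at least \<open>1/2\<close>
  on the compact set, since otherwise a limit path would violate the upper gradient inequality.
  Truncating and mollifying this function gives a smooth competitor of comparable energy.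

  If the complement is fat, the capacity estimate for \<open>\<eta> (1 - u / u(x))\<close> near the boundary point
  closest to \<open>x\<close> is the pointwise Hardy inequality. Conversely, given a smooth competitor \<open>v\<close> for
  the capacity of the complement in a ball, the Hardy inequality for \<open>\<phi> (1 - v)\<close> and a Vitali
  covering show that \<open>v\<close> exceeds \<open>1/2\<close> on a large set unless its energy is already large; in
  the former case its energy is large by the Poincare inequality.
\<close>

section \<open>Length and arc-length parametrization of curves\<close>

text \<open>An upper bound for a capacity needs one good function, and smooth ones suffice. Both
  implications also need lower bounds, which concern every Newtonian competitor. Its values are
  prescribed pointwise, so null sets cannot be discarded, and mollifying it directly would lose the
  value 1 on the compact set. Hence only its upper gradient is kept, and a new function is rebuilt
  from it as a weighted distance to the complement of the ball. Limits of paths are merely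
  1-Lipschitz, so integrals along such paths have to be compared with line integrals, which use arc
  length. The capacity of a closed ball of radius r in its double lies between multiples of r^(n-p);
  this makes all estimates scale invariant. Powers enter through the convexity of t^p, which covers
  p = 1 as well.\<close>

definition chain_length :: "(real \<Rightarrow> 'a::metric_space) \<Rightarrow> real list \<Rightarrow> real" where
  "chain_length \<gamma> ts = (\<Sum>i<length ts - 1. dist (\<gamma> (ts ! i)) (\<gamma> (ts ! Suc i)))"

lemma chain_length_simps [simp]:
  "chain_length \<gamma> [] = 0" "chain_length \<gamma> [x] = 0"
  "chain_length \<gamma> (x # y # ts) = dist (\<gamma> x) (\<gamma> y) + chain_length \<gamma> (y # ts)"
  by (simp_all add: chain_length_def sum.lessThan_Suc_shift del: sum.lessThan_Suc)

lemma chain_length_nonneg [simp]: "0 \<le> chain_length \<gamma> ts"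
  by (simp add: chain_length_def sum_nonneg)

lemma path_length_eq_SUP_chain:
  "path_length \<gamma> a b = (SUP ts\<in>{ts. sorted ts \<and> set ts \<subseteq> {a..b}}. ennreal (chain_length \<gamma> ts))"
  by (simp add: path_length_def chain_length_def)

lemma chain_length_le_path_length:
  "sorted ts \<Longrightarrow> set ts \<subseteq> {a..b} \<Longrightarrow> ennreal (chain_length \<gamma> ts) \<le> path_length \<gamma> a b"
  unfolding path_length_eq_SUP_chain by (rule SUP_upper) auto

lemma path_length_leI:
  assumes "\<And>ts. sorted ts \<Longrightarrow> set ts \<subseteq> {a..b} \<Longrightarrow> ennreal (chain_length \<gamma> ts) \<le> c"
  shows "path_length \<gamma> a b \<le> c"
  unfolding path_length_eq_SUP_chain by (rule SUP_least) (use assms in auto)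

lemma dist_le_path_length:
  assumes "a \<le> b" shows "ennreal (dist (\<gamma> a) (\<gamma> b)) \<le> path_length \<gamma> a b"
  using chain_length_le_path_length[of "[a, b]" a b \<gamma>] assms by simp

lemma chain_length_append_ge:
  "chain_length \<gamma> xs + chain_length \<gamma> ys \<le> chain_length \<gamma> (xs @ ys)"
proof (induction xs)
  case (Cons x xs)
  then show ?case by (cases xs; cases ys) auto
qed simp

lemma chain_length_insert:
  "chain_length \<gamma> (xs @ ys) \<le> chain_length \<gamma> (xs @ [b]) + chain_length \<gamma> (b # ys)"
proof (induction xs)
  case Nil
  then show ?case by (cases ys) auto
next
  case (Cons x xs)
  show ?case
  proof (cases xs)
    case Nil
    then show ?thesis
      using dist_triangle[of "\<gamma> x" _ "\<gamma> b"] by (cases ys) (auto simp: algebra_simps)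
  next
    case (Cons y zs)
    then show ?thesis using Cons.IH by simp
  qed
qed

text \<open>A chain in \<open>{a..c}\<close> is cut at \<open>b\<close>, the extra node only
  lengthening it; conversely, two chains concatenate to one, which only adds a link.\<close>

lemma path_length_add:
  assumes "a \<le> b" "b \<le> c"
  shows "path_length \<gamma> a c = path_length \<gamma> a b + path_length \<gamma> b c"
proof (rule antisym)
  show "path_length \<gamma> a c \<le> path_length \<gamma> a b + path_length \<gamma> b c"
  proof (rule path_length_leI)
    fix ts assume ts: "sorted ts" "set ts \<subseteq> {a..c}"
    define xs where "xs = filter (\<lambda>t. t \<le> b) ts"
    define ys where "ys = filter (\<lambda>t. \<not> t \<le> b) ts"
    have "ts = xs @ ys"
      using ts(1) unfolding xs_def ys_def
    proof (induction ts)
      case (Cons t ts)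
      have "t > b \<Longrightarrow> filter (\<lambda>t. t \<le> b) ts = []"
        using Cons.prems by (auto simp: filter_empty_conv)
      with Cons show ?case by (cases "t \<le> b") (auto simp: filter_empty_conv)
    qed simp
    have "ennreal (chain_length \<gamma> ts) \<le> ennreal (chain_length \<gamma> (xs @ [b]) + chain_length \<gamma> (b # ys))"
      unfolding \<open>ts = xs @ ys\<close> by (rule ennreal_leI[OF chain_length_insert])
    also have "\<dots> = ennreal (chain_length \<gamma> (xs @ [b])) + ennreal (chain_length \<gamma> (b # ys))"
      by (simp add: ennreal_plus)
    also have "\<dots> \<le> path_length \<gamma> a b + path_length \<gamma> b c"
      by (intro add_mono chain_length_le_path_length)
        (use ts assms in \<open>auto simp: xs_def ys_def sorted_append intro!: sorted_wrt_filter\<close>)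
    finally show "ennreal (chain_length \<gamma> ts) \<le> path_length \<gamma> a b + path_length \<gamma> b c" .
  qed
next
  have *: "ennreal (chain_length \<gamma> xs) + ennreal (chain_length \<gamma> ys) \<le> path_length \<gamma> a c"
    if "sorted xs" "set xs \<subseteq> {a..b}" "sorted ys" "set ys \<subseteq> {b..c}" for xs ys
  proof -
    have "ennreal (chain_length \<gamma> xs) + ennreal (chain_length \<gamma> ys) = ennreal (chain_length \<gamma> xs + chain_length \<gamma> ys)"
      by (simp add: ennreal_plus)
    also have "\<dots> \<le> ennreal (chain_length \<gamma> (xs @ ys))"
      by (rule ennreal_leI[OF chain_length_append_ge])
    also have "\<dots> \<le> path_length \<gamma> a c"
      by (rule chain_length_le_path_length) (use that assms in \<open>fastforce simp: sorted_append\<close>)+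
    finally show ?thesis .
  qed
  \<comment> \<open>A constant may be added inside a supremum only over a nonempty index set; the
    empty chain is a member.\<close>
  have ne: "{ts. sorted ts \<and> set ts \<subseteq> {s..t::real}} \<noteq> {}" for s t
    by (auto intro: exI[of _ "[]"])
  have "path_length \<gamma> a b + ennreal (chain_length \<gamma> ys) \<le> path_length \<gamma> a c"
    if "sorted ys" "set ys \<subseteq> {b..c}" for ys
    unfolding path_length_eq_SUP_chain[of \<gamma> a b]
    by (subst ennreal_SUP_add_left[OF ne, symmetric]) (intro SUP_least, use * that in auto)
  then show "path_length \<gamma> a b + path_length \<gamma> b c \<le> path_length \<gamma> a c"
    unfolding path_length_eq_SUP_chain[of \<gamma> b c]
    by (subst ennreal_SUP_add_right[OF ne]) (auto intro!: SUP_least)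
qed

lemma path_length_refl [simp]: "path_length \<gamma> a a = 0"
proof -
  have "chain_length \<gamma> ts = 0" if "set ts \<subseteq> {a..a}" for ts
    using that
  proof (induction ts)
    case (Cons t ts) then show ?case by (cases ts) auto
  qed simp
  then have "path_length \<gamma> a a \<le> 0" by (intro path_length_leI) simp
  then show ?thesis by simp
qed

lemma path_length_lipschitz:
  assumes "1-lipschitz_on {a..b} \<gamma>" "a \<le> b"
  shows "path_length \<gamma> a b \<le> ennreal (b - a)"
proof (rule path_length_leI)
  fix ts assume ts: "sorted ts" "set ts \<subseteq> {a..b}"
  have "chain_length \<gamma> ts \<le> last ts - hd ts" if "ts \<noteq> []" using ts that
  proof (induction ts)
    case (Cons t ts)
    show ?case
    proof (cases ts)
      case (Cons s rs)
      have "dist (\<gamma> t) (\<gamma> s) \<le> 1 * dist t s"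
        using lipschitz_onD[OF assms(1)] Cons.prems Cons by auto
      also have "\<dots> = s - t" using Cons.prems Cons by (auto simp: dist_real_def)
      finally show ?thesis using Cons.IH Cons.prems Cons by auto
    qed simp
  qed simp
  moreover have "last ts - hd ts \<le> b - a" if "ts \<noteq> []"
  proof -
    have "last ts \<in> set ts" "hd ts \<in> set ts" using that by auto
    then have "last ts \<in> {a..b}" "hd ts \<in> {a..b}" using ts(2) by blast+
    then show ?thesis by simp
  qed
  ultimately have "chain_length \<gamma> ts \<le> b - a" using assms(2) by (cases "ts = []") auto
  then show "ennreal (chain_length \<gamma> ts) \<le> ennreal (b - a)" by (rule ennreal_leI)
qed

text \<open>The nodes are functions of \<open>t\<close>, so that one chain can be deformed into
  \<open>{a..t}\<close> or \<open>{t..b}\<close> while keeping its number of links.\<close>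

lemma continuous_on_chain_length:
  assumes "continuous_on {a..b} \<gamma>" "\<And>f. f \<in> set fs \<Longrightarrow> continuous_on {a..b} f \<and> f ` {a..b} \<subseteq> {a..b}"
  shows "continuous_on {a..b} (\<lambda>t. chain_length \<gamma> (map (\<lambda>f. f t) fs))"
proof -
  have *: "continuous_on {a..b} (\<lambda>t. \<gamma> (f t))" if "f \<in> set fs" for f
    using assms(2)[OF that] by (intro continuous_on_compose2[OF assms(1)]) auto
  show ?thesis unfolding chain_length_def
    by (auto intro!: continuous_intros *)
qed

text \<open>Both \<open>t \<mapsto> path_length \<gamma> a t\<close> and \<open>t \<mapsto> path_length \<gamma> t b\<close> are suprema of continuous functions
  (move every node of a chain into \<open>[a,t]\<close>, respectively \<open>[t,b]\<close>), hence lower semicontinuous,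
  and their sum is constant.\<close>

lemma path_length_lsc_left:
  assumes "continuous_on {a..b} \<gamma>" "t \<in> {a..b}" "ennreal y < path_length \<gamma> a t" "0 \<le> y"
  shows "\<forall>\<^sub>F s in at t within {a..b}. ennreal y < path_length \<gamma> a s"
proof -
  obtain ts where ts: "sorted ts" "set ts \<subseteq> {a..t}" "ennreal y < ennreal (chain_length \<gamma> ts)"
    using assms(3) unfolding path_length_eq_SUP_chain less_SUP_iff by auto
  define F where "F s = chain_length \<gamma> (map (\<lambda>f. f s) (map (\<lambda>x s. min x s) ts))" for s
  have "map (\<lambda>f. f t) (map (\<lambda>x s. min x s) ts) = ts"
    using ts(2) by (auto simp: o_def intro!: map_idI)
  then have Ft: "F t = chain_length \<gamma> ts" by (simp add: F_def)
  have "continuous_on {a..b} F"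
    unfolding F_def by (rule continuous_on_chain_length[OF assms(1)])
      (use ts(2) assms(2) in \<open>auto intro!: continuous_intros simp: min_le_iff_disj\<close>)
  then have "(F \<longlongrightarrow> F t) (at t within {a..b})"
    using assms(2) by (auto simp: continuous_on_def)
  moreover have "y < F t" using ts(3) assms(4) by (simp add: Ft ennreal_less_iff)
  ultimately have "\<forall>\<^sub>F s in at t within {a..b}. y < F s" by (rule order_tendstoD)
  moreover have "\<forall>\<^sub>F s in at t within {a..b}. s \<in> {a..b}" by (simp add: eventually_at_filter)
  ultimately show ?thesis
  proof eventually_elim
    case (elim s)
    have "ennreal y < ennreal (F s)" using elim assms(4) by (simp add: ennreal_less_iff)
    also have "\<dots> \<le> path_length \<gamma> a s" unfolding F_def
      by (rule chain_length_le_path_length)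
        (use elim ts in \<open>auto simp: o_def sorted_map min_le_iff_disj intro!: sorted_wrt_mono_rel[OF _ ts(1)]\<close>)
    finally show ?case .
  qed
qed

lemma path_length_lsc_right:
  assumes "continuous_on {a..b} \<gamma>" "t \<in> {a..b}" "ennreal y < path_length \<gamma> t b" "0 \<le> y"
  shows "\<forall>\<^sub>F s in at t within {a..b}. ennreal y < path_length \<gamma> s b"
proof -
  obtain ts where ts: "sorted ts" "set ts \<subseteq> {t..b}" "ennreal y < ennreal (chain_length \<gamma> ts)"
    using assms(3) unfolding path_length_eq_SUP_chain less_SUP_iff by auto
  define F where "F s = chain_length \<gamma> (map (\<lambda>f. f s) (map (\<lambda>x s. max x s) ts))" for s
  have "map (\<lambda>f. f t) (map (\<lambda>x s. max x s) ts) = ts"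
    using ts(2) by (auto simp: o_def intro!: map_idI)
  then have Ft: "F t = chain_length \<gamma> ts" by (simp add: F_def)
  have "continuous_on {a..b} F"
    unfolding F_def by (rule continuous_on_chain_length[OF assms(1)])
      (use ts(2) assms(2) in \<open>auto intro!: continuous_intros simp: le_max_iff_disj\<close>)
  then have "(F \<longlongrightarrow> F t) (at t within {a..b})"
    using assms(2) by (auto simp: continuous_on_def)
  moreover have "y < F t" using ts(3) assms(4) by (simp add: Ft ennreal_less_iff)
  ultimately have "\<forall>\<^sub>F s in at t within {a..b}. y < F s" by (rule order_tendstoD)
  moreover have "\<forall>\<^sub>F s in at t within {a..b}. s \<in> {a..b}" by (simp add: eventually_at_filter)
  ultimately show ?thesis
  proof eventually_elim
    case (elim s)
    have "ennreal y < ennreal (F s)" using elim assms(4) by (simp add: ennreal_less_iff)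
    also have "\<dots> \<le> path_length \<gamma> s b" unfolding F_def
      by (rule chain_length_le_path_length)
        (use elim ts in \<open>auto simp: o_def sorted_map le_max_iff_disj intro!: sorted_wrt_mono_rel[OF _ ts(1)]\<close>)
    finally show ?case .
  qed
qed

lemma continuous_on_path_length:
  assumes "continuous_on {a..b} \<gamma>" "path_length \<gamma> a b < \<infinity>" "a \<le> b"
  shows "continuous_on {a..b} (\<lambda>t. enn2real (path_length \<gamma> a t))"
  unfolding continuous_on_def
proof
  fix t assume t: "t \<in> {a..b}"
  define T where "T = path_length \<gamma> a b"
  have add: "path_length \<gamma> a s + path_length \<gamma> s b = T" if "s \<in> {a..b}" for s
    using path_length_add[of a s b \<gamma>] that by (simp add: T_def)
  have fin: "path_length \<gamma> a s < \<infinity>" "path_length \<gamma> s b < \<infinity>" if "s \<in> {a..b}" for s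
    using add[OF that] assms(2) unfolding T_def[symmetric]
    by (metis infinity_ennreal_def ennreal_add_eq_top top.not_eq_extremum)+
  define l r where "l s = enn2real (path_length \<gamma> a s)" and "r s = enn2real (path_length \<gamma> s b)" for s
  have lr: "path_length \<gamma> a s = ennreal (l s)" "path_length \<gamma> s b = ennreal (r s)" if "s \<in> {a..b}" for s
    using fin[OF that] by (auto simp: l_def r_def)
  have nn: "0 \<le> l s" "0 \<le> r s" for s by (auto simp: l_def r_def)
  have sum: "l s + r s = enn2real T" if "s \<in> {a..b}" for s
    using add[OF that] fin[OF that] by (metis enn2real_plus infinity_ennreal_def l_def r_def)
  have ev: "\<forall>\<^sub>F s in at t within {a..b}. s \<in> {a..b}" by (simp add: eventually_at_filter)
  show "((\<lambda>t. enn2real (path_length \<gamma> a t)) \<longlongrightarrow> enn2real (path_length \<gamma> a t)) (at t within {a..b})"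
    unfolding l_def[symmetric]
  proof (rule order_tendstoI)
    fix y assume y: "y < l t"
    show "\<forall>\<^sub>F s in at t within {a..b}. y < l s"
    proof (cases "0 \<le> y")
      case True
      have "\<forall>\<^sub>F s in at t within {a..b}. ennreal y < path_length \<gamma> a s"
        by (rule path_length_lsc_left[OF assms(1) t]) (use y True lr[OF t] in \<open>auto simp: ennreal_less_iff\<close>)
      with ev show ?thesis by eventually_elim (use True lr in \<open>auto simp: ennreal_less_iff\<close>)
    next
      case False
      then show ?thesis using nn(1) by (intro always_eventually allI) (meson not_le order.strict_trans2)
    qed
  next
    fix y assume y: "l t < y"
    \<comment> \<open>The initial and final lengths add up to a constant, so an upper bound
      \<open>y\<close> for \<open>l\<close> is the lower bound \<open>z\<close> for
      \<open>r\<close>.\<close>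
    define z where "z = enn2real T - y"
    have z: "z < r t" using y sum[OF t] by (simp add: z_def)
    have "\<forall>\<^sub>F s in at t within {a..b}. z < r s"
    proof (cases "0 \<le> z")
      case True
      have "\<forall>\<^sub>F s in at t within {a..b}. ennreal z < path_length \<gamma> s b"
        by (rule path_length_lsc_right[OF assms(1) t]) (use z True lr[OF t] in \<open>auto simp: ennreal_less_iff\<close>)
      with ev show ?thesis by eventually_elim (use True lr in \<open>auto simp: ennreal_less_iff\<close>)
    next
      case False
      then show ?thesis using nn(2) by (intro always_eventually allI) (meson not_le order.strict_trans2)
    qed
    with ev show "\<forall>\<^sub>F s in at t within {a..b}. l s < y"
      by eventually_elim (use sum in \<open>force simp: z_def\<close>)
  qed
qed

section \<open>The arc-length parametrization\<close>

lemma path_length_finite_sub: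
  assumes "path_length \<gamma> a b < \<infinity>" "a \<le> s" "s \<le> t" "t \<le> b"
  shows "path_length \<gamma> s t < \<infinity>"
  using assms path_length_add[of a s b \<gamma>] path_length_add[of s t b \<gamma>]
  by (auto simp: less_top[symmetric])

text \<open>\<open>arc_param\<close> picks some parameter of the right length, possibly not
  \<open>t\<close>. Cancelling finite lengths shows that the piece between the two parameters has
  length 0, so \<open>\<gamma>\<close> agrees at both.\<close>

lemma arc_param_path_length:
  assumes "path_length \<gamma> a b < \<infinity>" "t \<in> {a..b}"
  shows "arc_param (a, b, \<gamma>) (enn2real (path_length \<gamma> a t)) = \<gamma> t"
proof -
  have fin: "path_length \<gamma> a t < \<infinity>" by (rule path_length_finite_sub[OF assms(1)]) (use assms in auto)
  define P where "P t' \<longleftrightarrow> t' \<in> {a..b} \<and> path_length \<gamma> a t' = ennreal (enn2real (path_length \<gamma> a t))" for t'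
  have "P t" using assms fin by (auto simp: P_def)
  then have P: "P (SOME t. P t)" by (rule someI)
  define t' where "t' = (SOME t. P t)"
  have eq: "path_length \<gamma> a t' = path_length \<gamma> a t" "t' \<in> {a..b}"
    using P fin unfolding t'_def[symmetric] by (simp_all add: P_def)
  have *: "\<gamma> s = \<gamma> u" if "s \<le> u" "s \<in> {a..b}" "path_length \<gamma> a s = path_length \<gamma> a u" "path_length \<gamma> a u < \<infinity>" for s u
  proof -
    have "path_length \<gamma> a u = path_length \<gamma> a s + path_length \<gamma> s u" using that path_length_add[of a s u \<gamma>] by simp
    then have "path_length \<gamma> s u = 0"
      using that(3,4) by (metis add.right_neutral ennreal_add_left_cancel infinity_ennreal_def less_irrefl)
    then have "ennreal (dist (\<gamma> s) (\<gamma> u)) \<le> 0" using dist_le_path_length[OF that(1), of \<gamma>] by simp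
    then show ?thesis by simp
  qed
  have "\<gamma> t' = \<gamma> t"
  proof (cases "t' \<le> t")
    case True then show ?thesis using *[OF True] eq fin by auto
  next
    case False then show ?thesis using *[of t t'] eq fin assms(2) by auto
  qed
  then show ?thesis by (simp add: arc_param_def t'_def P_def)
qed

lemma path_length_surj:
  assumes "continuous_on {a..b} \<gamma>" "path_length \<gamma> a b < \<infinity>" "a \<le> b"
    "s \<in> {0..enn2real (path_length \<gamma> a b)}"
  obtains t where "t \<in> {a..b}" "enn2real (path_length \<gamma> a t) = s"
  using IVT'[of "\<lambda>t. enn2real (path_length \<gamma> a t)" a s b] continuous_on_path_length[OF assms(1-3)] assms
  by auto

lemma enn2real_path_length_diff:
  assumes "path_length \<gamma> a b < \<infinity>" "a \<le> s" "s \<le> t" "t \<le> b"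
  shows "enn2real (path_length \<gamma> a t) - enn2real (path_length \<gamma> a s) = enn2real (path_length \<gamma> s t)"
proof -
  have "path_length \<gamma> a s < \<infinity>" "path_length \<gamma> s t < \<infinity>"
    using path_length_finite_sub[OF assms(1)] assms by auto
  then show ?thesis using path_length_add[OF assms(2,3), of \<gamma>] by (simp add: enn2real_plus)
qed

text \<open>A chord is at most as long as its arc, and by the intermediate value theorem every
  number in the domain is the length of an initial piece.\<close>

lemma arc_param_lipschitz:
  assumes "continuous_on {a..b} \<gamma>" "path_length \<gamma> a b < \<infinity>" "a \<le> b"
  shows "1-lipschitz_on {0..enn2real (path_length \<gamma> a b)} (arc_param (a, b, \<gamma>))"
proof (rule lipschitz_onI)
  define l where "l t = enn2real (path_length \<gamma> a t)" for t
  have *: "dist (arc_param (a, b, \<gamma>) (l t)) (arc_param (a, b, \<gamma>) (l t')) \<le> dist (l t) (l t')"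
    if "t \<le> t'" "t \<in> {a..b}" "t' \<in> {a..b}" for t t'
  proof -
    have "ennreal (dist (\<gamma> t) (\<gamma> t')) \<le> path_length \<gamma> t t'"
      by (rule dist_le_path_length) fact
    also have "\<dots> = ennreal (l t' - l t)"
      using enn2real_path_length_diff[OF assms(2), of t t'] path_length_finite_sub[OF assms(2), of t t'] that
      by (simp add: l_def)
    finally have "dist (\<gamma> t) (\<gamma> t') \<le> \<bar>l t' - l t\<bar>"
      by (cases "0 \<le> l t' - l t") (auto simp: ennreal_neg)
    then show ?thesis
      using arc_param_path_length[OF assms(2)] that by (simp add: l_def dist_real_def abs_minus_commute)
  qed
  fix x y assume xy: "x \<in> {0..enn2real (path_length \<gamma> a b)}" "y \<in> {0..enn2real (path_length \<gamma> a b)}"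
  obtain t t' where t: "t \<in> {a..b}" "l t = x" "t' \<in> {a..b}" "l t' = y"
    using path_length_surj[OF assms] xy unfolding l_def by metis
  show "dist (arc_param (a, b, \<gamma>) x) (arc_param (a, b, \<gamma>) y) \<le> 1 * dist x y"
    using *[of t t'] *[of t' t] t by (cases "t \<le> t'") (auto simp: dist_commute)
qed simp

lemma arc_param_mem:
  assumes "continuous_on {a..b} \<gamma>" "path_length \<gamma> a b < \<infinity>" "a \<le> b"
    "s \<in> {0..enn2real (path_length \<gamma> a b)}"
  shows "arc_param (a, b, \<gamma>) s \<in> \<gamma> ` {a..b}"
proof -
  obtain t where "t \<in> {a..b}" "enn2real (path_length \<gamma> a t) = s"
    using path_length_surj[OF assms] by auto
  then show ?thesis using arc_param_path_length[OF assms(2)] by force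
qed

section \<open>Line integrals\<close>

text \<open>Replaces the fundamental theorem of calculus when \<open>w\<close> comes from a merely
  Lipschitz path. Only small intervals around \<open>t\<close> are compared: bisection
  (\<open>Bolzano\<close>) reduces the claim to these, and additivity of the integral passes it on
  to unions.\<close>

lemma increment_le_integral:
  fixes w g :: "real \<Rightarrow> real"
  assumes "a \<le> b" and g: "continuous_on {a..b} g"
    and loc: "\<And>t e. t \<in> {a..b} \<Longrightarrow> e > 0 \<Longrightarrow> \<exists>d>0. \<forall>s u. a \<le> s \<and> s \<le> t \<and> t \<le> u \<and> u \<le> b \<and> u - s < d
      \<longrightarrow> w u - w s \<le> (g t + e) * (u - s)"
  shows "w b - w a \<le> integral {a..b} g"
proof -
  have *: "w b - w a \<le> integral {a..b} g + e * (b - a)" if "e > 0" for e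
  proof -
    define P where "P s u \<longleftrightarrow> (a \<le> s \<and> u \<le> b \<longrightarrow> w u - w s \<le> integral {s..u} g + e * (u - s))" for s u
    have int: "g integrable_on {s..u}" if "a \<le> s" "u \<le> b" for s u
      by (rule integrable_continuous_interval[OF continuous_on_subset[OF g]]) (use that in auto)
    have "P a b" using \<open>a \<le> b\<close>
    proof (induction rule: Bolzano)
      case (trans s t u)
      show ?case unfolding P_def
      proof
        assume A: "a \<le> s \<and> u \<le> b"
        have "integral {s..t} g + integral {t..u} g = integral {s..u} g"
          by (rule Henstock_Kurzweil_Integration.integral_combine[OF _ _ int]) (use trans A in auto)
        moreover have "w t - w s \<le> integral {s..t} g + e * (t - s)" "w u - w t \<le> integral {t..u} g + e * (u - t)"
          using trans A by (auto simp: P_def)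
        ultimately show "w u - w s \<le> integral {s..u} g + e * (u - s)" by (simp add: algebra_simps)
      qed
    next
      case (local t)
      then have t: "t \<in> {a..b}" by simp
      obtain d1 where d1: "d1 > 0" "\<And>s u. a \<le> s \<Longrightarrow> s \<le> t \<Longrightarrow> t \<le> u \<Longrightarrow> u \<le> b \<Longrightarrow> u - s < d1
          \<Longrightarrow> w u - w s \<le> (g t + e/2) * (u - s)"
        using loc[OF t, of "e/2"] \<open>e > 0\<close> by auto
      obtain d2 where d2: "d2 > 0" "\<And>s. s \<in> {a..b} \<Longrightarrow> dist s t < d2 \<Longrightarrow> dist (g s) (g t) < e/2"
        using g t \<open>e > 0\<close> unfolding continuous_on_iff by (metis half_gt_zero)
      show ?case
      proof (intro exI[of _ "min d1 d2"] conjI allI impI)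
        fix s u assume A: "s \<le> t \<and> t \<le> u \<and> u - s < min d1 d2"
        show "P s u" unfolding P_def
        proof
          assume B: "a \<le> s \<and> u \<le> b"
          have "w u - w s \<le> (g t + e/2) * (u - s)" using d1 A B by auto
          also have "\<dots> = integral {s..u} (\<lambda>_. g t - e/2) + e * (u - s)"
            using A by (simp add: algebra_simps)
          also have "integral {s..u} (\<lambda>_. g t - e/2) \<le> integral {s..u} g"
          proof (rule integral_le)
            fix r assume "r \<in> {s..u}"
            then have "dist (g r) (g t) < e/2" using A B by (intro d2) (auto simp: dist_real_def)
            then show "g t - e/2 \<le> g r" by (simp add: dist_real_def abs_if split: if_splits)
          qed (use B int in auto)
          finally show "w u - w s \<le> integral {s..u} g + e * (u - s)" by simp
        qed
      qed (use d1 d2 in auto)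
    qed
    then show ?thesis by (simp add: P_def)
  qed
  show ?thesis
  proof (rule field_le_epsilon)
    fix e :: real assume "e > 0"
    \<comment> \<open>The summand 1 keeps the denominator positive when
      \<open>a = b\<close>.\<close>
    have "w b - w a \<le> integral {a..b} g + e / (b - a + 1) * (b - a)"
      by (rule *) (use \<open>e > 0\<close> assms(1) in auto)
    also have "e / (b - a + 1) * (b - a) \<le> e"
      using \<open>e > 0\<close> assms(1) by (simp add: field_simps)
    finally show "w b - w a \<le> integral {a..b} g + e" by simp
  qed
qed

lemma nn_integral_continuous_interval:
  fixes g :: "real \<Rightarrow> real"
  assumes "continuous_on {a..b} g" "\<And>t. t \<in> {a..b} \<Longrightarrow> 0 \<le> g t"
  shows "(\<integral>\<^sup>+t\<in>{a..b}. ennreal (g t) \<partial>lborel) = ennreal (integral {a..b} g)"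
  using nn_integral_has_integral_lebesgue'[of "{a..b}" g] assms
  by (simp add: integrable_integral integrable_continuous_interval)

lemma lipschitz_has_derivative_local:
  fixes v :: "'a::euclidean_space \<Rightarrow> real"
  assumes D: "\<And>x. (v has_derivative (\<lambda>h. D x \<bullet> h)) (at x)" and "continuous_on UNIV D" and "e > 0"
  obtains d where "d > 0" "\<And>y z. y \<in> ball x d \<Longrightarrow> z \<in> ball x d \<Longrightarrow> \<bar>v y - v z\<bar> \<le> (norm (D x) + e) * dist y z"
proof -
  obtain d where d: "d > 0" "\<And>y. dist y x < d \<Longrightarrow> dist (D y) (D x) < e"
    using assms(2,3) unfolding continuous_on_iff by (metis UNIV_I)
  have "\<bar>v y - v z\<bar> \<le> (norm (D x) + e) * dist y z" if "y \<in> ball x d" "z \<in> ball x d" for y z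
  proof -
    have "norm (v y - v z) \<le> (norm (D x) + e) * norm (y - z)"
    proof (rule differentiable_bound[of "ball x d" v "\<lambda>x h. D x \<bullet> h"])
      fix y assume "y \<in> ball x d"
      then have "dist (D y) (D x) < e" by (intro d) (simp add: dist_commute)
      then have "norm (D y) \<le> norm (D x) + e"
        using norm_triangle_ineq2[of "D y" "D x"] by (simp add: dist_norm)
      moreover have "onorm (\<lambda>h. D y \<bullet> h) \<le> norm (D y)"
        by (rule onorm_le) (simp add: Cauchy_Schwarz_ineq2)
      ultimately show "onorm (\<lambda>h. D y \<bullet> h) \<le> norm (D x) + e" by simp
    qed (use that D in \<open>auto intro: has_derivative_at_withinI\<close>)
    then show ?thesis by (simp add: dist_norm)
  qed
  with d(1) show thesis by (rule that)
qed

text \<open>The path need not be differentiable: near \<open>\<sigma> t\<close> the function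
  \<open>v\<close> is Lipschitz with constant \<open>norm (D (\<sigma> t)) + e\<close>, and
  \<open>\<sigma>\<close> does not increase distances.\<close>

lemma lipschitz_curve_increment:
  fixes v :: "'a::euclidean_space \<Rightarrow> real" and a b :: real
  assumes D: "\<And>x. (v has_derivative (\<lambda>h. D x \<bullet> h)) (at x)" "continuous_on UNIV D"
    and "a \<le> b" and \<sigma>: "1-lipschitz_on {a..b} \<sigma>"
  shows "v (\<sigma> b) - v (\<sigma> a) \<le> integral {a..b} (\<lambda>t. norm (D (\<sigma> t)))"
proof (rule increment_le_integral[OF \<open>a \<le> b\<close>])
  show "continuous_on {a..b} (\<lambda>t. norm (D (\<sigma> t)))"
    by (intro continuous_on_norm continuous_on_compose2[OF D(2)] lipschitz_on_continuous_on[OF \<sigma>]) auto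
next
  fix t e :: real assume t: "t \<in> {a..b}" and "e > 0"
  obtain d where d: "d > 0" "\<And>y z. y \<in> ball (\<sigma> t) d \<Longrightarrow> z \<in> ball (\<sigma> t) d \<Longrightarrow>
      \<bar>v y - v z\<bar> \<le> (norm (D (\<sigma> t)) + e) * dist y z"
    using lipschitz_has_derivative_local[OF D \<open>e > 0\<close>] by blast
  show "\<exists>d>0. \<forall>s u. a \<le> s \<and> s \<le> t \<and> t \<le> u \<and> u \<le> b \<and> u - s < d
      \<longrightarrow> v (\<sigma> u) - v (\<sigma> s) \<le> (norm (D (\<sigma> t)) + e) * (u - s)"
  proof (intro exI[of _ d] conjI allI impI d)
    fix s u assume A: "a \<le> s \<and> s \<le> t \<and> t \<le> u \<and> u \<le> b \<and> u - s < d"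
    have l: "dist (\<sigma> p) (\<sigma> q) \<le> dist p q" if "p \<in> {a..b}" "q \<in> {a..b}" for p q
      using lipschitz_onD[OF \<sigma> that] by simp
    have "\<sigma> s \<in> ball (\<sigma> t) d" "\<sigma> u \<in> ball (\<sigma> t) d"
      using l[of t s] l[of t u] A t by (auto simp: dist_real_def)
    then have "\<bar>v (\<sigma> u) - v (\<sigma> s)\<bar> \<le> (norm (D (\<sigma> t)) + e) * dist (\<sigma> u) (\<sigma> s)" by (intro d)
    also have "\<dots> \<le> (norm (D (\<sigma> t)) + e) * (u - s)"
      using l[of u s] A t \<open>e > 0\<close> by (intro mult_left_mono) (auto simp: dist_real_def)
    finally show "v (\<sigma> u) - v (\<sigma> s) \<le> (norm (D (\<sigma> t)) + e) * (u - s)" by simp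
  qed
qed

lemma is_curveD:
  assumes "is_curve (a, b, \<gamma>)"
  shows "a \<le> b" "continuous_on {a..b} \<gamma>" "path_length \<gamma> a b < \<infinity>"
  using assms by (auto simp: is_curve_def)

lemma abs_diff_le_line_integral:
  fixes v :: "'a::euclidean_space \<Rightarrow> real"
  assumes D: "\<And>x. (v has_derivative (\<lambda>h. D x \<bullet> h)) (at x)" "continuous_on UNIV D"
    and "is_curve (a, b, \<gamma>)"
  shows "ennreal \<bar>v (\<gamma> a) - v (\<gamma> b)\<bar> \<le> line_integral (\<lambda>x. ennreal (norm (D x))) (a, b, \<gamma>)"
proof -
  note c = is_curveD[OF assms(3)]
  define L where "L = enn2real (path_length \<gamma> a b)"
  define \<sigma> where "\<sigma> = arc_param (a, b, \<gamma>)"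
  have \<sigma>: "1-lipschitz_on {0..L} \<sigma>" unfolding L_def \<sigma>_def by (rule arc_param_lipschitz) fact+
  have ends: "\<sigma> 0 = \<gamma> a" "\<sigma> L = \<gamma> b"
    using arc_param_path_length[OF c(3), of a] arc_param_path_length[OF c(3), of b] c
    by (auto simp: \<sigma>_def L_def)
  have D': "\<And>x. ((\<lambda>x. - v x) has_derivative (\<lambda>h. (- D x) \<bullet> h)) (at x)" "continuous_on UNIV (\<lambda>x. - D x)"
    using has_derivative_minus[OF D(1)] D(2) by (auto intro: continuous_intros)
  have "0 \<le> L" by (simp add: L_def)
  have "\<bar>v (\<gamma> a) - v (\<gamma> b)\<bar> \<le> integral {0..L} (\<lambda>t. norm (D (\<sigma> t)))"
    using lipschitz_curve_increment[OF D \<open>0 \<le> L\<close> \<sigma>] lipschitz_curve_increment[OF D' \<open>0 \<le> L\<close> \<sigma>] ends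
    by (auto simp: abs_le_iff)
  then have "ennreal \<bar>v (\<gamma> a) - v (\<gamma> b)\<bar> \<le> ennreal (integral {0..L} (\<lambda>t. norm (D (\<sigma> t))))"
    by (rule ennreal_leI)
  also have "\<dots> = (\<integral>\<^sup>+t\<in>{0..L}. ennreal (norm (D (\<sigma> t))) \<partial>lborel)"
    by (subst nn_integral_continuous_interval)
      (auto intro!: continuous_on_norm continuous_on_compose2[OF D(2)] lipschitz_on_continuous_on[OF \<sigma>])
  finally show ?thesis by (simp add: line_integral_def L_def \<sigma>_def)
qed

text \<open>\<open>line_integral\<close> refers to arc length \<open>l\<close>, whereas a limit of
  paths is only 1-Lipschitz in its parameter. Since \<open>l\<close> grows at most at unit speed,
  the integral over \<open>{0..l t}\<close> of \<open>h\<close> along the arc-length path grows at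
  rate at most \<open>h (\<sigma> t)\<close>, up to an arbitrarily small error.\<close>

lemma line_integral_le_lipschitz:
  fixes h :: "'a::metric_space \<Rightarrow> real" and a b :: real
  assumes h: "continuous_on UNIV h" "\<And>x. 0 \<le> h x"
    and "a \<le> b" and \<sigma>: "1-lipschitz_on {a..b} \<sigma>"
  shows "line_integral (\<lambda>x. ennreal (h x)) (a, b, \<sigma>) \<le> (\<integral>\<^sup>+t\<in>{a..b}. ennreal (h (\<sigma> t)) \<partial>lborel)"
proof -
  have fin: "path_length \<sigma> a b < \<infinity>" using path_length_lipschitz[OF \<sigma> \<open>a \<le> b\<close>]
    by (metis ennreal_less_top infinity_ennreal_def order.strict_trans1)
  have cont: "continuous_on {a..b} \<sigma>" by (rule lipschitz_on_continuous_on[OF \<sigma>])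
  define l where "l t = enn2real (path_length \<sigma> a t)" for t
  define A where "A = arc_param (a, b, \<sigma>)"
  define L where "L = l b"
  have lip: "1-lipschitz_on {0..L} A"
    using arc_param_lipschitz[OF cont fin \<open>a \<le> b\<close>] by (simp add: A_def L_def l_def)
  have hA: "continuous_on {0..L} (\<lambda>s. h (A s))"
    by (intro continuous_on_compose2[OF h(1)] lipschitz_on_continuous_on[OF lip]) auto
  have int: "(\<lambda>s. h (A s)) integrable_on {x..y}" if "0 \<le> x" "y \<le> L" for x y
    by (rule integrable_continuous_interval[OF continuous_on_subset[OF hA]]) (use that in auto)
  have ldiff: "l t - l s = enn2real (path_length \<sigma> s t)" "l t - l s \<le> t - s" "l s \<le> l t"
    if "a \<le> s" "s \<le> t" "t \<le> b" for s t
  proof -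
    show 1: "l t - l s = enn2real (path_length \<sigma> s t)"
      unfolding l_def by (rule enn2real_path_length_diff[OF fin that])
    have "path_length \<sigma> s t \<le> ennreal (t - s)"
      by (rule path_length_lipschitz[OF lipschitz_on_subset[OF \<sigma>]]) (use that in auto)
    then show "l t - l s \<le> t - s" unfolding 1 using that
      by (metis diff_ge_0_iff_ge enn2real_leI)
    have "0 \<le> l t - l s" unfolding 1 by simp
    then show "l s \<le> l t" by simp
  qed
  have l0: "l a = 0" by (simp add: l_def)
  have Al: "A (l t) = \<sigma> t" if "t \<in> {a..b}" for t
    unfolding A_def l_def by (rule arc_param_path_length[OF fin that])
  define w where "w t = integral {0..l t} (\<lambda>s. h (A s))" for t
  have h\<sigma>: "continuous_on {a..b} (\<lambda>t. h (\<sigma> t))"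
    by (intro continuous_on_compose2[OF h(1)] cont) auto
  have "w b - w a \<le> integral {a..b} (\<lambda>t. h (\<sigma> t))"
  proof (rule increment_le_integral[OF \<open>a \<le> b\<close> h\<sigma>])
    fix t e :: real assume t: "t \<in> {a..b}" and "e > 0"
    obtain d where d: "d > 0" "\<And>y. dist y (\<sigma> t) < d \<Longrightarrow> dist (h y) (h (\<sigma> t)) < e"
      using h(1) \<open>e > 0\<close> unfolding continuous_on_iff by (metis UNIV_I)
    show "\<exists>d>0. \<forall>s u. a \<le> s \<and> s \<le> t \<and> t \<le> u \<and> u \<le> b \<and> u - s < d
      \<longrightarrow> w u - w s \<le> (h (\<sigma> t) + e) * (u - s)"
    proof (intro exI[of _ d] conjI allI impI d)
      fix s u assume B: "a \<le> s \<and> s \<le> t \<and> t \<le> u \<and> u \<le> b \<and> u - s < d"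
      have ls: "0 \<le> l s" "l s \<le> l t" "l t \<le> l u" "l u \<le> L" "l u - l s \<le> u - s"
        using ldiff[of a s] ldiff[of s t] ldiff[of t u] ldiff[of u b] ldiff[of s u] B l0 by (auto simp: L_def)
      have "integral {0..l s} (\<lambda>s. h (A s)) + integral {l s..l u} (\<lambda>s. h (A s)) = integral {0..l u} (\<lambda>s. h (A s))"
        by (rule Henstock_Kurzweil_Integration.integral_combine[OF _ _ int]) (use ls in auto)
      then have "w u - w s = integral {l s..l u} (\<lambda>s. h (A s))" by (simp add: w_def)
      also have "\<dots> \<le> integral {l s..l u} (\<lambda>_. h (\<sigma> t) + e)"
      proof (rule integral_le)
        fix r assume r: "r \<in> {l s..l u}"
        have "dist (A r) (A (l t)) \<le> 1 * dist r (l t)"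
          by (rule lipschitz_onD[OF lip]) (use r ls in auto)
        also have "\<dots> < d" using r ls B by (auto simp: dist_real_def)
        finally have "dist (h (A r)) (h (\<sigma> t)) < e" using t by (intro d) (simp add: Al)
        then show "h (A r) \<le> h (\<sigma> t) + e" by (simp add: dist_real_def)
      qed (use ls int in auto)
      also have "\<dots> = (h (\<sigma> t) + e) * (l u - l s)" using ls by simp
      also have "\<dots> \<le> (h (\<sigma> t) + e) * (u - s)" 
        using ls h(2) \<open>e > 0\<close> by (intro mult_left_mono) (auto intro: add_nonneg_nonneg)
      finally show "w u - w s \<le> (h (\<sigma> t) + e) * (u - s)" .
    qed
  qed
  then have "integral {0..L} (\<lambda>s. h (A s)) \<le> integral {a..b} (\<lambda>t. h (\<sigma> t))"
    by (simp add: w_def l0 L_def)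
  then show ?thesis
    using nn_integral_continuous_interval[OF hA h(2)] nn_integral_continuous_interval[OF h\<sigma> h(2)]
    by (simp add: line_integral_def A_def L_def l_def ennreal_leI)
qed

text \<open>Monotone convergence extends the comparison to an increasing supremum of continuous
  weights, which is only lower semicontinuous and may be infinite.\<close>

lemma line_integral_SUP_le_lipschitz:
  fixes h :: "nat \<Rightarrow> 'a::metric_space \<Rightarrow> real" and a b :: real
  assumes h: "\<And>k. continuous_on UNIV (h k)" "\<And>k x. 0 \<le> h k x" "\<And>x. incseq (\<lambda>k. h k x)"
    and "a \<le> b" and \<sigma>: "1-lipschitz_on {a..b} \<sigma>"
  shows "line_integral (\<lambda>x. SUP k. ennreal (h k x)) (a, b, \<sigma>)
    \<le> (\<integral>\<^sup>+t\<in>{a..b}. (SUP k. ennreal (h k (\<sigma> t))) \<partial>lborel)"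
proof -
  have fin: "path_length \<sigma> a b < \<infinity>" using path_length_lipschitz[OF \<sigma> \<open>a \<le> b\<close>]
    by (metis ennreal_less_top infinity_ennreal_def order.strict_trans1)
  define A where "A = arc_param (a, b, \<sigma>)"
  define L where "L = enn2real (path_length \<sigma> a b)"
  have lip: "1-lipschitz_on {0..L} A"
    using arc_param_lipschitz[OF lipschitz_on_continuous_on[OF \<sigma>] fin \<open>a \<le> b\<close>] by (simp add: A_def L_def)
  have hA: "continuous_on {0..L} (\<lambda>s. h k (A s))" for k
    by (intro continuous_on_compose2[OF h(1)] lipschitz_on_continuous_on[OF lip]) auto
  have "(\<lambda>s. h k (A s) * indicator {0..L} s) \<in> borel_measurable borel" for k
    using borel_measurable_continuous_on_indicator[OF _ hA[of k]] by (simp add: mult.commute)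
  then have meas: "(\<lambda>s. ennreal (h k (A s)) * indicator {0..L} s) \<in> borel_measurable lborel" for k
    by (subst measurable_cong[where g="\<lambda>s. ennreal (h k (A s) * indicator {0..L} s)"])
      (auto simp: indicator_def)
  have "line_integral (\<lambda>x. SUP k. ennreal (h k x)) (a, b, \<sigma>)
      = (\<integral>\<^sup>+s. (SUP k. ennreal (h k (A s)) * indicator {0..L} s) \<partial>lborel)"
    by (simp add: line_integral_def A_def L_def SUP_mult_right_ennreal)
  also have "\<dots> = (SUP k. \<integral>\<^sup>+s. ennreal (h k (A s)) * indicator {0..L} s \<partial>lborel)"
  proof (rule nn_integral_monotone_convergence_SUP[OF _ meas])
    show "incseq (\<lambda>k s. ennreal (h k (A s)) * indicator {0..L} s)"
      using h(3) by (auto simp: incseq_def le_fun_def intro!: mult_right_mono ennreal_leI)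
  qed
  also have "\<dots> \<le> (\<integral>\<^sup>+t\<in>{a..b}. (SUP k. ennreal (h k (\<sigma> t))) \<partial>lborel)"
  proof (rule SUP_least)
    fix k
    have "(\<integral>\<^sup>+s. ennreal (h k (A s)) * indicator {0..L} s \<partial>lborel) \<le> (\<integral>\<^sup>+t\<in>{a..b}. ennreal (h k (\<sigma> t)) \<partial>lborel)"
      using line_integral_le_lipschitz[OF h(1,2) \<open>a \<le> b\<close> \<sigma>] by (simp add: line_integral_def A_def L_def)
    also have "\<dots> \<le> (\<integral>\<^sup>+t\<in>{a..b}. (SUP k. ennreal (h k (\<sigma> t))) \<partial>lborel)"
      by (intro nn_integral_mono mult_right_mono SUP_upper) auto
    finally show "(\<integral>\<^sup>+s. ennreal (h k (A s)) * indicator {0..L} s \<partial>lborel) \<le> \<dots>" .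
  qed
  finally show ?thesis .
qed

lemma line_integral_mono:
  assumes "is_curve (a, b, \<gamma>)" "\<And>x. x \<in> \<gamma> ` {a..b} \<Longrightarrow> f x \<le> g x"
  shows "line_integral f (a, b, \<gamma>) \<le> line_integral g (a, b, \<gamma>)"
  unfolding line_integral_def prod.case
proof (rule nn_integral_mono)
  fix s
  show "f (arc_param (a, b, \<gamma>) s) * indicator {0..enn2real (path_length \<gamma> a b)} s
    \<le> g (arc_param (a, b, \<gamma>) s) * indicator {0..enn2real (path_length \<gamma> a b)} s"
    using arc_param_mem[OF is_curveD(2,3,1)[OF assms(1)], of s] assms(2)
    by (auto simp: indicator_def)
qed

section \<open>Test functions and an upper bound for the capacity\<close>

lemma has_derivative_imp_gradient:
  fixes u :: "'a::euclidean_space \<Rightarrow> real"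
  assumes "(u has_derivative (\<lambda>h. D \<bullet> h)) (at x)"
  shows "frechet_derivative u (at x) b = D \<bullet> b" "gradient u x = D"
proof -
  have eq: "frechet_derivative u (at x) = (\<lambda>h. D \<bullet> h)"
    by (rule frechet_derivative_at[OF assms, symmetric])
  show "frechet_derivative u (at x) b = D \<bullet> b" by (simp add: eq)
  show "gradient u x = D" unfolding gradient_def eq by (rule euclidean_representation)
qed

lemma differentiable_imp_has_derivative_gradient:
  fixes u :: "'a::euclidean_space \<Rightarrow> real"
  assumes "u differentiable (at x)"
  shows "(u has_derivative (\<lambda>h. gradient u x \<bullet> h)) (at x)"
proof -
  define F where "F = frechet_derivative u (at x)"
  have F: "(u has_derivative F) (at x)" using assms by (simp add: F_def frechet_derivative_works)
  then have "linear F" by (rule has_derivative_linear)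
  have "F h = gradient u x \<bullet> h" for h
  proof -
    have "F h = F (\<Sum>b\<in>Basis. (h \<bullet> b) *\<^sub>R b)" by (simp add: euclidean_representation)
    also have "\<dots> = (\<Sum>b\<in>Basis. (h \<bullet> b) * F b)"
      by (simp add: linear_sum[OF \<open>linear F\<close>] linear_scale[OF \<open>linear F\<close>])
    also have "\<dots> = gradient u x \<bullet> h"
      unfolding gradient_def F_def[symmetric] inner_sum_left inner_scaleR_left
      by (intro sum.cong refl) (simp add: inner_commute mult.commute)
    finally show ?thesis .
  qed
  then have "F = (\<lambda>h. gradient u x \<bullet> h)" by (rule ext)
  then show ?thesis using F by simp
qed

section \<open>Calculus of k times continuously differentiable functions\<close>

lemma Ck_Suc_imp_has_derivative:
  "Ck (Suc k) u \<Longrightarrow> (u has_derivative (\<lambda>h. gradient u x \<bullet> h)) (at x)"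
  by (rule differentiable_imp_has_derivative_gradient) auto

lemma Ck_SucI:
  assumes "\<And>x. (u has_derivative (\<lambda>h. D x \<bullet> h)) (at x)" "\<And>b. b \<in> Basis \<Longrightarrow> Ck k (\<lambda>x. D x \<bullet> b)"
  shows "Ck (Suc k) u"
  using assms(2) has_derivative_imp_gradient(1)[OF assms(1)] differentiableI[OF assms(1)]
  by simp

lemma Ck_SucD:
  assumes "Ck (Suc k) u" "b \<in> Basis"
  shows "Ck k (\<lambda>x. gradient u x \<bullet> b)"
  using assms has_derivative_imp_gradient(1)[OF Ck_Suc_imp_has_derivative[OF assms(1)]] by simp

lemma Ck_Suc_imp: "Ck (Suc k) u \<Longrightarrow> Ck k u"
proof (induction k arbitrary: u)
  case 0
  then show ?case
    by (auto intro!: continuous_at_imp_continuous_on differentiable_imp_continuous_within)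
next
  case (Suc k)
  show ?case
    by (rule Ck_SucI[OF Ck_Suc_imp_has_derivative[OF Suc.prems]]) (intro Suc.IH Ck_SucD Suc.prems)
qed

lemma Ck_imp_continuous: "Ck k u \<Longrightarrow> continuous_on S u"
proof (induction k)
  case 0
  then show ?case using continuous_on_subset[of UNIV u S] by simp
next
  case (Suc k)
  show ?case by (rule Suc.IH[OF Ck_Suc_imp[OF Suc.prems]])
qed

lemma continuous_on_gradient: "Ck (Suc k) u \<Longrightarrow> continuous_on S (gradient u)"
  unfolding continuous_on_componentwise[of S "gradient u"]
  by (intro ballI Ck_imp_continuous[OF Ck_SucD])

lemma Ck_const: "Ck k (\<lambda>x. c)"
proof (induction k arbitrary: c)
  case (Suc k)
  show ?case by (rule Ck_SucI[where D="\<lambda>_. 0"]) (auto intro: Suc)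
qed simp

lemma Ck_inner: "Ck k (\<lambda>x. x \<bullet> c)"
proof (cases k)
  case (Suc m)
  show ?thesis unfolding Suc
    by (rule Ck_SucI[where D="\<lambda>_. c"]) (auto intro!: derivative_eq_intros Ck_const simp: inner_commute)
qed (auto intro!: continuous_intros)

lemma has_derivative_add_inner:
  assumes "(u has_derivative (\<lambda>h. D \<bullet> h)) (at x)" "(v has_derivative (\<lambda>h. E \<bullet> h)) (at x)"
  shows "((\<lambda>x. u x + v x) has_derivative (\<lambda>h. (D + E) \<bullet> h)) (at x)"
  using has_derivative_add[OF assms] by (simp add: inner_add_left)

lemma has_derivative_mult_inner:
  fixes u v :: "'a::euclidean_space \<Rightarrow> real"
  assumes "(u has_derivative (\<lambda>h. D \<bullet> h)) (at x)" "(v has_derivative (\<lambda>h. E \<bullet> h)) (at x)"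
  shows "((\<lambda>x. u x * v x) has_derivative (\<lambda>h. (u x *\<^sub>R E + v x *\<^sub>R D) \<bullet> h)) (at x)"
  using has_derivative_mult[OF assms] by (simp add: inner_add_left mult.commute)

lemma Ck_add:
  assumes "Ck k u" "Ck k v" shows "Ck k (\<lambda>x. u x + v x)"
  using assms
proof (induction k arbitrary: u v)
  case (Suc k)
  show ?case
  proof (rule Ck_SucI[OF has_derivative_add_inner[OF Ck_Suc_imp_has_derivative[OF Suc.prems(1)]
          Ck_Suc_imp_has_derivative[OF Suc.prems(2)]]])
    fix b :: 'a assume "b \<in> Basis"
    then have "Ck k (\<lambda>x. gradient u x \<bullet> b + gradient v x \<bullet> b)" by (intro Suc.IH Ck_SucD Suc.prems)
    then show "Ck k (\<lambda>x. (gradient u x + gradient v x) \<bullet> b)" by (simp add: inner_add_left)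
  qed
qed (auto intro!: continuous_intros)

lemma Ck_mult:
  assumes "Ck k u" "Ck k v" shows "Ck k (\<lambda>x. u x * v x)"
  using assms
proof (induction k arbitrary: u v)
  case (Suc k)
  show ?case
  proof (rule Ck_SucI[OF has_derivative_mult_inner[OF Ck_Suc_imp_has_derivative[OF Suc.prems(1)]
          Ck_Suc_imp_has_derivative[OF Suc.prems(2)]]])
    fix b :: 'a assume "b \<in> Basis"
    then have "Ck k (\<lambda>x. u x * (gradient v x \<bullet> b) + v x * (gradient u x \<bullet> b))"
      by (intro Ck_add Suc.IH Ck_SucD Suc.prems Ck_Suc_imp)
    then show "Ck k (\<lambda>x. (u x *\<^sub>R gradient v x + v x *\<^sub>R gradient u x) \<bullet> b)"
      by (simp add: inner_add_left)
  qed
qed (auto intro!: continuous_intros)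

lemma gradient_eq_0:
  assumes "open S" "x \<in> S" "\<And>y. y \<in> S \<Longrightarrow> u y = c"
  shows "gradient u x = 0"
proof -
  have "((\<lambda>_. c) has_derivative (\<lambda>h. 0 \<bullet> h)) (at x)" by simp
  then have "(u has_derivative (\<lambda>h. 0 \<bullet> h)) (at x)"
    by (rule has_derivative_transform_within_open[OF _ assms(1,2)]) (simp add: assms(3))
  then show ?thesis by (rule has_derivative_imp_gradient)
qed

lemma ennreal_powr_ennreal [simp]: "0 \<le> a \<Longrightarrow> ennreal_powr (ennreal a) p = ennreal (a powr p)"
  by (simp add: ennreal_powr_def)

lemma ennreal_powr_mono: "0 \<le> p \<Longrightarrow> x \<le> y \<Longrightarrow> ennreal_powr x p \<le> ennreal_powr y p"
  unfolding ennreal_powr_def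
  by (auto simp: top_unique less_top[symmetric] intro!: ennreal_leI powr_mono2 enn2real_mono)

lemma nn_integral_bounded_support_finite:
  fixes f :: "'a::euclidean_space \<Rightarrow> real"
  assumes "continuous_on UNIV f" "bounded U" "\<And>x. x \<notin> U \<Longrightarrow> f x = 0"
  shows "(\<integral>\<^sup>+x. ennreal (f x) \<partial>lebesgue) < \<infinity>"
proof -
  have K: "compact (closure U)" using assms(2) by simp
  have "bounded (f ` closure U)"
    by (intro compact_imp_bounded compact_continuous_image K continuous_on_subset[OF assms(1)]) auto
  then obtain M where M: "\<And>x. x \<in> closure U \<Longrightarrow> \<bar>f x\<bar> \<le> M" by (auto simp: bounded_real)
  have "(\<integral>\<^sup>+x. ennreal (f x) \<partial>lebesgue) \<le> (\<integral>\<^sup>+x. ennreal M * indicator (closure U) x \<partial>lebesgue)"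
  proof (rule nn_integral_mono)
    fix x show "ennreal (f x) \<le> ennreal M * indicator (closure U) x"
    proof (cases "x \<in> closure U")
      case True
      then show ?thesis using M[of x] by (auto intro!: ennreal_leI)
    next
      case False
      then have "f x = 0" using assms(3) closure_subset[of U] by blast
      then show ?thesis by simp
    qed
  qed
  also have "\<dots> = ennreal M * emeasure lebesgue (closure U)"
    by (rule nn_integral_cmult_indicator) auto
  also have "\<dots> < \<infinity>"
    using emeasure_compact_finite[OF K] by (auto simp: ennreal_mult_less_top)
  finally show ?thesis .
qed

lemma continuous_on_norm_powr:
  assumes "continuous_on S f" "0 < p" shows "continuous_on S (\<lambda>x. norm (f x) powr p)"
  using assms by (intro continuous_on_powr' continuous_intros) auto

text \<open>For a continuously differentiable function the inequality holds along every curve, so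
  the exceptional family is empty. The arbitrary value \<open>c\<close> off \<open>U\<close> covers
  \<open>restrict\<close>, which is \<open>undefined\<close> there.\<close>

lemma weak_upper_gradient_gradient:
  assumes "Ck (Suc k) v" "p > 0"
  shows "weak_upper_gradient p U (\<lambda>x. if x \<in> U then ereal (v x) else c) (\<lambda>x. ennreal (norm (gradient v x)))"
  unfolding weak_upper_gradient_def
proof (intro conjI exI[of _ "{}"] allI impI)
  have "gradient v \<in> borel_measurable borel"
    by (rule borel_measurable_continuous_onI[OF continuous_on_gradient[OF assms(1)]])
  then have "(\<lambda>x. ennreal (norm (gradient v x))) \<in> borel_measurable borel" by measurable
  then have "(\<lambda>x. ennreal (norm (gradient v x))) \<in> borel_measurable lebesgue"
    by (simp add: measurable_completion)
  then show "(\<lambda>x. ennreal (norm (gradient v x))) \<in> borel_measurable (lebesgue_on U)"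
    by (rule measurable_restrict_space1)
  have "modulus p ({} :: 'a curve set) \<le> (\<integral>\<^sup>+x. ennreal_powr 0 p \<partial>(lebesgue :: 'a measure))"
    unfolding modulus_def by (rule INF_lower) auto
  then show "modulus p ({} :: 'a curve set) = 0" using assms(2) by (simp add: ennreal_powr_def)
next
  fix a b :: real and \<gamma> :: "real \<Rightarrow> 'a"
  assume c: "is_curve (a, b, \<gamma>) \<and> \<gamma> ` {a..b} \<subseteq> U \<and> (a, b, \<gamma>) \<notin> {}"
  then have "\<gamma> a \<in> U" "\<gamma> b \<in> U" using is_curveD(1)[of a b \<gamma>] by auto
  then show "if \<bar>(if \<gamma> a \<in> U then ereal (v (\<gamma> a)) else c)\<bar> \<noteq> \<infinity> \<and> \<bar>(if \<gamma> b \<in> U then ereal (v (\<gamma> b)) else c)\<bar> \<noteq> \<infinity>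
        then e2ennreal \<bar>(if \<gamma> a \<in> U then ereal (v (\<gamma> a)) else c) - (if \<gamma> b \<in> U then ereal (v (\<gamma> b)) else c)\<bar>
             \<le> line_integral (\<lambda>x. ennreal (norm (gradient v x))) (a, b, \<gamma>)
        else line_integral (\<lambda>x. ennreal (norm (gradient v x))) (a, b, \<gamma>) = \<infinity>"
    using abs_diff_le_line_integral[OF Ck_Suc_imp_has_derivative[OF assms(1)] continuous_on_gradient[OF assms(1)], of a b \<gamma>] c
    by (simp add: e2ennreal_ereal)
qed auto

text \<open>The source of every upper bound on a capacity below. Boundedness of \<open>U\<close>
  makes the norm and the energy of \<open>v\<close> finite.\<close>

lemma cap_le_gradient:
  assumes v: "Ck (Suc k) v" and "p > 0" and U: "bounded U" and "K \<subseteq> U"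
    and "\<And>x. x \<notin> U \<Longrightarrow> v x = 0" "\<And>x. x \<in> K \<Longrightarrow> v x = 1"
  shows "cap p K U \<le> (\<integral>\<^sup>+x\<in>U. ennreal (norm (gradient v x) powr p) \<partial>lebesgue)"
proof -
  define u where "u x = ereal (v x)" for x
  define g where "g x = ennreal (norm (gradient v x))" for x
  have ug: "weak_upper_gradient p UNIV u g"
    using weak_upper_gradient_gradient[OF v \<open>p > 0\<close>, of UNIV] by (simp add: u_def[abs_def] g_def[abs_def])
  have gp: "ennreal_powr (g x) p = ennreal (norm (gradient v x) powr p)" for x
    by (simp add: g_def)
  have "u \<in> newtonian p"
    unfolding newtonian_def mem_Collect_eq
  proof (intro conjI exI[of _ g] ug)
    have "v \<in> borel_measurable borel" by (rule borel_measurable_continuous_onI[OF Ck_imp_continuous[OF v]])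
    then have "u \<in> borel_measurable borel" unfolding u_def[abs_def] by measurable
    then show "u \<in> borel_measurable lebesgue" by (simp add: measurable_completion)
    have "(\<integral>\<^sup>+x. ennreal (norm (v x) powr p) \<partial>lebesgue) < \<infinity>"
      by (rule nn_integral_bounded_support_finite[OF continuous_on_norm_powr[OF Ck_imp_continuous[OF v] \<open>p > 0\<close>] U])
        (use assms(5) in auto)
    then show "(\<integral>\<^sup>+x. ennreal_powr (e2ennreal \<bar>u x\<bar>) p \<partial>lebesgue) < \<infinity>"
      by (simp add: u_def e2ennreal_ereal)
    \<comment> \<open>The bounded set is now \<open>closure U\<close>: its complement is open and
      \<open>v\<close> vanishes there, hence so does the gradient.\<close>
    have "(\<integral>\<^sup>+x. ennreal (norm (gradient v x) powr p) \<partial>lebesgue) < \<infinity>"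
    proof (rule nn_integral_bounded_support_finite[OF continuous_on_norm_powr[OF continuous_on_gradient[OF v] \<open>p > 0\<close>]])
      fix x assume "x \<notin> closure U"
      then have "gradient v x = 0"
        by (intro gradient_eq_0[of "- closure U" x v 0]) (use assms(5) closure_subset[of U] in auto)
      then show "norm (gradient v x) powr p = 0" by simp
    qed (use U in \<open>simp add: bounded_closure\<close>)
    then show "(\<integral>\<^sup>+x. ennreal_powr (g x) p \<partial>lebesgue) < \<infinity>" by (simp add: gp)
  qed
  then have "restrict u U \<in> newtonian_zero p U"
    unfolding newtonian_zero_def using assms(5) by (auto simp: u_def zero_ereal_def)
  moreover have "weak_upper_gradient p U (restrict u U) g"
    using weak_upper_gradient_gradient[OF v \<open>p > 0\<close>, of U undefined]
    by (simp add: u_def[abs_def] g_def[abs_def] restrict_def)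
  moreover have "\<forall>x\<in>K. restrict u U x = 1" using assms(4,6) by (auto simp: u_def one_ereal_def)
  ultimately have "(restrict u U, g) \<in> {(u, g). u \<in> newtonian_zero p U \<and> (\<forall>x\<in>K. u x = 1) \<and> weak_upper_gradient p U u g}"
    by simp
  from INF_lower[OF this, of "\<lambda>(u, g). \<integral>\<^sup>+x\<in>U. ennreal_powr (g x) p \<partial>lebesgue"]
  show ?thesis by (simp add: cap_def gp)
qed

section \<open>Mollification\<close>

text \<open>The exponent \<open>j\<close> makes the linear span of the family closed under differentiation.\<close>

definition flat_exp :: "nat \<Rightarrow> real \<Rightarrow> real" where
  "flat_exp j t = (if t > 0 then exp (- 1 / t) / t ^ j else 0)"

lemma flat_exp_tendsto_0: "(flat_exp j \<longlongrightarrow> 0) (at 0)"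
proof (rule filterlim_split_at)
  have "\<forall>\<^sub>F t in at_left 0. flat_exp j t = 0"
    by (auto simp: flat_exp_def eventually_at_filter)
  then show "(flat_exp j \<longlongrightarrow> 0) (at_left 0)" by (rule tendsto_eventually)
next
  have "((\<lambda>x. inverse x ^ j / exp (inverse x)) \<longlongrightarrow> 0) (at_right (0::real))"
    by (rule filterlim_compose[OF tendsto_power_div_exp_0 filterlim_inverse_at_top_right])
  moreover have "\<forall>\<^sub>F x in at_right 0. inverse x ^ j / exp (inverse x) = flat_exp j x"
    by (auto simp: flat_exp_def eventually_at_filter exp_minus field_simps)
  ultimately show "(flat_exp j \<longlongrightarrow> 0) (at_right 0)" by (rule Lim_transform_eventually)
qed

text \<open>At 0 the difference quotient of \<open>flat_exp j\<close> is
  \<open>flat_exp (Suc j)\<close>, whose limit is already known to be 0. To the right of 0 the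
  quotient rule applies, to the left the function is constant.\<close>

lemma flat_exp_has_derivative:
  "(flat_exp j has_real_derivative flat_exp (Suc (Suc j)) t - real j * flat_exp (Suc j) t) (at t)"
proof -
  consider "t > 0" | "t = 0" | "t < 0" by linarith
  then show ?thesis
  proof cases
    case 1
    have "((\<lambda>t. exp (- 1 / t) / t ^ j) has_real_derivative
        (exp (- 1 / t) * (1 / t\<^sup>2) * t ^ j - exp (- 1 / t) * (real j * t ^ (j - 1))) / (t ^ j * t ^ j)) (at t)"
      using 1 by (auto intro!: derivative_eq_intros simp: power2_eq_square field_simps)
    also have "(exp (- 1 / t) * (1 / t\<^sup>2) * t ^ j - exp (- 1 / t) * (real j * t ^ (j - 1))) / (t ^ j * t ^ j)
      = flat_exp (Suc (Suc j)) t - real j * flat_exp (Suc j) t"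
      using 1 by (cases j) (simp_all add: flat_exp_def power2_eq_square field_simps)
    finally show ?thesis
      by (rule has_field_derivative_transform_within_open[of _ _ _ "{0<..}"]) (use 1 in \<open>auto simp: flat_exp_def\<close>)
  next
    case 2
    have "\<forall>\<^sub>F h in at 0. flat_exp (Suc j) h = flat_exp j h / h"
      by (auto simp: flat_exp_def eventually_at_filter)
    from Lim_transform_eventually[OF flat_exp_tendsto_0 this] show ?thesis
      using 2 by (simp add: has_field_derivative_iff flat_exp_def)
  next
    case 3
    have "((\<lambda>t. 0) has_real_derivative 0) (at t)" by simp
    then have "(flat_exp j has_real_derivative 0) (at t)"
      by (rule has_field_derivative_transform_within_open[of _ _ _ "{..<0}"]) (use 3 in \<open>auto simp: flat_exp_def\<close>)
    then show ?thesis using 3 by (simp add: flat_exp_def)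
  qed
qed

lemma Ck_flat_exp: "Ck k (\<lambda>x::'a::euclidean_space. flat_exp j (c - x \<bullet> x))"
proof (induction k arbitrary: j)
  case 0
  have "continuous_on UNIV (flat_exp j)"
    by (intro continuous_at_imp_continuous_on ballI DERIV_isCont[OF flat_exp_has_derivative])
  then show ?case unfolding Ck.simps
    by (rule continuous_on_compose2) (auto intro!: continuous_intros)
next
  case (Suc k)
  define G where "G x = flat_exp (Suc (Suc j)) (c - x \<bullet> x) - real j * flat_exp (Suc j) (c - x \<bullet> x)" for x :: 'a
  have "((\<lambda>x. flat_exp j (c - x \<bullet> x)) has_derivative (\<lambda>h. ((- 2 * G x) *\<^sub>R x) \<bullet> h)) (at x)" for x
  proof -
    have "((\<lambda>x. c - x \<bullet> x) has_derivative (\<lambda>h. - (2 * (x \<bullet> h)))) (at x)"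
      by (auto intro!: derivative_eq_intros simp: inner_commute)
    from has_derivative_compose[OF this flat_exp_has_derivative[unfolded has_field_derivative_def]]
    show ?thesis by (simp add: G_def algebra_simps)
  qed
  moreover have "Ck k (\<lambda>x. ((- 2 * G x) *\<^sub>R x) \<bullet> b)" for b
  proof -
    have "Ck k (\<lambda>x. ((- 2) * (flat_exp (Suc (Suc j)) (c - x \<bullet> x)
        + (- real j) * flat_exp (Suc j) (c - x \<bullet> x))) * (x \<bullet> b))"
      by (intro Ck_mult Ck_add Ck_const Ck_inner Suc.IH)
    then show ?thesis by (simp add: G_def)
  qed
  ultimately show ?case by (rule Ck_SucI)
qed

lemma lborel_integral_translation:
  fixes f :: "'a::euclidean_space \<Rightarrow> 'b::{banach, second_countable_topology}"
  assumes "f \<in> borel_measurable borel"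
  shows "(\<integral>x. f (c + x) \<partial>lborel) = (\<integral>x. f x \<partial>lborel)"
  using integral_distr[of "(+) c" lborel borel f] assms by (simp add: lborel_distr_plus)

lemma integrable_continuous_bounded_support:
  fixes f :: "'a::euclidean_space \<Rightarrow> real"
  assumes "continuous_on UNIV f" "\<And>x. norm x > r \<Longrightarrow> f x = 0"
  shows "integrable lborel f"
proof -
  have "integrable lborel (\<lambda>x. indicator (cball 0 r) x *\<^sub>R f x)"
    by (intro borel_integrable_compact continuous_on_subset[OF assms(1)]) auto
  moreover have "(\<lambda>x. indicator (cball 0 r) x *\<^sub>R f x) = f"
    using assms(2) by (force simp: indicator_def)
  ultimately show ?thesis by simp
qed

lemma mollifier_exists:
  assumes "d > 0"
  obtains \<phi> :: "'a::euclidean_space \<Rightarrow> real" where "\<And>k. Ck k \<phi>" "\<And>y. 0 \<le> \<phi> y"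
    "\<And>y. norm y \<ge> d \<Longrightarrow> \<phi> y = 0" "\<And>y. \<phi> (- y) = \<phi> y" "(\<integral>y. \<phi> y \<partial>lborel) = 1"
proof -
  define f where "f = (\<lambda>x::'a. flat_exp 0 (d\<^sup>2 - x \<bullet> x))"
  have Ckf: "Ck k f" for k unfolding f_def by (rule Ck_flat_exp)
  have nonneg: "0 \<le> f x" for x by (simp add: f_def flat_exp_def)
  have supp: "f x = 0" if "norm x \<ge> d" for x
  proof -
    have "d\<^sup>2 \<le> (norm x)\<^sup>2" using that assms by (intro power_mono) auto
    then show ?thesis by (simp add: f_def flat_exp_def dot_square_norm)
  qed
  have int: "integrable lborel f"
    by (rule integrable_continuous_bounded_support[of _ d]) (use Ckf[of 0] supp in auto)
  \<comment> \<open>The value of \<open>f\<close> on the sphere of radius d/2, as d^2 - (d/2)^2 = 3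
    d^2 / 4. It bounds \<open>f\<close> from below inside and makes the normalizing integral
    positive.\<close>
  define c where "c = exp (- 1 / (3 * d\<^sup>2 / 4))"
  have lower: "c * indicator (ball 0 (d / 2)) x \<le> f x" for x :: 'a
  proof (cases "x \<in> ball 0 (d / 2)")
    case True
    then have "(norm x)\<^sup>2 \<le> (d / 2)\<^sup>2" by (intro power_mono) auto
    then have *: "3 * d\<^sup>2 / 4 \<le> d\<^sup>2 - x \<bullet> x" "0 < 3 * d\<^sup>2 / 4"
      using assms by (auto simp: dot_square_norm power_divide)
    then have pos: "0 < d\<^sup>2 - x \<bullet> x" by linarith
    with * have "- 1 / (3 * d\<^sup>2 / 4) \<le> - 1 / (d\<^sup>2 - x \<bullet> x)"
      by (intro divide_left_mono_neg mult_pos_pos) auto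
    then show ?thesis using True pos by (simp add: f_def flat_exp_def c_def)
  qed (use nonneg in auto)
  have "0 < c * measure lborel (ball (0::'a) (d / 2))"
    using assms by (simp add: c_def content_ball_pos)
  also have "\<dots> = (\<integral>x. c * indicator (ball (0::'a) (d / 2)) x \<partial>lborel)" by simp
  also have "\<dots> \<le> (\<integral>x. f x \<partial>lborel)"
    by (rule integral_mono) (use int lower in \<open>auto intro!: integrable_real_indicator emeasure_bounded_finite\<close>)
  finally have N: "0 < (\<integral>x. f x \<partial>lborel)" .
  show thesis
  proof (rule that[of "\<lambda>x. (1 / (\<integral>x. f x \<partial>lborel)) * f x"])
    show "Ck k (\<lambda>x. 1 / integral\<^sup>L lborel f * f x)" for k by (intro Ck_mult Ck_const Ckf)
  qed (use N nonneg supp in \<open>auto simp: f_def\<close>)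
qed

section \<open>Convolution with a smooth kernel\<close>

lemma convolution_has_derivative:
  fixes v :: "'a::euclidean_space \<Rightarrow> real"
  assumes v: "continuous_on UNIV v" and \<phi>: "Ck (Suc k) \<phi>"
  shows "((\<lambda>x. integral (cbox a b) (\<lambda>y. v y * \<phi> (x - y))) has_derivative
     (\<lambda>h. integral (cbox a b) (\<lambda>y. v y *\<^sub>R gradient \<phi> (x - y)) \<bullet> h)) (at x)"
proof -
  define w where "w x y = v y *\<^sub>R gradient \<phi> (x - y)" for x y
  have cont: "continuous_on S (\<lambda>x. v (f x))" "continuous_on S (\<lambda>x. gradient \<phi> (f x))" "continuous_on S (\<lambda>x. \<phi> (f x))"
    if "continuous_on S f" for S :: "'b::topological_space set" and f
    by (rule continuous_on_compose2[OF v that] continuous_on_compose2[OF continuous_on_gradient[OF \<phi>, of UNIV] that]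
        continuous_on_compose2[OF Ck_imp_continuous[OF \<phi>, of UNIV] that]; simp)+
  \<comment> \<open>The Leibniz rule takes derivatives as bounded linear maps;
    \<open>blinfun_inner_left\<close> turns the gradient vector into one and commutes with the
    integral.\<close>
  have "((\<lambda>x. integral (cbox a b) (\<lambda>y. v y * \<phi> (x - y))) has_derivative
      blinfun_apply (integral (cbox a b) (\<lambda>y. blinfun_inner_left (w x y)))) (at x within UNIV)"
  proof (rule leibniz_rule[where U=UNIV and fx="\<lambda>x y. blinfun_inner_left (w x y)"])
    fix x t
    have "((\<lambda>x. \<phi> (x - t)) has_derivative (\<lambda>h. gradient \<phi> (x - t) \<bullet> h)) (at x)"
    proof (rule has_derivative_compose[OF _ Ck_Suc_imp_has_derivative[OF \<phi>]])
      show "((\<lambda>x. x - t) has_derivative (\<lambda>h. h)) (at x)"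
        by (auto intro!: derivative_eq_intros)
    qed
    from has_derivative_mult_right[OF this, of "v t"]
    show "((\<lambda>x. v t * \<phi> (x - t)) has_derivative blinfun_apply (blinfun_inner_left (w x t))) (at x within UNIV)"
      by (simp add: w_def inner_commute)
  next
    show "(\<lambda>y. v y * \<phi> (x - y)) integrable_on cbox a b" for x
      by (intro integrable_continuous continuous_intros cont)
    show "continuous_on (UNIV \<times> cbox a b) (\<lambda>(x, t). blinfun_inner_left (w x t))"
      unfolding w_def split_beta
      by (intro bounded_linear.continuous_on[OF bounded_linear_blinfun_inner_left] continuous_intros cont)
  qed auto
  moreover have "integral (cbox a b) (\<lambda>y. blinfun_inner_left (w x y)) = blinfun_inner_left (integral (cbox a b) (w x))"
    by (intro integral_linear[OF _ bounded_linear_blinfun_inner_left, unfolded o_def] integrable_continuous)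
      (unfold w_def, intro continuous_intros cont)
  ultimately show ?thesis by (simp add: w_def[abs_def] inner_commute)
qed

text \<open>Each partial derivative is the convolution of \<open>v\<close> with a component of
  \<open>gradient \<phi>\<close>, which is again smooth. The induction therefore runs over all
  kernels, and \<open>v\<close> is never differentiated.\<close>

lemma Ck_convolution:
  fixes v :: "'a::euclidean_space \<Rightarrow> real"
  assumes v: "continuous_on UNIV v" and \<phi>: "\<And>j. Ck j \<phi>"
  shows "Ck k (\<lambda>x. integral (cbox a b) (\<lambda>y. v y * \<phi> (x - y)))"
  using \<phi>
proof (induction k arbitrary: \<phi>)
  case 0
  show ?case unfolding Ck.simps
    by (intro continuous_at_imp_continuous_on ballI
        has_derivative_continuous[OF convolution_has_derivative[OF v 0]])
next
  case (Suc k)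
  show ?case
  proof (rule Ck_SucI[OF convolution_has_derivative[OF v Suc.prems]])
    fix c :: 'a assume c: "c \<in> Basis"
    have "(\<lambda>y. v y *\<^sub>R gradient \<phi> (x - y)) integrable_on cbox a b" for x
      by (intro integrable_continuous continuous_intros continuous_on_subset[OF v]
          continuous_on_compose2[OF continuous_on_gradient[OF Suc.prems, of UNIV]]) auto
    from integral_linear[OF this bounded_linear_inner_left[of c]]
    have "integral (cbox a b) (\<lambda>y. v y *\<^sub>R gradient \<phi> (x - y)) \<bullet> c
        = integral (cbox a b) (\<lambda>y. v y * (gradient \<phi> (x - y) \<bullet> c))" for x
      by (simp add: o_def)
    moreover have "Ck k (\<lambda>x. integral (cbox a b) (\<lambda>y. v y * (gradient \<phi> (x - y) \<bullet> c)))"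
      by (rule Suc.IH[OF Ck_SucD[OF Suc.prems c]])
    ultimately show "Ck k (\<lambda>x. integral (cbox a b) (\<lambda>y. v y *\<^sub>R gradient \<phi> (x - y)) \<bullet> c)" by simp
  qed
qed

lemma norm_derivative_le_local_lipschitz:
  fixes f :: "'a::euclidean_space \<Rightarrow> real"
  assumes f: "(f has_derivative (\<lambda>h. D \<bullet> h)) (at x)" and "d > 0"
    and B: "\<And>h. norm h < d \<Longrightarrow> \<bar>f (x + h) - f x\<bar> \<le> B * norm h"
  shows "norm D \<le> B"
proof (rule ccontr)
  assume neg: "\<not> norm D \<le> B"
  define e where "e = (norm D - B) / 2"
  have "e > 0" using neg by (simp add: e_def)
  \<comment> \<open>A single increment forces \<open>B \<ge> 0\<close>; the negated claim then gives
    \<open>norm D > 0\<close>, which the choice of \<open>t\<close> needs.\<close>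
  obtain b :: 'a where "b \<in> Basis" using nonempty_Basis by blast
  then have "\<bar>f (x + (d/2) *\<^sub>R b) - f x\<bar> \<le> B * (d/2)"
    using B[of "(d/2) *\<^sub>R b"] \<open>d > 0\<close> by simp
  then have "0 \<le> B * (d/2)" by linarith
  then have "B \<ge> 0" using \<open>d > 0\<close> by (simp add: zero_le_mult_iff)
  then have D0: "norm D > 0" using neg by linarith
  obtain r where r: "r > 0" "\<And>y. norm (y - x) < r \<Longrightarrow> norm (f y - f x - D \<bullet> (y - x)) \<le> e * norm (y - x)"
    using f \<open>e > 0\<close> unfolding has_derivative_at_alt by blast
  \<comment> \<open>The increment in the direction of \<open>D\<close> itself reveals the full norm;
    \<open>t *\<^sub>R D\<close> has norm \<open>min d r / 2\<close>, inside both radii.\<close>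
  define t where "t = min d r / (2 * norm D)"
  have t: "t > 0" "t * norm D < d" "t * norm D < r"
    using D0 \<open>d > 0\<close> r(1) by (auto simp: t_def)
  have "norm (f (x + t *\<^sub>R D) - f x - D \<bullet> (t *\<^sub>R D)) \<le> e * norm (t *\<^sub>R D)"
    using r(2)[of "x + t *\<^sub>R D"] t by simp
  moreover have "\<bar>f (x + t *\<^sub>R D) - f x\<bar> \<le> B * norm (t *\<^sub>R D)" using B[of "t *\<^sub>R D"] t by simp
  moreover have "D \<bullet> (t *\<^sub>R D) = t * norm D * norm D" by (simp add: dot_square_norm power2_eq_square)
  ultimately have "t * norm D * norm D \<le> (B + e) * (t * norm D)"
    using t(1) by (simp add: algebra_simps abs_le_iff)
  then have "norm D \<le> B + e" using t(1) D0 by (simp add: mult.commute)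
  then show False using neg by (simp add: e_def field_simps)
qed

text \<open>The gradient bound is local, with \<open>B\<close> allowed to depend on
  \<open>x\<close>, because it is later a multiple of a weight at \<open>x\<close>. The radius
  \<open>2 * d\<close> accounts for an increment shorter than \<open>d\<close> plus a point of the
  support of the kernel.\<close>

lemma mollification:
  fixes v :: "'a::euclidean_space \<Rightarrow> real"
  assumes v: "continuous_on UNIV v" and supp: "\<And>x. norm x > r \<Longrightarrow> v x = 0" and "d > 0"
  obtains v' where "\<And>k. Ck k v'"
    "\<And>x c. (\<And>y. y \<in> ball x d \<Longrightarrow> v y = c) \<Longrightarrow> v' x = c"
    "\<And>x B. 0 \<le> B \<Longrightarrow> (\<And>y z. y \<in> ball x (2 * d) \<Longrightarrow> z \<in> ball x (2 * d) \<Longrightarrow> \<bar>v y - v z\<bar> \<le> B * dist y z)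
        \<Longrightarrow> norm (gradient v' x) \<le> B"
    "\<And>x B. (\<And>y. \<bar>v y\<bar> \<le> B) \<Longrightarrow> \<bar>v' x\<bar> \<le> B"
proof -
  obtain \<phi> :: "'a \<Rightarrow> real" where \<phi>: "\<And>k. Ck k \<phi>" "\<And>y. 0 \<le> \<phi> y"
    "\<And>y. norm y \<ge> d \<Longrightarrow> \<phi> y = 0" "\<And>y. \<phi> (- y) = \<phi> y" "(\<integral>y. \<phi> y \<partial>lborel) = 1"
    using mollifier_exists[OF \<open>d > 0\<close>] by blast
  have c\<phi>: "continuous_on UNIV \<phi>" by (rule Ck_imp_continuous[OF \<phi>(1)])
  have "bounded (cball (0::'a) r)" by simp
  then obtain a b where ab: "cball (0::'a) r \<subseteq> cbox a b"
    using bounded_subset_cbox_symmetric by metis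
  define v' where "v' x = integral (cbox a b) (\<lambda>y. v y * \<phi> (x - y))" for x
  have smooth: "Ck k v'" for k unfolding v'_def[abs_def] by (rule Ck_convolution[OF v \<phi>(1)])
  have c1: "continuous_on UNIV (\<lambda>y. v y * \<phi> (x - y))" for x
    by (intro continuous_intros v continuous_on_compose2[OF c\<phi>]) auto
  have int1: "integrable lborel (\<lambda>y. v y * \<phi> (x - y))" for x
    by (rule integrable_continuous_bounded_support[OF c1, of r]) (simp add: supp)
  have c2: "continuous_on UNIV (\<lambda>z. v (x + z) * \<phi> z)" for x
    by (intro continuous_intros c\<phi> continuous_on_compose2[OF v]) auto
  have int2: "integrable lborel (\<lambda>z. v (x + z) * \<phi> z)" for x
    by (rule integrable_continuous_bounded_support[OF c2, of d]) (simp add: \<phi>(3))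
  have int\<phi>: "integrable lborel \<phi>"
    by (rule integrable_continuous_bounded_support[OF c\<phi>, of d]) (simp add: \<phi>(3))
  \<comment> \<open>The box contains the support of \<open>v\<close>, so the integral runs over the
    whole space. A translation and the evenness of \<open>\<phi>\<close> move \<open>x\<close> into
    \<open>v\<close>; in this form Lipschitz bounds pass from \<open>v\<close> to
    \<open>v'\<close>.\<close>
  have eq: "v' x = (\<integral>z. v (x + z) * \<phi> z \<partial>lborel)" for x
  proof -
    have "v' x = integral UNIV (\<lambda>y. if y \<in> cbox a b then v y * \<phi> (x - y) else 0)"
      unfolding v'_def by (rule integral_restrict_UNIV[symmetric])
    also have "(\<lambda>y. if y \<in> cbox a b then v y * \<phi> (x - y) else 0) = (\<lambda>y. v y * \<phi> (x - y))"
    proof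
      fix y show "(if y \<in> cbox a b then v y * \<phi> (x - y) else 0) = v y * \<phi> (x - y)"
        using supp[of y] subsetD[OF ab, of y] by (cases "norm y > r") auto
    qed
    also have "integral UNIV (\<lambda>y. v y * \<phi> (x - y)) = (\<integral>y. v y * \<phi> (x - y) \<partial>lborel)"
      by (rule integral_lborel[OF int1])
    also have "\<dots> = (\<integral>z. v (x + z) * \<phi> (x - (x + z)) \<partial>lborel)"
      using lborel_integral_translation[OF borel_measurable_continuous_onI[OF c1], of x x] by simp
    also have "\<dots> = (\<integral>z. v (x + z) * \<phi> z \<partial>lborel)" by (simp add: \<phi>(4))
    finally show ?thesis .
  qed
  show thesis
  proof (rule that[OF smooth])
    fix x c assume c: "\<And>y. y \<in> ball x d \<Longrightarrow> v y = c"
    have "(\<lambda>z. v (x + z) * \<phi> z) = (\<lambda>z. c * \<phi> z)"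
    proof
      fix z show "v (x + z) * \<phi> z = c * \<phi> z"
        using c[of "x + z"] \<phi>(3)[of z] by (cases "norm z < d") (auto simp: dist_norm)
    qed
    then show "v' x = c" using \<phi>(5) by (simp add: eq)
  next
    fix x B assume "0 \<le> B"
      and B: "\<And>y z. y \<in> ball x (2 * d) \<Longrightarrow> z \<in> ball x (2 * d) \<Longrightarrow> \<bar>v y - v z\<bar> \<le> B * dist y z"
    show "norm (gradient v' x) \<le> B"
    proof (rule norm_derivative_le_local_lipschitz[OF Ck_Suc_imp_has_derivative[OF smooth] \<open>d > 0\<close>])
      fix h :: 'a assume h: "norm h < d"
      have "v' (x + h) - v' x = (\<integral>z. v (x + h + z) * \<phi> z - v (x + z) * \<phi> z \<partial>lborel)"
        unfolding eq by (rule Bochner_Integration.integral_diff[OF int2 int2, symmetric])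
      also have "\<bar>\<dots>\<bar> \<le> (\<integral>z. \<bar>v (x + h + z) * \<phi> z - v (x + z) * \<phi> z\<bar> \<partial>lborel)"
        by (rule integral_abs_bound)
      also have "\<dots> \<le> (\<integral>z. (B * norm h) * \<phi> z \<partial>lborel)"
      proof (rule integral_mono)
        show "integrable lborel (\<lambda>z. \<bar>v (x + h + z) * \<phi> z - v (x + z) * \<phi> z\<bar>)"
          by (intro integrable_abs Bochner_Integration.integrable_diff int2)
        show "integrable lborel (\<lambda>z. (B * norm h) * \<phi> z)" by (simp add: int\<phi>)
        fix z
        show "\<bar>v (x + h + z) * \<phi> z - v (x + z) * \<phi> z\<bar> \<le> (B * norm h) * \<phi> z"
        proof (cases "norm z < d")
          case True
          have "norm (h + z) < 2 * d" using norm_triangle_ineq[of h z] h True by simp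
          then have "x + h + z \<in> ball x (2 * d)" "x + z \<in> ball x (2 * d)"
            using True \<open>d > 0\<close> norm_minus_cancel[of "h + z"] by (auto simp: dist_norm add.commute)
          then have "\<bar>v (x + h + z) - v (x + z)\<bar> \<le> B * dist (x + h + z) (x + z)" by (rule B)
          then have "\<bar>v (x + h + z) - v (x + z)\<bar> * \<phi> z \<le> (B * norm h) * \<phi> z"
            by (intro mult_right_mono \<phi>) (simp add: dist_norm)
          then show ?thesis by (simp add: abs_mult \<phi>(2) left_diff_distrib[symmetric])
        qed (use \<phi>(3) in auto)
      qed
      also have "\<dots> = B * norm h" by (simp add: \<phi>(5))
      finally show "\<bar>v' (x + h) - v' x\<bar> \<le> B * norm h" .
    qed
  next
    fix x B assume B: "\<And>y. \<bar>v y\<bar> \<le> B"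
    have "\<bar>v' x\<bar> \<le> (\<integral>z. \<bar>v (x + z) * \<phi> z\<bar> \<partial>lborel)"
      unfolding eq by (rule integral_abs_bound)
    also have "\<dots> \<le> (\<integral>z. B * \<phi> z \<partial>lborel)"
    proof (rule integral_mono[OF integrable_abs[OF int2]])
      show "\<bar>v (x + z) * \<phi> z\<bar> \<le> B * \<phi> z" for z
        using B \<phi>(2) by (simp add: abs_mult mult_right_mono)
    qed (simp add: int\<phi>)
    also have "\<dots> = B" by (simp add: \<phi>(5))
    finally show "\<bar>v' x\<bar> \<le> B" .
  qed
qed

section \<open>Cheapest exit paths\<close>

text \<open>Being 1-Lipschitz, unlike having unit speed, survives uniform limits. Stationary pieces
  and \<open>L = 0\<close> are allowed; values of \<open>\<sigma>\<close> off \<open>{0..L}\<close>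
  are irrelevant.\<close>

definition exit_paths :: "'a::real_normed_vector set \<Rightarrow> 'a \<Rightarrow> (real \<times> (real \<Rightarrow> 'a)) set" where
  "exit_paths U x = {(L, \<sigma>). 0 \<le> L \<and> 1-lipschitz_on {0..L} \<sigma> \<and> \<sigma> 0 = x \<and> \<sigma> L \<notin> U}"

text \<open>The distance to the complement of \<open>U\<close> in the conformal metric with density
  \<open>h\<close>. For a nonnegative continuous weight and \<open>U \<noteq> UNIV\<close> the real
  infimum is meaningful: costs are nonnegative and every point has an exit path.\<close>

definition path_cost :: "('a \<Rightarrow> real) \<Rightarrow> 'a::real_normed_vector set \<Rightarrow> 'a \<Rightarrow> real" where
  "path_cost h U x = (INF (L, \<sigma>)\<in>exit_paths U x. integral {0..L} (\<lambda>t. h (\<sigma> t)))"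

lemma lipschitz_segment:
  fixes x y :: "'a::real_normed_vector"
  shows "1-lipschitz_on {0..dist x y} (\<lambda>t. x + (t / dist x y) *\<^sub>R (y - x))"
proof (cases "x = y")
  case False
  have "dist (x + (s / dist x y) *\<^sub>R (y - x)) (x + (t / dist x y) *\<^sub>R (y - x)) = dist s t" for s t
  proof -
    have "dist (x + (s / dist x y) *\<^sub>R (y - x)) (x + (t / dist x y) *\<^sub>R (y - x))
        = norm (((s - t) / dist x y) *\<^sub>R (y - x))"
      by (simp add: dist_norm scaleR_diff_left[symmetric] diff_divide_distrib)
    also have "\<dots> = dist s t" using False by (simp add: dist_norm norm_minus_commute)
    finally show ?thesis .
  qed
  then show ?thesis by (intro lipschitz_onI) auto
qed (auto intro: lipschitz_intros)

lemma exit_paths_nonempty: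
  assumes "U \<noteq> UNIV" shows "exit_paths U x \<noteq> {}"
proof -
  obtain z where "z \<notin> U" using assms by auto
  then have "(dist x z, \<lambda>t. x + (t / dist x z) *\<^sub>R (z - x)) \<in> exit_paths U x"
    using lipschitz_segment[of x z] by (auto simp: exit_paths_def)
  then show ?thesis by blast
qed

lemma continuous_on_exit_path:
  fixes h :: "'a::real_normed_vector \<Rightarrow> real"
  assumes "continuous_on UNIV h" "(L, \<sigma>) \<in> exit_paths U x"
  shows "continuous_on {0..L} (\<lambda>t. h (\<sigma> t))"
proof -
  have "1-lipschitz_on {0..L} \<sigma>" using assms(2) by (simp add: exit_paths_def)
  from lipschitz_on_continuous_on[OF this] show ?thesis
    by (rule continuous_on_compose2[OF assms(1)]) simp
qed

lemma exit_path_cost_nonneg: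
  fixes h :: "'a::real_normed_vector \<Rightarrow> real"
  assumes "continuous_on UNIV h" "\<And>x. 0 \<le> h x" "(L, \<sigma>) \<in> exit_paths U x"
  shows "0 \<le> integral {0..L} (\<lambda>t. h (\<sigma> t))"
  by (rule integral_nonneg) (use assms continuous_on_exit_path[OF assms(1,3)] in \<open>auto intro: integrable_continuous_interval\<close>)

lemma path_cost_le:
  fixes h :: "'a::real_normed_vector \<Rightarrow> real"
  assumes "continuous_on UNIV h" "\<And>x. 0 \<le> h x" "(L, \<sigma>) \<in> exit_paths U x"
  shows "path_cost h U x \<le> integral {0..L} (\<lambda>t. h (\<sigma> t))"
proof -
  have "bdd_below ((\<lambda>(L, \<sigma>). integral {0..L} (\<lambda>t. h (\<sigma> t))) ` exit_paths U x)"
    by (rule bdd_belowI[of _ 0]) (use exit_path_cost_nonneg[OF assms(1,2)] in auto)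
  from cINF_lower[OF this assms(3)] show ?thesis by (simp add: path_cost_def)
qed

lemma path_cost_nonneg:
  fixes h :: "'a::real_normed_vector \<Rightarrow> real"
  assumes "U \<noteq> UNIV" "continuous_on UNIV h" "\<And>x. 0 \<le> h x"
  shows "0 \<le> path_cost h U x"
  unfolding path_cost_def
  by (rule cINF_greatest[OF exit_paths_nonempty[OF assms(1)]])
    (use exit_path_cost_nonneg[OF assms(2,3)] in auto)

lemma path_cost_eq_0:
  fixes h :: "'a::real_normed_vector \<Rightarrow> real"
  assumes "continuous_on UNIV h" "\<And>x. 0 \<le> h x" "x \<notin> U"
  shows "path_cost h U x = 0"
proof (rule antisym)
  have "(0, \<lambda>_. x) \<in> exit_paths U x" using assms(3) by (auto simp: exit_paths_def intro: lipschitz_intros)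
  from path_cost_le[OF assms(1,2) this] show "path_cost h U x \<le> 0" by simp
  show "0 \<le> path_cost h U x" by (rule path_cost_nonneg) (use assms in auto)
qed

lemma path_cost_less:
  assumes "U \<noteq> UNIV" "path_cost h U x < c"
  obtains L \<sigma> where "(L, \<sigma>) \<in> exit_paths U x" "integral {0..L} (\<lambda>t. h (\<sigma> t)) < c"
proof -
  have "\<exists>y\<in>(\<lambda>(L, \<sigma>). integral {0..L} (\<lambda>t. h (\<sigma> t))) ` exit_paths U x. y < c"
    by (rule cInf_lessD) (use assms exit_paths_nonempty[OF assms(1)] in \<open>auto simp: path_cost_def\<close>)
  then show thesis using that by auto
qed

text \<open>An exit path from \<open>y\<close> becomes one from \<open>x\<close> by prepending the
  segment from \<open>x\<close> to \<open>y\<close>, which costs at most \<open>B\<close> per unit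
  of length.\<close>

lemma path_cost_triangle:
  fixes h :: "'a::real_normed_vector \<Rightarrow> real"
  assumes U: "U \<noteq> UNIV" and h: "continuous_on UNIV h" "\<And>x. 0 \<le> h x"
    and B: "\<And>z. z \<in> closed_segment x y \<Longrightarrow> h z \<le> B"
  shows "path_cost h U x \<le> path_cost h U y + B * dist x y"
proof (cases "x = y")
  case False
  define r where "r = dist x y"
  have "r > 0" using False by (simp add: r_def)
  have *: "path_cost h U x - B * r \<le> integral {0..L} (\<lambda>t. h (\<sigma> t))" if "(L, \<sigma>) \<in> exit_paths U y" for L \<sigma>
  proof -
    have L: "0 \<le> L" "1-lipschitz_on {0..L} \<sigma>" "\<sigma> 0 = y" "\<sigma> L \<notin> U"
      using that by (auto simp: exit_paths_def)
    define s where "s t = x + (t / r) *\<^sub>R (y - x)" for t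
    define \<tau> where "\<tau> t = (if t \<le> r then s t else \<sigma> (t - r))" for t
    have "1-lipschitz_on {r..r + L} (\<lambda>t. \<sigma> (t - r))"
    proof (rule lipschitz_onI)
      fix a b assume "a \<in> {r..r + L}" "b \<in> {r..r + L}"
      then show "dist (\<sigma> (a - r)) (\<sigma> (b - r)) \<le> 1 * dist a b"
        using lipschitz_onD[OF L(2), of "a - r" "b - r"] by (simp add: dist_real_def)
    qed simp
    moreover have "1-lipschitz_on {0..r} s"
      using lipschitz_segment[of x y] by (simp add: s_def[abs_def] r_def)
    moreover have sr: "s r = y" using \<open>r > 0\<close> by (simp add: s_def)
    ultimately have lip: "1-lipschitz_on {0..r + L} \<tau>"
      unfolding \<tau>_def by (intro lipschitz_on_concat) (use L(3) in auto)
    moreover have end_point: "\<tau> (r + L) = \<sigma> L"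
      using sr L by (cases "L = 0") (auto simp: \<tau>_def)
    ultimately have mem: "(r + L, \<tau>) \<in> exit_paths U x"
      using L \<open>r > 0\<close> by (auto simp: exit_paths_def \<tau>_def s_def)
    have int: "(\<lambda>t. h (\<tau> t)) integrable_on {a..b}" if "0 \<le> a" "b \<le> r + L" for a b
      by (rule integrable_continuous_interval[OF continuous_on_subset[OF continuous_on_exit_path[OF h(1) mem]]])
        (use that in auto)
    have "path_cost h U x \<le> integral {0..r + L} (\<lambda>t. h (\<tau> t))" by (rule path_cost_le[OF h mem])
    also have "\<dots> = integral {0..r} (\<lambda>t. h (\<tau> t)) + integral {r..r + L} (\<lambda>t. h (\<tau> t))"
      by (rule Henstock_Kurzweil_Integration.integral_combine[symmetric, OF _ _ int]) (use L \<open>r > 0\<close> in auto)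
    also have "integral {0..r} (\<lambda>t. h (\<tau> t)) \<le> integral {0..r} (\<lambda>_. B)"
    proof (rule integral_le)
      fix t assume t: "t \<in> {0..r}"
      have "s t = (1 - t / r) *\<^sub>R x + (t / r) *\<^sub>R y" by (simp add: s_def algebra_simps)
      then have "s t \<in> closed_segment x y"
        unfolding in_segment using t \<open>r > 0\<close> by (intro exI[of _ "t / r"]) auto
      then show "h (\<tau> t) \<le> B" using B t by (simp add: \<tau>_def)
    qed (use int L in auto)
    also have "integral {r..r + L} (\<lambda>t. h (\<tau> t)) = integral {r..r + L} (\<lambda>t. h (\<sigma> (t - r)))"
    proof (rule integral_cong)
      fix t assume "t \<in> {r..r + L}"
      then show "h (\<tau> t) = h (\<sigma> (t - r))" using sr L(3) by (cases "t = r") (auto simp: \<tau>_def)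
    qed
    also have "\<dots> = integral {0..L} (\<lambda>t. h (\<sigma> t))"
      using integral_shift_real_ivl[of 0 "-r" L "\<lambda>t. h (\<sigma> t)"] by (simp add: add.commute)
    finally show ?thesis using \<open>r > 0\<close> by (simp add: mult.commute)
  qed
  have "path_cost h U x - B * r \<le> path_cost h U y"
    unfolding path_cost_def[of h U y]
    by (rule cINF_greatest[OF exit_paths_nonempty[OF U]]) (use * in auto)
  then show ?thesis by (simp add: r_def)
qed simp

text \<open>Near a point the Lipschitz constant of the cost is close to the weight there, so
  \<open>h\<close> plays the role of its upper gradient.\<close>

lemma abs_path_cost_diff_le:
  fixes h :: "'a::real_normed_vector \<Rightarrow> real"
  assumes U: "U \<noteq> UNIV" and h: "continuous_on UNIV h" "\<And>x. 0 \<le> h x"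
    and B: "\<And>z. z \<in> closed_segment x y \<Longrightarrow> h z \<le> B"
  shows "\<bar>path_cost h U x - path_cost h U y\<bar> \<le> B * dist x y"
  using path_cost_triangle[OF U h B] path_cost_triangle[OF U h, of y x B] B
  by (auto simp: abs_le_iff closed_segment_commute dist_commute algebra_simps)

lemma continuous_on_path_cost:
  fixes h :: "'a::euclidean_space \<Rightarrow> real"
  assumes U: "U \<noteq> UNIV" and h: "continuous_on UNIV h" "\<And>x. 0 \<le> h x"
  shows "continuous_on UNIV (path_cost h U)"
proof (rule continuous_at_imp_continuous_on, rule ballI)
  fix x :: 'a
  have "bounded (h ` cball x 1)"
    by (intro compact_imp_bounded compact_continuous_image continuous_on_subset[OF h(1)]) auto
  then obtain B where B: "\<And>z. z \<in> cball x 1 \<Longrightarrow> h z \<le> B"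
    unfolding bounded_real by (meson abs_le_D1 imageI)
  have "\<forall>\<^sub>F y in at x. dist (path_cost h U y) (path_cost h U x) \<le> B * dist y x"
    unfolding eventually_at
  proof (intro exI[of _ 1] conjI ballI impI)
    fix y assume "y \<noteq> x \<and> dist y x < 1"
    then have "closed_segment y x \<subseteq> cball x 1"
      by (intro closed_segment_subset convex_cball) (auto simp: dist_commute)
    then show "dist (path_cost h U y) (path_cost h U x) \<le> B * dist y x"
      unfolding dist_real_def by (intro abs_path_cost_diff_le[OF U h] B) auto
  qed simp
  moreover have "((\<lambda>y. B * dist y x) \<longlongrightarrow> 0) (at x)"
    by (auto intro!: tendsto_eq_intros)
  ultimately have "((\<lambda>y. dist (path_cost h U y) (path_cost h U x)) \<longlongrightarrow> 0) (at x)"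
    by (rule tendsto_sandwich[rotated, OF _ tendsto_const]) simp_all
  then show "isCont (path_cost h U) x"
    unfolding isCont_def by (rule tendsto_dist_iff[THEN iffD2])
qed

text \<open>A cheap exit path has length at most \<open>c / m\<close>, so a subsequence converges uniformly by
  Arzela-Ascoli; Fatou's lemma bounds the integral along the limit path.\<close>

lemma exit_path_limit:
  fixes h :: "nat \<Rightarrow> 'a::euclidean_space \<Rightarrow> real"
  assumes h: "\<And>k. continuous_on UNIV (h k)" "\<And>k x. m \<le> h k x" "\<And>x. incseq (\<lambda>k. h k x)" and "m > 0"
    and U: "open U" "U \<noteq> UNIV" and K: "compact K"
    and small: "\<And>k. \<exists>x\<in>K. path_cost (h k) U x < c"
  obtains L :: real and \<sigma> where "0 \<le> L" "1-lipschitz_on {0..L} \<sigma>" "\<sigma> 0 \<in> K" "\<sigma> L \<notin> U"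
    "(\<integral>\<^sup>+t\<in>{0..L}. (SUP k. ennreal (h k (\<sigma> t))) \<partial>lborel) \<le> ennreal c"
proof -
  have hnn: "0 \<le> h k x" for k x using h(2)[of k x] \<open>m > 0\<close> by linarith
  have "\<exists>L \<sigma>. \<sigma> 0 \<in> K \<and> (L, \<sigma>) \<in> exit_paths U (\<sigma> 0) \<and> integral {0..L} (\<lambda>t. h k (\<sigma> t)) < c" for k
  proof -
    obtain x where x: "x \<in> K" "path_cost (h k) U x < c" using small by blast
    obtain L \<sigma> where "(L, \<sigma>) \<in> exit_paths U x" "integral {0..L} (\<lambda>t. h k (\<sigma> t)) < c"
      using path_cost_less[OF U(2) x(2)] by blast
    moreover from this have "\<sigma> 0 = x" by (auto simp: exit_paths_def)
    ultimately show ?thesis using x(1) by blast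
  qed
  then obtain L \<sigma> where L\<sigma>: "\<And>k. \<sigma> k 0 \<in> K" "\<And>k. (L k, \<sigma> k) \<in> exit_paths U (\<sigma> k 0)"
    "\<And>k. integral {0..L k} (\<lambda>t. h k (\<sigma> k t)) < c" by metis
  have P: "0 \<le> L k" "1-lipschitz_on {0..L k} (\<sigma> k)" "\<sigma> k (L k) \<notin> U" for k
    using L\<sigma>(2)[of k] by (auto simp: exit_paths_def)
  have int: "(\<lambda>t. h k (\<sigma> k t)) integrable_on {0..L k}" for k
    by (rule integrable_continuous_interval[OF continuous_on_exit_path[OF h(1) L\<sigma>(2)]])
  define M where "M = c / m"
  have LM: "L k \<le> M" for k
  proof -
    have "L k * m = integral {0..L k} (\<lambda>_. m)" using P by simp
    also have "\<dots> \<le> integral {0..L k} (\<lambda>t. h k (\<sigma> k t))" by (rule integral_le) (use h int in auto)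
    also have "\<dots> < c" by fact
    finally show ?thesis using \<open>m > 0\<close> by (simp add: M_def field_simps)
  qed
  \<comment> \<open>Freezing each path at its end point puts all of them on the common interval
    \<open>{0..M}\<close>, as Arzela-Ascoli requires.\<close>
  define \<tau> where "\<tau> k t = \<sigma> k (min t (L k))" for k t
  have lip\<tau>: "dist (\<tau> k s) (\<tau> k t) \<le> dist s t" if "0 \<le> s" "0 \<le> t" for k s t
  proof -
    have "dist (\<tau> k s) (\<tau> k t) \<le> 1 * dist (min s (L k)) (min t (L k))"
      unfolding \<tau>_def by (rule lipschitz_onD[OF P(2)]) (use that P(1) in auto)
    also have "\<dots> \<le> dist s t" by (auto simp: dist_real_def)
    finally show ?thesis .
  qed
  obtain b where b: "\<And>x. x \<in> K \<Longrightarrow> norm x \<le> b" using compact_imp_bounded[OF K] by (auto simp: bounded_iff)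
  have \<tau>0: "\<tau> k 0 = \<sigma> k 0" for k using P(1)[of k] by (simp add: \<tau>_def)
  obtain g r where g: "continuous_on {0..M} g" "strict_mono (r :: nat \<Rightarrow> nat)"
    "\<And>e. 0 < e \<Longrightarrow> \<exists>N. \<forall>n x. n \<ge> N \<and> x \<in> {0..M} \<longrightarrow> norm (\<tau> (r n) x - g x) < e"
  proof (rule Arzela_Ascoli[of "{0..M}" \<tau> "b + M"])
    fix n x assume x: "x \<in> {0..M}"
    have "dist (\<tau> n x) (\<tau> n 0) \<le> dist x 0" using x by (intro lip\<tau>) auto
    then have "norm (\<tau> n x - \<tau> n 0) \<le> M" using x by (simp add: dist_norm)
    then show "norm (\<tau> n x) \<le> b + M"
      using norm_triangle_ineq2[of "\<tau> n x" "\<tau> n 0"] b[OF L\<sigma>(1)[of n]] by (simp add: \<tau>0)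
  next
    fix x e :: real assume x: "x \<in> {0..M}" and "0 < e"
    then show "\<exists>d>0. \<forall>n y. y \<in> {0..M} \<and> norm (x - y) < d \<longrightarrow> norm (\<tau> n x - \<tau> n y) < e"
      using lip\<tau> by (intro exI[of _ e]) (auto simp: dist_norm intro: le_less_trans)
  qed auto
  \<comment> \<open>The lengths need a further subsequence; at their limit \<open>l\<close> the
    limit path turns out to be outside \<open>U\<close>.\<close>
  obtain l q where l: "l \<in> {0..M}" "strict_mono (q :: nat \<Rightarrow> nat)" "((\<lambda>k. L (r k)) \<circ> q) \<longlonglongrightarrow> l"
    using seq_compactE[of "{0..M}" "\<lambda>k. L (r k)"] P(1) LM compact_imp_seq_compact[of "{0..M}"] by auto
  define \<rho> where "\<rho> k = r (q k)" for k
  have \<rho>: "strict_mono \<rho>" unfolding \<rho>_def using strict_mono_compose[OF g(2) l(2)] by (simp add: o_def)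
  have limL: "(\<lambda>k. L (\<rho> k)) \<longlonglongrightarrow> l" using l(3) by (simp add: o_def \<rho>_def)
  have lim\<tau>: "(\<lambda>k. \<tau> (\<rho> k) t) \<longlonglongrightarrow> g t" if "t \<in> {0..M}" for t
  proof -
    have "(\<lambda>n. \<tau> (r n) t) \<longlonglongrightarrow> g t"
    proof (rule LIMSEQ_I)
      fix e :: real assume "e > 0"
      from g(3)[OF this] that show "\<exists>N. \<forall>n\<ge>N. norm (\<tau> (r n) t - g t) < e" by blast
    qed
    from LIMSEQ_subseq_LIMSEQ[OF this l(2)] show ?thesis by (simp add: o_def \<rho>_def)
  qed
  show thesis
  proof (rule that[of l g])
    show "0 \<le> l" using l(1) by simp
    show "1-lipschitz_on {0..l} g"
    proof (rule lipschitz_onI)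
      fix s t assume "s \<in> {0..l}" "t \<in> {0..l}"
      then have st: "s \<in> {0..M}" "t \<in> {0..M}" using l(1) by auto
      have "(\<lambda>k. dist (\<tau> (\<rho> k) s) (\<tau> (\<rho> k) t)) \<longlonglongrightarrow> dist (g s) (g t)"
        by (intro tendsto_dist lim\<tau> st)
      then show "dist (g s) (g t) \<le> 1 * dist s t"
        by (rule tendsto_upperbound) (use st in \<open>auto intro!: always_eventually lip\<tau>\<close>)
    qed simp
    have "(\<lambda>k. \<sigma> (\<rho> k) 0) \<longlonglongrightarrow> g 0" using lim\<tau>[of 0] l(1) by (simp add: \<tau>0)
    then show "g 0 \<in> K"
      using closed_sequentially[OF compact_imp_closed[OF K], of "\<lambda>k. \<sigma> (\<rho> k) 0" "g 0"] L\<sigma>(1) by simp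
    have "(\<lambda>k. \<tau> (\<rho> k) (L (\<rho> k))) \<longlonglongrightarrow> g l"
    proof -
      have "(\<lambda>k. dist (\<tau> (\<rho> k) (L (\<rho> k))) (\<tau> (\<rho> k) l)) \<longlonglongrightarrow> 0"
      proof (rule tendsto_sandwich[OF _ _ tendsto_const])
        show "\<forall>\<^sub>F k in sequentially. dist (\<tau> (\<rho> k) (L (\<rho> k))) (\<tau> (\<rho> k) l) \<le> dist (L (\<rho> k)) l"
          using P(1) l(1) by (intro always_eventually allI lip\<tau>) auto
        show "(\<lambda>k. dist (L (\<rho> k)) l) \<longlonglongrightarrow> 0" using limL by (rule tendsto_dist_iff[THEN iffD1])
      qed simp
      moreover have "(\<lambda>k. dist (\<tau> (\<rho> k) l) (g l)) \<longlonglongrightarrow> 0"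
        using lim\<tau>[OF l(1)] by (rule tendsto_dist_iff[THEN iffD1])
      ultimately have "(\<lambda>k. dist (\<tau> (\<rho> k) (L (\<rho> k))) (\<tau> (\<rho> k) l) + dist (\<tau> (\<rho> k) l) (g l)) \<longlonglongrightarrow> 0 + 0"
        by (rule tendsto_add)
      then have lim0: "(\<lambda>k. dist (\<tau> (\<rho> k) (L (\<rho> k))) (\<tau> (\<rho> k) l) + dist (\<tau> (\<rho> k) l) (g l)) \<longlonglongrightarrow> 0"
        by simp
      have "(\<lambda>k. dist (\<tau> (\<rho> k) (L (\<rho> k))) (g l)) \<longlonglongrightarrow> 0"
        by (rule Lim_null_comparison[OF _ lim0]) (simp add: dist_triangle)
      then show ?thesis by (rule tendsto_dist_iff[THEN iffD2])
    qed
    moreover have "\<tau> (\<rho> k) (L (\<rho> k)) \<in> - U" for k using P(3) by (simp add: \<tau>_def)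
    ultimately have "g l \<in> - U"
      using closed_sequentially[of "- U" "\<lambda>k. \<tau> (\<rho> k) (L (\<rho> k))" "g l"] U(1) by (simp add: closed_Compl)
    then show "g l \<notin> U" by simp
    define f where "f k t = ennreal (h (\<rho> k) (\<tau> (\<rho> k) t)) * indicator {0..L (\<rho> k)} t" for k t
    have meas: "f k \<in> borel_measurable lborel" for k
    proof -
      have "continuous_on {0..L (\<rho> k)} (\<lambda>t. h (\<rho> k) (\<sigma> (\<rho> k) t))"
        by (rule continuous_on_exit_path[OF h(1) L\<sigma>(2)])
      then have "(\<lambda>t. indicator {0..L (\<rho> k)} t *\<^sub>R h (\<rho> k) (\<sigma> (\<rho> k) t)) \<in> borel_measurable borel"
        by (intro borel_measurable_continuous_on_indicator) auto
      then have "(\<lambda>t. ennreal (indicator {0..L (\<rho> k)} t *\<^sub>R h (\<rho> k) (\<sigma> (\<rho> k) t))) \<in> borel_measurable borel"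
        by measurable
      moreover have "f k = (\<lambda>t. ennreal (indicator {0..L (\<rho> k)} t *\<^sub>R h (\<rho> k) (\<sigma> (\<rho> k) t)))"
        by (auto simp: f_def \<tau>_def indicator_def fun_eq_iff)
      ultimately show ?thesis by simp
    qed
    have intf: "(\<integral>\<^sup>+t. f k t \<partial>lborel) \<le> ennreal c" for k
    proof -
      have "(\<integral>\<^sup>+t. f k t \<partial>lborel) = (\<integral>\<^sup>+t\<in>{0..L (\<rho> k)}. ennreal (h (\<rho> k) (\<sigma> (\<rho> k) t)) \<partial>lborel)"
        by (rule nn_integral_cong) (auto simp: f_def \<tau>_def indicator_def)
      also have "\<dots> = ennreal (integral {0..L (\<rho> k)} (\<lambda>t. h (\<rho> k) (\<sigma> (\<rho> k) t)))"
        by (rule nn_integral_continuous_interval[OF continuous_on_exit_path[OF h(1) L\<sigma>(2)] hnn])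
      also have "\<dots> \<le> ennreal c" using L\<sigma>(3)[of "\<rho> k"] by (intro ennreal_leI) simp
      finally show ?thesis .
    qed
    \<comment> \<open>The index \<open>j\<close> stays fixed while \<open>k\<close> grows:
      eventually \<open>h (\<rho> k)\<close> dominates \<open>h j\<close>, and only the continuity
      of the single function \<open>h j\<close> enters.\<close>
    have lower: "(SUP j. ennreal (h j (g t))) \<le> liminf (\<lambda>k. f k t)" if t: "0 \<le> t" "t < l" for t
    proof (rule SUP_least)
      fix j
      have tM: "t \<in> {0..M}" using t l(1) by auto
      have "\<forall>\<^sub>F k in sequentially. j \<le> \<rho> k"
        using filterlim_subseq[OF \<rho>] by (simp add: filterlim_at_top)
      moreover have "\<forall>\<^sub>F k in sequentially. t < L (\<rho> k)" using limL t(2) by (rule order_tendstoD)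
      ultimately have ev: "\<forall>\<^sub>F k in sequentially. ennreal (h j (\<tau> (\<rho> k) t)) \<le> f k t"
      proof eventually_elim
        case (elim k)
        have "h j (\<tau> (\<rho> k) t) \<le> h (\<rho> k) (\<tau> (\<rho> k) t)" using incseqD[OF h(3) elim(1)] .
        then show ?case using elim t by (simp add: f_def ennreal_leI)
      qed
      have "isCont (h j) (g t)" using h(1)[of j] by (simp add: continuous_on_eq_continuous_at)
      from isCont_tendsto_compose[OF this lim\<tau>[OF tM]]
      have "(\<lambda>k. ennreal (h j (\<tau> (\<rho> k) t))) \<longlonglongrightarrow> ennreal (h j (g t))" by (rule tendsto_ennrealI)
      from lim_imp_Liminf[OF _ this] have "ennreal (h j (g t)) = liminf (\<lambda>k. ennreal (h j (\<tau> (\<rho> k) t)))" by simp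
      also have "\<dots> \<le> liminf (\<lambda>k. f k t)" by (rule Liminf_mono[OF ev])
      finally show "ennreal (h j (g t)) \<le> liminf (\<lambda>k. f k t)" .
    qed
    have "(\<integral>\<^sup>+t\<in>{0..l}. (SUP k. ennreal (h k (g t))) \<partial>lborel) \<le> (\<integral>\<^sup>+t. liminf (\<lambda>k. f k t) \<partial>lborel)"
    proof (rule nn_integral_mono_AE)
      \<comment> \<open>At \<open>t = l\<close> the estimate may fail: all approximating paths may
        end before \<open>l\<close>, and then \<open>f k l = 0\<close>.\<close>
      have "AE t in lborel. t \<noteq> l" by (rule AE_lborel_singleton)
      then show "AE t in lborel. (SUP k. ennreal (h k (g t))) * indicator {0..l} t \<le> liminf (\<lambda>k. f k t)"
      proof eventually_elim
        case (elim t)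
        then show ?case using lower[of t] by (auto simp: indicator_def)
      qed
    qed
    also have "\<dots> \<le> liminf (\<lambda>k. \<integral>\<^sup>+t. f k t \<partial>lborel)" by (rule nn_integral_liminf[OF meas])
    also have "\<dots> \<le> liminf (\<lambda>k. ennreal c)" by (rule Liminf_mono) (use intf in simp)
    also have "\<dots> = ennreal c" by (simp add: Liminf_const)
    finally show "(\<integral>\<^sup>+t\<in>{0..l}. (SUP k. ennreal (h k (g t))) \<partial>lborel) \<le> ennreal c" .
  qed
qed

section \<open>Lower semicontinuous majorants\<close>

lemma measurable_ennreal_powr [measurable]: "(\<lambda>x. ennreal_powr x p) \<in> borel_measurable borel"
  unfolding ennreal_powr_def by measurable

text \<open>The whole space is treated separately because \<open>infdist x {} = 0\<close>.\<close>

definition ramp :: "'a::metric_space set \<Rightarrow> nat \<Rightarrow> 'a \<Rightarrow> real" where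
  "ramp V k x = (if V = UNIV then 1 else min 1 (real k * infdist x (- V)))"

lemma continuous_on_ramp: "continuous_on S (ramp V k)"
  unfolding ramp_def by (cases "V = UNIV") (auto intro!: continuous_intros)

lemma ramp_bounds: "0 \<le> ramp V k x" "ramp V k x \<le> indicator V x"
  by (auto simp: ramp_def indicator_def infdist_nonneg)

lemma ramp_mono: "k \<le> l \<Longrightarrow> ramp V k x \<le> ramp V l x"
proof -
  assume "k \<le> l"
  then have "real k * infdist x (- V) \<le> real l * infdist x (- V)"
    by (intro mult_right_mono infdist_nonneg) simp
  then show ?thesis by (auto simp: ramp_def min_def)
qed

lemma ramp_eventually_1:
  assumes "open V" "x \<in> V"
  shows "\<forall>\<^sub>F k in sequentially. ramp V k x = 1"
proof (cases "V = UNIV")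
  case False
  have "infdist x (- V) > 0"
    using assms False in_closed_iff_infdist_zero[of "- V" x] infdist_nonneg[of x "- V"]
    by (auto simp: closed_Compl less_le)
  moreover obtain N :: nat where "1 / infdist x (- V) \<le> real N" using real_arch_simple by blast
  ultimately have "ramp V k x = 1" if "k \<ge> N" for k
    using that False by (auto simp: ramp_def field_simps min_def intro: antisym order_trans[OF _ mult_right_mono])
  then show ?thesis unfolding eventually_sequentially by blast
qed (simp add: ramp_def)

text \<open>Layer cake: \<open>f\<close> lies between \<open>\<tau> \<Sum>\<^sub>j 1\<^bsub>A j\<^esub>\<close> and \<open>\<tau> + \<tau> \<Sum>\<^sub>j 1\<^bsub>A j\<^esub>\<close>, where \<open>A j\<close> is the
  set on which \<open>f > \<tau> (j + 1)\<close>; the majorant replaces each \<open>A j\<close> by a slightly larger open set.\<close>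

lemma lsc_majorant:
  fixes f :: "'a::euclidean_space \<Rightarrow> ennreal"
  assumes f: "f \<in> borel_measurable lebesgue" and "\<tau> > 0"
  obtains H :: "nat \<Rightarrow> 'a \<Rightarrow> real" where "\<And>k. continuous_on UNIV (H k)" "\<And>k x. \<tau> \<le> H k x"
    "\<And>x. incseq (\<lambda>k. H k x)" "\<And>x. f x \<le> (SUP k. ennreal (H k x))"
    "\<And>k S. S \<in> sets lebesgue \<Longrightarrow> (\<integral>\<^sup>+x\<in>S. ennreal (H k x) \<partial>lebesgue)
       \<le> ennreal \<tau> * emeasure lebesgue S + (\<integral>\<^sup>+x. f x \<partial>lebesgue) + ennreal \<tau>"
proof -
  define A where "A j = {x. ennreal (\<tau> * real (Suc j)) < f x}" for j
  have A: "A j \<in> sets lebesgue" for j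
    using measurable_sets[OF f, of "{ennreal (\<tau> * real (Suc j))<..}"]
    by (simp add: A_def vimage_def)
  \<comment> \<open>The excess measures \<open>(1/2) ^ Suc j\<close> have partial sums at most 1,
    which yields the last \<open>\<tau>\<close> of the integral bound.\<close>
  have "\<exists>V. open V \<and> A j \<subseteq> V \<and> V - A j \<in> lmeasurable \<and> emeasure lebesgue (V - A j) < ennreal ((1/2) ^ Suc j)" for j
    using sets_lebesgue_outer_open[OF A, of "(1/2) ^ Suc j" j] by (metis zero_less_power half_gt_zero zero_less_one)
  then obtain V where V: "\<And>j. open (V j)" "\<And>j. A j \<subseteq> V j" "\<And>j. V j - A j \<in> lmeasurable"
    "\<And>j. emeasure lebesgue (V j - A j) < ennreal ((1/2) ^ Suc j)" by metis
  \<comment> \<open>The number of layers and the steepness of the ramps both grow with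
    \<open>k\<close>, so the sequence increases while each \<open>H k\<close> is a finite sum of
    continuous functions. The leading \<open>\<tau>\<close> makes up for the incomplete layer and
    keeps \<open>H k\<close> away from 0.\<close>
  define H where "H k x = \<tau> + \<tau> * (\<Sum>j<k. ramp (V j) k x)" for k x
  have layer: "(\<Sum>j<k. ennreal \<tau> * indicator (A j) x) \<le> f x" for k x
  proof (induction k)
    case (Suc k)
    show ?case
    proof (cases "x \<in> A k")
      case True
      have "(\<Sum>j<Suc k. ennreal \<tau> * indicator (A j) x) \<le> (\<Sum>j<Suc k. ennreal \<tau>)"
        by (rule sum_mono) (auto simp: indicator_def)
      also have "\<dots> = ennreal (\<tau> * real (Suc k))"
        using \<open>\<tau> > 0\<close> by (simp add: ennreal_mult' ennreal_of_nat_eq_real_of_nat mult.commute del: of_nat_Suc sum.lessThan_Suc)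
      also have "\<dots> \<le> f x" using True by (simp add: A_def)
      finally show ?thesis .
    qed (use Suc in simp)
  qed simp
  show thesis
  proof (rule that[of H])
    show "continuous_on UNIV (H k)" for k
      unfolding H_def by (intro continuous_intros continuous_on_ramp)
    show "\<tau> \<le> H k x" for k x
      using \<open>\<tau> > 0\<close> by (simp add: H_def sum_nonneg ramp_bounds)
    show "incseq (\<lambda>k. H k x)" for x
    proof (rule incseq_SucI)
      fix k
      have "(\<Sum>j<k. ramp (V j) k x) \<le> (\<Sum>j<k. ramp (V j) (Suc k) x)" by (intro sum_mono ramp_mono) simp
      also have "\<dots> \<le> (\<Sum>j<Suc k. ramp (V j) (Suc k) x)" by (simp add: ramp_bounds)
      finally show "H k x \<le> H (Suc k) x" using \<open>\<tau> > 0\<close> by (simp add: H_def)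
    qed
    show "f x \<le> (SUP k. ennreal (H k x))" for x
    proof (rule ccontr)
      assume "\<not> f x \<le> (SUP k. ennreal (H k x))"
      then have less: "(SUP k. ennreal (H k x)) < f x" by simp
      then obtain s where s: "(SUP k. ennreal (H k x)) = ennreal s" "0 \<le> s"
        by (cases "SUP k. ennreal (H k x)") auto
      \<comment> \<open>The number of full layers below \<open>s\<close>. As \<open>s < f x\<close>,
        the point lies in the first \<open>n\<close> sets \<open>V j\<close>; with the leading
        \<open>\<tau>\<close> this gives \<open>H k x \<ge> \<tau> * (n + 1) > s\<close> for a large
        \<open>k\<close>.\<close>
      define n where "n = nat \<lfloor>s / \<tau>\<rfloor>"
      have n: "\<tau> * real n \<le> s" "s < \<tau> * (real n + 1)"
      proof -
        have "real n = of_int \<lfloor>s / \<tau>\<rfloor>" using s(2) \<open>\<tau> > 0\<close> by (simp add: n_def)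
        then have "real n \<le> s / \<tau>" "s / \<tau> < real n + 1" by linarith+
        then show "\<tau> * real n \<le> s" "s < \<tau> * (real n + 1)" using \<open>\<tau> > 0\<close> by (auto simp: field_simps)
      qed
      have "x \<in> V j" if "j < n" for j
      proof -
        have "\<tau> * real (Suc j) \<le> \<tau> * real n" using that \<open>\<tau> > 0\<close> by (intro mult_left_mono) auto
        then have "ennreal (\<tau> * real (Suc j)) \<le> ennreal s" using n by (intro ennreal_leI) linarith
        also have "\<dots> < f x" using less s by simp
        finally show ?thesis using V(2) by (auto simp: A_def)
      qed
      then have "\<forall>\<^sub>F k in sequentially. \<forall>j\<in>{..<n}. ramp (V j) k x = 1"
        by (intro eventually_ball_finite ballI ramp_eventually_1 V) auto
      then have "\<forall>\<^sub>F k in sequentially. n \<le> k \<and> (\<forall>j\<in>{..<n}. ramp (V j) k x = 1)"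
        using eventually_ge_at_top by (rule eventually_conj[rotated])
      then obtain k where k: "n \<le> k" "\<And>j. j < n \<Longrightarrow> ramp (V j) k x = 1"
        unfolding eventually_sequentially by auto
      have "real n = (\<Sum>j<n. ramp (V j) k x)" using k(2) by simp
      also have "\<dots> \<le> (\<Sum>j<k. ramp (V j) k x)" using k(1) by (intro sum_mono2) (auto simp: ramp_bounds)
      finally have "\<tau> * (real n + 1) \<le> H k x" using \<open>\<tau> > 0\<close> by (simp add: H_def algebra_simps)
      then have "s < H k x" using n by linarith
      then have "ennreal s < ennreal (H k x)" using s(2) by (simp add: ennreal_less_iff)
      also have "\<dots> \<le> (SUP k. ennreal (H k x))" by (rule SUP_upper) simp
      finally show False using s(1) by simp
    qed
    fix k S assume S: "S \<in> sets (lebesgue :: 'a measure)"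
    have pt: "ennreal (H k x) * indicator S x
        \<le> ennreal \<tau> * indicator S x + f x + (\<Sum>j<k. ennreal \<tau> * indicator (V j - A j) x)" for x
    proof (cases "x \<in> S")
      case True
      have "ennreal (H k x) \<le> ennreal (\<tau> + (\<Sum>j<k. \<tau> * indicator (V j) x))"
        unfolding H_def sum_distrib_left[symmetric] using \<open>\<tau> > 0\<close>
        by (intro ennreal_leI add_left_mono mult_left_mono sum_mono ramp_bounds) auto
      also have "\<dots> = ennreal \<tau> + (\<Sum>j<k. ennreal (\<tau> * indicator (V j) x))"
        using \<open>\<tau> > 0\<close> by (simp add: ennreal_plus sum_nonneg sum_ennreal)
      also have "(\<Sum>j<k. ennreal (\<tau> * indicator (V j) x))
          = (\<Sum>j<k. ennreal \<tau> * indicator (A j) x + ennreal \<tau> * indicator (V j - A j) x)"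
        using V(2) by (intro sum.cong) (auto simp: indicator_def)
      also have "\<dots> = (\<Sum>j<k. ennreal \<tau> * indicator (A j) x) + (\<Sum>j<k. ennreal \<tau> * indicator (V j - A j) x)"
        by (rule sum.distrib)
      also have "\<dots> \<le> f x + (\<Sum>j<k. ennreal \<tau> * indicator (V j - A j) x)"
        by (intro add_right_mono layer)
      finally show ?thesis using True by (simp add: add.assoc add_left_mono)
    qed simp
    have "(\<integral>\<^sup>+x\<in>S. ennreal (H k x) \<partial>lebesgue)
        \<le> (\<integral>\<^sup>+x. ennreal \<tau> * indicator S x + f x + (\<Sum>j<k. ennreal \<tau> * indicator (V j - A j) x) \<partial>lebesgue)"
      by (rule nn_integral_mono) (rule pt)
    also have "\<dots> = ennreal \<tau> * emeasure lebesgue S + (\<integral>\<^sup>+x. f x \<partial>lebesgue)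
        + (\<Sum>j<k. ennreal \<tau> * emeasure lebesgue (V j - A j))"
    proof -
      have V': "V j - A j \<in> sets lebesgue" for j using V(3) by (rule fmeasurableD)
      have m: "(\<lambda>x. ennreal \<tau> * indicator W x) \<in> borel_measurable lebesgue" if "W \<in> sets lebesgue" for W :: "'a set"
        using that by (intro borel_measurable_times_ennreal borel_measurable_indicator) auto
      have "(\<integral>\<^sup>+x. ennreal \<tau> * indicator S x + f x + (\<Sum>j<k. ennreal \<tau> * indicator (V j - A j) x) \<partial>lebesgue)
        = (\<integral>\<^sup>+x. ennreal \<tau> * indicator S x + f x \<partial>lebesgue)
          + (\<integral>\<^sup>+x. (\<Sum>j<k. ennreal \<tau> * indicator (V j - A j) x) \<partial>lebesgue)"
        by (rule nn_integral_add) (intro borel_measurable_add borel_measurable_sum m S f V')+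
      also have "(\<integral>\<^sup>+x. ennreal \<tau> * indicator S x + f x \<partial>lebesgue)
          = ennreal \<tau> * emeasure lebesgue S + (\<integral>\<^sup>+x. f x \<partial>lebesgue)"
        by (subst nn_integral_add[OF m[OF S] f]) (simp add: nn_integral_cmult_indicator[OF S])
      also have "(\<integral>\<^sup>+x. (\<Sum>j<k. ennreal \<tau> * indicator (V j - A j) x) \<partial>lebesgue)
          = (\<Sum>j<k. ennreal \<tau> * emeasure lebesgue (V j - A j))"
        by (subst nn_integral_sum[OF m[OF V']]) (simp add: nn_integral_cmult_indicator[OF V'])
      finally show ?thesis .
    qed
    also have "(\<Sum>j<k. ennreal \<tau> * emeasure lebesgue (V j - A j)) \<le> (\<Sum>j<k. ennreal (\<tau> * (1/2) ^ Suc j))"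
      using \<open>\<tau> > 0\<close> less_imp_le[OF V(4)]
      by (intro sum_mono) (simp add: ennreal_mult' mult_left_mono del: power_Suc)
    also have "\<dots> = ennreal (\<tau> * (\<Sum>j<k. (1/2) ^ Suc j))"
      using \<open>\<tau> > 0\<close> by (simp add: sum_ennreal sum_distrib_left)
    also have "\<dots> \<le> ennreal \<tau>"
    proof (rule ennreal_leI)
      have "(\<Sum>j<k. (1/2::real) ^ Suc j) = 1 - (1/2) ^ k" by (induction k) auto
      then have "(\<Sum>j<k. (1/2::real) ^ Suc j) \<le> 1" by simp
      then show "\<tau> * (\<Sum>j<k. (1/2) ^ Suc j) \<le> \<tau>" using \<open>\<tau> > 0\<close> by (simp add: mult_left_le)
    qed
    finally show "(\<integral>\<^sup>+x\<in>S. ennreal (H k x) \<partial>lebesgue)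
       \<le> ennreal \<tau> * emeasure lebesgue S + (\<integral>\<^sup>+x. f x \<partial>lebesgue) + ennreal \<tau>"
      by (simp add: add_left_mono)
  qed
qed

text \<open>Integrals over shrinking end intervals tend to the integral over the single point
  \<open>T\<close>, which is null. This is continuity from above for the measure with density
  \<open>f\<close>, hence the finite total.\<close>

lemma small_tail_integral:
  fixes f :: "real \<Rightarrow> ennreal"
  assumes f: "(\<lambda>t. f t * indicator {0..T} t) \<in> borel_measurable lborel" and "0 < T"
    and fin: "(\<integral>\<^sup>+t\<in>{0..T}. f t \<partial>lborel) < \<infinity>" and "e > 0"
  obtains t where "0 \<le> t" "t < T" "(\<integral>\<^sup>+s\<in>{t..T}. f s \<partial>lborel) < e"
proof -
  define N where "N = density lborel (\<lambda>t. f t * indicator {0..T} t)"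
  define B where "B n = {T - T / real (Suc n)..T}" for n
  have sub: "B n \<subseteq> {0..T}" for n
    using \<open>0 < T\<close> by (auto simp: B_def field_simps)
  have B: "B n \<in> sets N" for n by (simp add: B_def N_def)
  have NB: "emeasure N (B n) = (\<integral>\<^sup>+s\<in>B n. f s \<partial>lborel)" for n
  proof -
    have "emeasure N (B n) = (\<integral>\<^sup>+t. f t * indicator {0..T} t * indicator (B n) t \<partial>lborel)"
      unfolding N_def by (rule emeasure_density[OF f]) (simp add: B_def)
    also have "\<dots> = (\<integral>\<^sup>+s\<in>B n. f s \<partial>lborel)"
      by (rule nn_integral_cong) (use sub[of n] in \<open>auto simp: indicator_def\<close>)
    finally show ?thesis .
  qed
  have "(INF n. emeasure N (B n)) = emeasure N (\<Inter>n. B n)"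
  proof (rule INF_emeasure_decseq')
    show "decseq B"
      unfolding decseq_def B_def using \<open>0 < T\<close> by (auto intro: order_trans[rotated] divide_left_mono)
    have "emeasure N (B 0) \<le> (\<integral>\<^sup>+t\<in>{0..T}. f t \<partial>lborel)"
      unfolding NB by (rule nn_integral_mono) (use sub[of 0] in \<open>auto simp: indicator_def\<close>)
    with fin show "\<exists>n. emeasure N (B n) \<noteq> \<infinity>" by (metis infinity_ennreal_def leD)
  qed (rule B)
  also have "(\<Inter>n. B n) = {T}"
  proof -
    have "s = T" if s: "\<And>n. s \<in> B n" for s
    proof (rule ccontr)
      assume "s \<noteq> T"
      then have "s < T" using s[of 0] by (auto simp: B_def)
      obtain n :: nat where "T / (T - s) < real n" using reals_Archimedean2 by blast
      then have "T < real (Suc n) * (T - s)" using \<open>s < T\<close> by (simp add: field_simps)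
      then have "T / real (Suc n) < T - s" by (simp add: field_simps)
      then show False using s[of n] by (simp add: B_def)
    qed
    moreover have "T \<in> B n" for n using \<open>0 < T\<close> by (simp add: B_def)
    ultimately show ?thesis by auto
  qed
  also have "emeasure N {T} = 0"
  proof -
    have "emeasure N {T} = (\<integral>\<^sup>+t. f t * indicator {0..T} t * indicator {T} t \<partial>lborel)"
      unfolding N_def by (rule emeasure_density[OF f]) simp
    also have "\<dots> = (\<integral>\<^sup>+t. 0 \<partial>(lborel :: real measure))"
      by (rule nn_integral_cong_AE) (use AE_lborel_singleton[of T] in \<open>auto simp: indicator_def\<close>)
    finally show ?thesis by simp
  qed
  finally have "(INF n. emeasure N (B n)) < e" using \<open>e > 0\<close> by simp
  then obtain n where n: "emeasure N (B n) < e" by (auto simp: INF_less_iff)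
  show thesis
  proof (rule that)
    show "0 \<le> T - T / real (Suc n)" "T - T / real (Suc n) < T"
      using \<open>0 < T\<close> by (simp_all add: field_simps)
    show "(\<integral>\<^sup>+s\<in>{T - T / real (Suc n)..T}. f s \<partial>lborel) < e"
      using n unfolding NB by (simp only: B_def)
  qed
qed

text \<open>The clause of \<open>weak_upper_gradient\<close> for a single curve, kept apart so that
  the gradient can be enlarged curve by curve.\<close>

definition upper_ineq :: "('a::metric_space \<Rightarrow> ereal) \<Rightarrow> ('a \<Rightarrow> ennreal) \<Rightarrow> 'a curve \<Rightarrow> bool" where
  "upper_ineq u g = (\<lambda>(a, b, \<gamma>).
     if \<bar>u (\<gamma> a)\<bar> \<noteq> \<infinity> \<and> \<bar>u (\<gamma> b)\<bar> \<noteq> \<infinity>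
     then e2ennreal \<bar>u (\<gamma> a) - u (\<gamma> b)\<bar> \<le> line_integral g (a, b, \<gamma>)
     else line_integral g (a, b, \<gamma>) = \<infinity>)"

lemma upper_ineq_mono:
  assumes "upper_ineq u g (a, b, \<gamma>)" "is_curve (a, b, \<gamma>)" "\<And>x. x \<in> \<gamma> ` {a..b} \<Longrightarrow> g x \<le> g' x"
  shows "upper_ineq u g' (a, b, \<gamma>)"
proof -
  have "line_integral g (a, b, \<gamma>) \<le> line_integral g' (a, b, \<gamma>)"
    by (rule line_integral_mono[OF assms(2,3)])
  with assms(1) show ?thesis
    unfolding upper_ineq_def prod.case
    by (cases "\<bar>u (\<gamma> a)\<bar> \<noteq> \<infinity> \<and> \<bar>u (\<gamma> b)\<bar> \<noteq> \<infinity>") (simp_all only: if_True if_False top_unique infinity_ennreal_def, auto)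
qed

lemma measurable_SUP_path:
  fixes h :: "nat \<Rightarrow> 'a::metric_space \<Rightarrow> real" and a b :: real
  assumes h: "\<And>k. continuous_on UNIV (h k)" and \<sigma>: "1-lipschitz_on {a..b} \<sigma>"
  shows "(\<lambda>t. (SUP k. ennreal (h k (\<sigma> t))) * indicator {a..b} t) \<in> borel_measurable lborel"
proof -
  have "(\<lambda>t. ennreal (h k (\<sigma> t)) * indicator {a..b} t) \<in> borel_measurable lborel" for k
  proof -
    have "continuous_on {a..b} (\<lambda>t. h k (\<sigma> t))"
      by (rule continuous_on_compose2[OF h lipschitz_on_continuous_on[OF \<sigma>]]) simp
    then have "(\<lambda>t. indicator {a..b} t *\<^sub>R h k (\<sigma> t)) \<in> borel_measurable borel"
      by (intro borel_measurable_continuous_on_indicator) auto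
    then have "(\<lambda>t. ennreal (indicator {a..b} t *\<^sub>R h k (\<sigma> t))) \<in> borel_measurable lborel" by simp
    moreover have "(\<lambda>t. ennreal (indicator {a..b} t *\<^sub>R h k (\<sigma> t))) = (\<lambda>t. ennreal (h k (\<sigma> t)) * indicator {a..b} t)"
      by (auto simp: indicator_def)
    ultimately show ?thesis by simp
  qed
  then have "(\<lambda>t. SUP k. ennreal (h k (\<sigma> t)) * indicator {a..b} t) \<in> borel_measurable lborel"
    by measurable
  then show ?thesis by (simp add: SUP_mult_right_ennreal)
qed

section \<open>Continuous and smooth competitors for the capacity\<close>

text \<open>Otherwise \<open>exit_path_limit\<close> yields a path from \<open>K\<close> to the complement of \<open>U\<close> whose
  \<open>G\<close>-integral is at most \<open>1/2\<close>. Up to the first exit time \<open>u\<close> stays above \<open>1/2\<close> by the gradient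
  of \<open>u\<close> in \<open>U\<close>. This gradient says nothing about the exit point itself: there \<open>u\<close> is continuous
  along the path by the gradient of \<open>u\<close> on the whole space, which is only known to be below \<open>C G\<close>.\<close>

lemma path_cost_lower_bound:
  fixes h :: "nat \<Rightarrow> 'a::euclidean_space \<Rightarrow> real" and u :: "'a \<Rightarrow> ereal"
  defines "G \<equiv> \<lambda>x. SUP k. ennreal (h k x)"
  assumes h: "\<And>k. continuous_on UNIV (h k)" "\<And>k x. m \<le> h k x" "\<And>x. incseq (\<lambda>k. h k x)" and "m > 0"
    and U: "open U" "U \<noteq> UNIV" and K: "compact K" "K \<subseteq> U"
    and u: "\<And>x. x \<in> K \<Longrightarrow> u x = 1" "\<And>x. x \<notin> U \<Longrightarrow> u x = 0" and "0 \<le> C"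
    and inside: "\<And>a b \<gamma>. is_curve (a, b, \<gamma>) \<Longrightarrow> \<gamma> ` {a..b} \<subseteq> U \<Longrightarrow> line_integral G (a, b, \<gamma>) < 1
        \<Longrightarrow> upper_ineq u G (a, b, \<gamma>)"
    and everywhere: "\<And>a b \<gamma>. is_curve (a, b, \<gamma>) \<Longrightarrow> line_integral G (a, b, \<gamma>) < 1
        \<Longrightarrow> upper_ineq u (\<lambda>x. SUP k. ennreal (C * h k x)) (a, b, \<gamma>)"
  shows "\<exists>k. \<forall>x\<in>K. 1/2 \<le> path_cost (h k) U x"
proof (rule ccontr)
  have hnn: "0 \<le> h k x" for k x using h(2)[of k x] \<open>m > 0\<close> by linarith
  assume "\<not> ?thesis"
  then have small: "\<exists>x\<in>K. path_cost (h k) U x < 1/2" for k by (meson not_le)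
  obtain L :: real and \<sigma> where L: "0 \<le> L" "1-lipschitz_on {0..L} \<sigma>" "\<sigma> 0 \<in> K" "\<sigma> L \<notin> U"
    "(\<integral>\<^sup>+t\<in>{0..L}. G (\<sigma> t) \<partial>lborel) \<le> ennreal (1/2)"
    unfolding G_def by (rule exit_path_limit[OF h \<open>m > 0\<close> U K(1) small]) blast
  define J where "J s t = (\<integral>\<^sup>+r\<in>{s..t}. G (\<sigma> r) \<partial>lborel)" for s t
  have J: "J s t \<le> ennreal (1/2)" if "0 \<le> s" "t \<le> L" for s t
  proof -
    have "J s t \<le> (\<integral>\<^sup>+t\<in>{0..L}. G (\<sigma> t) \<partial>lborel)"
      unfolding J_def by (rule nn_integral_mono) (use that in \<open>auto simp: indicator_def\<close>)
    with L(5) show ?thesis by (rule order_trans[rotated])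
  qed
  have J1: "J s t < \<infinity>" if "0 \<le> s" "t \<le> L" for s t
    by (rule order.strict_trans1[OF J[OF that]]) (simp only: infinity_ennreal_def ennreal_less_top)
  have lip: "1-lipschitz_on {s..t} \<sigma>" if "0 \<le> s" "t \<le> L" for s t
    by (rule lipschitz_on_subset[OF L(2)]) (use that in auto)
  have lineG: "line_integral G (s, t, \<sigma>) \<le> J s t" if "0 \<le> s" "s \<le> t" "t \<le> L" for s t
    unfolding G_def J_def
    by (rule line_integral_SUP_le_lipschitz[OF h(1) hnn h(3) that(2) lip]) (use that in auto)
  \<comment> \<open>As 1/2 is below the threshold 1 in \<open>inside\<close> and
    \<open>everywhere\<close>, these hypotheses become available for subpaths that are
    curves.\<close>
  have lineG1: "line_integral G (s, t, \<sigma>) < 1" if "0 \<le> s" "s \<le> t" "t \<le> L" for s t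
  proof -
    have "line_integral G (s, t, \<sigma>) \<le> ennreal (1/2)" using lineG[OF that] J[of s t] that by (auto intro: order_trans)
    also have "ennreal (1/2) < ennreal 1" by (subst ennreal_less_iff) auto
    finally show ?thesis by simp
  qed
  have lineC: "line_integral (\<lambda>x. SUP k. ennreal (C * h k x)) (s, t, \<sigma>) \<le> ennreal C * J s t"
    if st: "0 \<le> s" "s \<le> t" "t \<le> L" for s t
  proof -
    have "line_integral (\<lambda>x. SUP k. ennreal (C * h k x)) (s, t, \<sigma>)
        \<le> (\<integral>\<^sup>+r\<in>{s..t}. (SUP k. ennreal (C * h k (\<sigma> r))) \<partial>lborel)"
    proof (rule line_integral_SUP_le_lipschitz[OF _ _ _ st(2) lip])
      show "continuous_on UNIV (\<lambda>x. C * h k x)" for k by (intro continuous_intros h(1))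
      show "incseq (\<lambda>k. C * h k x)" for x
        using h(3)[of x] \<open>0 \<le> C\<close> by (auto simp: incseq_def intro: mult_left_mono)
    qed (use st hnn \<open>0 \<le> C\<close> in auto)
    also have "\<dots> = (\<integral>\<^sup>+r. ennreal C * (G (\<sigma> r) * indicator {s..t} r) \<partial>lborel)"
      unfolding G_def using \<open>0 \<le> C\<close> hnn
      by (simp add: ennreal_mult SUP_mult_left_ennreal[symmetric] mult.assoc)
    also have "\<dots> = ennreal C * J s t"
      unfolding J_def G_def
      by (rule nn_integral_cmult[OF measurable_SUP_path[OF h(1) lip]]) (use st in auto)
    finally show ?thesis .
  qed
  \<comment> \<open>Constant pieces do not count as curves; each use of this fact treats them
    separately, where the claim is trivial.\<close>
  have curve: "is_curve (s, t, \<sigma>)" if "0 \<le> s" "s \<le> t" "t \<le> L" "\<not> \<sigma> constant_on {s..t}" for s t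
    unfolding is_curve_def prod.case
  proof (intro conjI that lipschitz_on_continuous_on[OF lip[OF that(1,3)]])
    have "path_length \<sigma> s t \<le> ennreal (t - s)" by (rule path_length_lipschitz[OF lip]) (use that in auto)
    also have "\<dots> < \<infinity>" by simp
    finally show "path_length \<sigma> s t < \<infinity>" .
  qed
  have const: "\<sigma> s = \<sigma> t" if "s \<le> t" "\<sigma> constant_on {s..t}" for s t
    using that unfolding constant_on_def by (metis atLeastAtMost_iff order_refl)
  have u0: "u (\<sigma> 0) = 1" by (rule u(1)[OF L(3)])
  \<comment> \<open>An infinite value would force an infinite line integral through the else branch
    of \<open>upper_ineq\<close>.\<close>
  have fin: "\<bar>u (\<sigma> t)\<bar> \<noteq> \<infinity>" if t: "0 \<le> t" "t \<le> L" for t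
  proof (cases "\<sigma> constant_on {0..t}")
    case True
    from const[OF t(1) this] u0 show ?thesis by simp
  next
    case False
    have "line_integral (\<lambda>x. SUP k. ennreal (C * h k x)) (0, t, \<sigma>) \<le> ennreal C * J 0 t"
      by (rule lineC) (use t in auto)
    also have "\<dots> < \<infinity>" using J1[of 0 t] t by (simp add: ennreal_mult_less_top)
    finally have "line_integral (\<lambda>x. SUP k. ennreal (C * h k x)) (0, t, \<sigma>) \<noteq> \<infinity>" by simp
    moreover have "upper_ineq u (\<lambda>x. SUP k. ennreal (C * h k x)) (0, t, \<sigma>)"
      by (rule everywhere[OF curve lineG1]) (use t False in auto)
    ultimately show ?thesis by (auto simp: upper_ineq_def split: if_splits)
  qed
  define a where "a t = real_of_ereal (u (\<sigma> t))" for t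
  have a: "u (\<sigma> t) = ereal (a t)" if "0 \<le> t" "t \<le> L" for t
    using fin[OF that] by (simp add: a_def ereal_real)
  have DC: "ennreal \<bar>a s - a t\<bar> \<le> ennreal C * J s t" if st: "0 \<le> s" "s \<le> t" "t \<le> L" for s t
  proof (cases "\<sigma> constant_on {s..t}")
    case True
    from const[OF st(2) this] show ?thesis by (simp add: a_def)
  next
    case False
    have "upper_ineq u (\<lambda>x. SUP k. ennreal (C * h k x)) (s, t, \<sigma>)"
      by (rule everywhere[OF curve lineG1]) (use st False in auto)
    then have "ennreal \<bar>a s - a t\<bar> \<le> line_integral (\<lambda>x. SUP k. ennreal (C * h k x)) (s, t, \<sigma>)"
      using a st by (simp add: upper_ineq_def e2ennreal_ereal)
    with lineC[OF st] show ?thesis by (rule order_trans[rotated])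
  qed
  \<comment> \<open>This set is closed, so its infimum \<open>T\<close> is a first exit time; it is
    positive because the path starts in \<open>K\<close>.\<close>
  define X where "X = {t\<in>{0..L}. \<sigma> t \<in> - U}"
  define T where "T = Inf X"
  have "closed X"
  proof -
    have "closed ({0..L} \<inter> \<sigma> -` (- U))"
      using U(1) by (intro continuous_closed_preimage lipschitz_on_continuous_on[OF L(2)]) auto
    also have "{0..L} \<inter> \<sigma> -` (- U) = X" by (auto simp: X_def)
    finally show ?thesis .
  qed
  moreover have "L \<in> X" using L by (simp add: X_def)
  moreover have bdd: "bdd_below X" by (rule bdd_belowI[of _ 0]) (simp add: X_def)
  ultimately have "T \<in> X" unfolding T_def using closed_contains_Inf[of X] by blast
  then have T: "0 \<le> T" "T \<le> L" "\<sigma> T \<notin> U" by (auto simp: X_def)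
  have before: "\<sigma> t \<in> U" if "0 \<le> t" "t < T" for t
  proof (rule ccontr)
    assume "\<sigma> t \<notin> U"
    then have "t \<in> X" using that T by (simp add: X_def)
    then have "T \<le> t" unfolding T_def using bdd by (rule cInf_lower)
    with that show False by simp
  qed
  have "T \<noteq> 0" using T(3) L(3) K(2) by auto
  then have "0 < T" using T by simp
  have aT: "a T = 0" using u(2)[OF T(3)] by (simp add: a_def)
  have a0: "a 0 = 1" using u0 by (simp add: a_def)
  have half: "1/2 \<le> a t" if t: "0 \<le> t" "t < T" for t
  proof (cases "\<sigma> constant_on {0..t}")
    case True
    from const[OF t(1) this] a0 show ?thesis by (simp add: a_def)
  next
    case False
    have "upper_ineq u G (0, t, \<sigma>)"
      by (rule inside[OF curve _ lineG1]) (use t T False before in auto)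
    then have "ennreal \<bar>a 0 - a t\<bar> \<le> line_integral G (0, t, \<sigma>)"
      using a t T by (simp add: upper_ineq_def e2ennreal_ereal)
    also have "\<dots> \<le> J 0 t" using t T by (intro lineG) auto
    also have "\<dots> \<le> ennreal (1/2)" using t T by (intro J) auto
    finally have "\<bar>a 0 - a t\<bar> \<le> 1/2" by (subst (asm) ennreal_le_iff) simp_all
    then show ?thesis using a0 by linarith
  qed
  \<comment> \<open>Chosen so that \<open>C * e < 1/2\<close>, whereas \<open>u\<close> falls from
    at least 1/2 to 0 between the times \<open>t\<close> and \<open>T\<close>.\<close>
  define e where "e = 1 / (2 * (C + 1))"
  have "e > 0" using \<open>0 \<le> C\<close> by (simp add: e_def)
  obtain t where t: "0 \<le> t" "t < T" "(\<integral>\<^sup>+s\<in>{t..T}. G (\<sigma> s) \<partial>lborel) < ennreal e"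
  proof (rule small_tail_integral[of "\<lambda>t. G (\<sigma> t)" T "ennreal e"])
    show "(\<lambda>t. G (\<sigma> t) * indicator {0..T} t) \<in> borel_measurable lborel"
      unfolding G_def by (rule measurable_SUP_path[OF h(1) lip]) (use T in auto)
    show "(\<integral>\<^sup>+t\<in>{0..T}. G (\<sigma> t) \<partial>lborel) < \<infinity>" using J1[of 0 T] T by (simp add: J_def)
  qed (use \<open>0 < T\<close> \<open>e > 0\<close> in auto)
  have "ennreal (1/2) \<le> ennreal \<bar>a t - a T\<bar>" using half[OF t(1,2)] aT by (intro ennreal_leI) auto
  also have "\<dots> \<le> ennreal C * J t T" by (rule DC) (use t T in auto)
  also have "\<dots> \<le> ennreal C * ennreal e" using t(3) by (intro mult_left_mono) (auto simp: J_def)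
  also have "\<dots> = ennreal (C * e)" using \<open>0 \<le> C\<close> \<open>e > 0\<close> by (simp add: ennreal_mult)
  finally have "1/2 \<le> C * e" using \<open>0 \<le> C\<close> \<open>e > 0\<close> by (subst (asm) ennreal_le_iff) simp_all
  then show False using \<open>0 \<le> C\<close> by (simp add: e_def field_simps)
qed

text \<open>Majorants are built for the p-th power, whose integral is the energy; this turns them
  into majorants of the function itself, infinite values included.\<close>

lemma ennreal_powr_SUP_le:
  fixes H :: "nat \<Rightarrow> real"
  assumes "p > 0" "\<And>k. 0 \<le> H k" "ennreal_powr y p \<le> (SUP k. ennreal (H k))"
  shows "y \<le> (SUP k. ennreal (H k powr (1 / p)))"
proof (rule ccontr)
  assume "\<not> y \<le> (SUP k. ennreal (H k powr (1 / p)))"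
  then have less: "(SUP k. ennreal (H k powr (1 / p))) < y" by simp
  then obtain s where s: "(SUP k. ennreal (H k powr (1 / p))) = ennreal s" "0 \<le> s"
    by (cases "SUP k. ennreal (H k powr (1 / p))") auto
  have "H k \<le> s powr p" for k
  proof -
    have "ennreal (H k powr (1 / p)) \<le> ennreal s" unfolding s(1)[symmetric] by (rule SUP_upper) simp
    then have "H k powr (1 / p) \<le> s" using s(2) by simp
    then have "(H k powr (1 / p)) powr p \<le> s powr p" using assms(1) by (intro powr_mono2) auto
    then show ?thesis using assms(1) assms(2)[of k] by (simp add: powr_powr)
  qed
  then have "(SUP k. ennreal (H k)) \<le> ennreal (s powr p)" by (intro SUP_least ennreal_leI)
  with assms(3) have le: "ennreal_powr y p \<le> ennreal (s powr p)" by (rule order_trans)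
  show False
  proof (cases y)
    case (real t)
    then have "s < t" using less s by (simp add: ennreal_less_iff)
    then have "s powr p < t powr p" using s(2) assms(1) by (intro powr_less_mono2) auto
    then show False using le real by simp
  next
    case top
    then show False using le by (simp add: ennreal_powr_def top_unique)
  qed
qed

lemma measurable_ennreal_powr_comp:
  "f \<in> borel_measurable M \<Longrightarrow> (\<lambda>x. ennreal_powr (f x) p) \<in> borel_measurable M"
  by (rule measurable_compose[OF _ measurable_ennreal_powr])

text \<open>The factor 6 counts contributions of at most \<open>A\<close>: the gradient in the ball,
  the weighted gradient on the whole space, the two admissible densities, and the two error terms of
  \<open>lsc_majorant\<close>.\<close>

lemma continuous_competitor:
  fixes w :: "'a::euclidean_space"
  assumes p: "1 \<le> p" and K: "compact K" "K \<subseteq> ball w r" and A: "cap p K (ball w r) < ennreal A"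
  obtains H :: "'a \<Rightarrow> real" and m where "continuous_on UNIV H" "m > 0" "\<And>x. m \<le> H x"
    "(\<integral>\<^sup>+x\<in>ball w r. ennreal (H x powr p) \<partial>lebesgue) \<le> ennreal (6 * A)"
    "\<And>x. x \<in> K \<Longrightarrow> 1/2 \<le> path_cost H (ball w r) x"
proof -
  define U where "U = ball w r"
  have "A > 0" using A by (metis ennreal_eq_0_iff not_less not_less_zero)
  have p0: "p > 0" using p by simp
  have U: "open U" "U \<noteq> UNIV" "U \<in> sets lebesgue" "emeasure lebesgue U < \<infinity>"
  proof -
    show "open U" "U \<in> sets lebesgue" by (simp_all add: U_def)
    show "U \<noteq> UNIV" using bounded_ball[of w r] not_bounded_UNIV[where 'a='a] unfolding U_def by metis
    show "emeasure lebesgue U < \<infinity>" using emeasure_bounded_finite[OF bounded_ball[of w r]] by (simp add: U_def)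
  qed
  obtain u0 g where u0: "u0 \<in> newtonian p" "\<forall>x\<in>-U. u0 x = 0" "\<forall>x\<in>K. restrict u0 U x = 1"
    and g: "weak_upper_gradient p U (restrict u0 U) g"
    and gA: "(\<integral>\<^sup>+x\<in>U. ennreal_powr (g x) p \<partial>lebesgue) < ennreal A"
    using A unfolding cap_def INF_less_iff newtonian_zero_def U_def[symmetric] by auto
  obtain g0 where g0: "weak_upper_gradient p UNIV u0 g0" "(\<integral>\<^sup>+x. ennreal_powr (g0 x) p \<partial>lebesgue) < \<infinity>"
    using u0(1) unfolding newtonian_def by auto
  obtain \<Gamma> where \<Gamma>: "modulus p \<Gamma> = 0" "\<And>a b \<gamma>. is_curve (a, b, \<gamma>) \<Longrightarrow> \<gamma> ` {a..b} \<subseteq> U \<Longrightarrow> (a, b, \<gamma>) \<notin> \<Gamma>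
      \<Longrightarrow> upper_ineq (restrict u0 U) g (a, b, \<gamma>)"
    using g unfolding weak_upper_gradient_def upper_ineq_def prod.case by metis
  obtain \<Gamma>0 where \<Gamma>0: "modulus p \<Gamma>0 = 0" "\<And>a b \<gamma>. is_curve (a, b, \<gamma>) \<Longrightarrow> (a, b, \<gamma>) \<notin> \<Gamma>0
      \<Longrightarrow> upper_ineq u0 g0 (a, b, \<gamma>)"
    using g0(1) unfolding weak_upper_gradient_def upper_ineq_def prod.case by (metis subset_UNIV)
  \<comment> \<open>Modulus 0 permits densities with energy below any positive number; below
    \<open>A\<close> is small enough.\<close>
  have adm: "\<exists>\<rho>. \<rho> \<in> borel_measurable borel \<and> (\<forall>\<gamma>\<in>\<Delta>. 1 \<le> line_integral \<rho> \<gamma>)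
      \<and> (\<integral>\<^sup>+x. ennreal_powr (\<rho> x) p \<partial>lebesgue) < ennreal A" if "modulus p \<Delta> = 0" for \<Delta> :: "'a curve set"
  proof -
    have "modulus p \<Delta> < ennreal A" using that \<open>A > 0\<close> by simp
    then show ?thesis unfolding modulus_def INF_less_iff by auto
  qed
  obtain \<rho> where \<rho>: "\<rho> \<in> borel_measurable borel" "\<And>\<gamma>. \<gamma> \<in> \<Gamma> \<Longrightarrow> 1 \<le> line_integral \<rho> \<gamma>"
      "(\<integral>\<^sup>+x. ennreal_powr (\<rho> x) p \<partial>lebesgue) < ennreal A" using adm[OF \<Gamma>(1)] by blast
  obtain \<rho>0 where \<rho>0: "\<rho>0 \<in> borel_measurable borel" "\<And>\<gamma>. \<gamma> \<in> \<Gamma>0 \<Longrightarrow> 1 \<le> line_integral \<rho>0 \<gamma>"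
      "(\<integral>\<^sup>+x. ennreal_powr (\<rho>0 x) p \<partial>lebesgue) < ennreal A" using adm[OF \<Gamma>0(1)] by blast
  define I0 where "I0 = enn2real (\<integral>\<^sup>+x. ennreal_powr (g0 x) p \<partial>lebesgue)"
  have I0: "(\<integral>\<^sup>+x. ennreal_powr (g0 x) p \<partial>lebesgue) = ennreal I0" "0 \<le> I0"
    using g0(2) by (auto simp: I0_def)
  \<comment> \<open>The energy \<open>I0\<close> of \<open>g0\<close> is finite but uncontrolled;
    the weight \<open>\<delta>\<close> caps its share at \<open>A\<close>. The price is the factor
    \<open>C = (1 / \<delta>) powr (1 / p)\<close> below, and \<open>path_cost_lower_bound\<close>
    tolerates a factor of any size.\<close>
  define \<delta> where "\<delta> = A / (1 + I0)"
  have \<delta>: "\<delta> > 0" "\<delta> * I0 \<le> A" using \<open>A > 0\<close> I0(2) by (auto simp: \<delta>_def field_simps)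
  \<comment> \<open>The admissible densities \<open>\<rho>\<close>, \<open>\<rho>0\<close> enter \<open>f\<close> so that no curve whose integral is below \<open>1\<close> is exceptional.\<close>
  define f where "f x = ennreal_powr (g x) p * indicator U x + ennreal \<delta> * ennreal_powr (g0 x) p
      + ennreal_powr (\<rho> x) p + ennreal_powr (\<rho>0 x) p" for x
  have m1: "(\<lambda>x. ennreal_powr (g x) p * indicator U x) \<in> borel_measurable lebesgue"
  proof -
    have "(\<lambda>x. ennreal_powr (g x) p) \<in> borel_measurable (lebesgue_on U)"
      using g by (intro measurable_ennreal_powr_comp) (simp add: weak_upper_gradient_def)
    then show ?thesis by (subst (asm) borel_measurable_restrict_space_iff_ennreal) (use U in auto)
  qed
  have m2: "(\<lambda>x. ennreal \<delta> * ennreal_powr (g0 x) p) \<in> borel_measurable lebesgue"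
    using g0(1) by (intro borel_measurable_times_ennreal measurable_ennreal_powr_comp)
      (auto simp: weak_upper_gradient_def lebesgue_on_UNIV_eq)
  have m3: "(\<lambda>x. ennreal_powr (\<rho> x) p) \<in> borel_measurable lebesgue" "(\<lambda>x. ennreal_powr (\<rho>0 x) p) \<in> borel_measurable lebesgue"
    using \<rho>(1) \<rho>0(1) by (auto intro!: measurable_ennreal_powr_comp simp: measurable_completion)
  have mf: "f \<in> borel_measurable lebesgue"
    unfolding f_def by (intro borel_measurable_add m1 m2 m3)
  have intf: "(\<integral>\<^sup>+x. f x \<partial>lebesgue) \<le> ennreal (4 * A)"
  proof -
    have "(\<integral>\<^sup>+x. f x \<partial>lebesgue) = (\<integral>\<^sup>+x\<in>U. ennreal_powr (g x) p \<partial>lebesgue) + (\<integral>\<^sup>+x. ennreal \<delta> * ennreal_powr (g0 x) p \<partial>lebesgue)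
        + (\<integral>\<^sup>+x. ennreal_powr (\<rho> x) p \<partial>lebesgue) + (\<integral>\<^sup>+x. ennreal_powr (\<rho>0 x) p \<partial>lebesgue)"
      unfolding f_def using m1 m2 m3 by (simp only: nn_integral_add borel_measurable_add)
    also have "(\<integral>\<^sup>+x. ennreal \<delta> * ennreal_powr (g0 x) p \<partial>lebesgue) = ennreal \<delta> * (\<integral>\<^sup>+x. ennreal_powr (g0 x) p \<partial>lebesgue)"
      using g0(1) by (intro nn_integral_cmult measurable_ennreal_powr_comp)
        (auto simp: weak_upper_gradient_def lebesgue_on_UNIV_eq)
    also have "\<dots> = ennreal (\<delta> * I0)" using I0 \<delta> by (simp add: ennreal_mult)
    also have "\<dots> \<le> ennreal A" using \<delta> by (intro ennreal_leI)
    finally have "(\<integral>\<^sup>+x. f x \<partial>lebesgue) \<le> ennreal A + ennreal A + ennreal A + ennreal A"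
      using gA \<rho>(3) \<rho>0(3) by (auto intro: order_trans[OF _ add_mono[OF add_mono[OF add_mono]]] less_imp_le)
    also have "\<dots> = ennreal (4 * A)" using \<open>A > 0\<close> by (simp flip: ennreal_plus)
    finally show ?thesis .
  qed
  define V where "V = enn2real (emeasure lebesgue U)"
  have V: "emeasure lebesgue U = ennreal V" "0 \<le> V" using U(4) by (auto simp: V_def)
  \<comment> \<open>\<open>lsc_majorant\<close> costs \<open>\<tau>\<close> times the measure of
    \<open>U\<close> plus another \<open>\<tau>\<close>; each is at most \<open>A\<close>.\<close>
  define \<tau> where "\<tau> = A / (1 + V)"
  have \<tau>: "\<tau> > 0" "\<tau> * V \<le> A" "\<tau> \<le> A" using \<open>A > 0\<close> V(2) by (auto simp: \<tau>_def field_simps)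
  obtain F :: "nat \<Rightarrow> 'a \<Rightarrow> real" where F: "\<And>k. continuous_on UNIV (F k)" "\<And>k x. \<tau> \<le> F k x"
    "\<And>x. incseq (\<lambda>k. F k x)" "\<And>x. f x \<le> (SUP k. ennreal (F k x))"
    "\<And>k S. S \<in> sets lebesgue \<Longrightarrow> (\<integral>\<^sup>+x\<in>S. ennreal (F k x) \<partial>lebesgue)
       \<le> ennreal \<tau> * emeasure lebesgue S + (\<integral>\<^sup>+x. f x \<partial>lebesgue) + ennreal \<tau>"
    using lsc_majorant[OF mf \<tau>(1)] by blast
  have F0: "0 < F k x" for k x using F(2)[of k x] \<tau> by linarith
  define h where "h k x = F k x powr (1 / p)" for k x
  define m where "m = \<tau> powr (1 / p)"
  have h: "\<And>k. continuous_on UNIV (h k)" "\<And>k x. m \<le> h k x" "\<And>x. incseq (\<lambda>k. h k x)" and "m > 0"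
  proof -
    show "continuous_on UNIV (h k)" for k
      unfolding h_def using F0[of k] by (intro continuous_on_powr F continuous_intros) (metis less_irrefl)
    show "m \<le> h k x" for k x
      unfolding h_def m_def using \<tau> F(2) p by (intro powr_mono2) auto
    show "incseq (\<lambda>k. h k x)" for x
      unfolding incseq_def h_def
      using F(3)[of x] less_imp_le[OF F0[of _ x]] p by (auto simp: incseq_def intro!: powr_mono2)
    show "m > 0" using \<tau> by (simp add: m_def)
  qed
  define G where "G x = (SUP k. ennreal (h k x))" for x
  have G: "y \<le> G x" if "ennreal_powr y p \<le> f x" for y x
    unfolding G_def h_def using that F(4)[of x] F0 by (intro ennreal_powr_SUP_le[OF p0]) (auto intro: less_imp_le)
  have G1: "g x \<le> G x" if "x \<in> U" for x
    by (rule G) (use that in \<open>simp add: f_def add.assoc add_increasing2\<close>)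
  have G3: "\<rho> x \<le> G x" "\<rho>0 x \<le> G x" for x
    by (rule G; simp add: f_def add_increasing add_increasing2)+
  define C where "C = (1 / \<delta>) powr (1 / p)"
  have "C > 0" using \<delta> by (simp add: C_def)
  have G2: "g0 x \<le> (SUP k. ennreal (C * h k x))" for x
  proof -
    have "C * h k x = (F k x / \<delta>) powr (1 / p)" for k
      using \<delta> F0[of k x] by (simp add: C_def h_def powr_mult[symmetric])
    moreover have "ennreal_powr (g0 x) p \<le> (SUP k. ennreal (F k x / \<delta>))"
    proof -
      have "ennreal \<delta> * ennreal_powr (g0 x) p \<le> f x" by (simp add: f_def add_increasing add_increasing2)
      also have "\<dots> \<le> (SUP k. ennreal (F k x))" by (rule F)
      finally have "ennreal (1 / \<delta>) * (ennreal \<delta> * ennreal_powr (g0 x) p) \<le> ennreal (1 / \<delta>) * (SUP k. ennreal (F k x))"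
        by (rule mult_left_mono) simp
      also have "ennreal (1 / \<delta>) * (ennreal \<delta> * ennreal_powr (g0 x) p) = ennreal_powr (g0 x) p"
        using \<delta> by (simp add: mult.assoc[symmetric] ennreal_mult[symmetric])
      also have "ennreal (1 / \<delta>) * (SUP k. ennreal (F k x)) = (SUP k. ennreal (F k x / \<delta>))"
        using \<delta> F0[of _ x] by (simp add: SUP_mult_left_ennreal ennreal_mult[symmetric] less_imp_le)
      finally show ?thesis .
    qed
    ultimately show ?thesis
      using F0 \<delta> by (simp only:) (intro ennreal_powr_SUP_le[OF p0], auto intro: less_imp_le)
  qed
  have "\<exists>k. \<forall>x\<in>K. 1/2 \<le> path_cost (h k) U x"
  proof (rule path_cost_lower_bound[OF h \<open>m > 0\<close> U(1,2) K(1), of u0 C, folded G_def])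
    show KU: "K \<subseteq> U" using K(2) by (simp add: U_def)
    show "u0 x = 1" if "x \<in> K" for x using bspec[OF u0(3) that] subsetD[OF KU that] by simp
    show "u0 x = 0" if "x \<notin> U" for x using u0(2) that by simp
    show "0 \<le> C" using \<open>C > 0\<close> by simp
  next
    fix a b \<gamma> assume c: "is_curve (a, b, \<gamma>)" "\<gamma> ` {a..b} \<subseteq> U" "line_integral G (a, b, \<gamma>) < 1"
    have "line_integral \<rho> (a, b, \<gamma>) \<le> line_integral G (a, b, \<gamma>)" by (rule line_integral_mono[OF c(1) G3(1)])
    with c(3) have "line_integral \<rho> (a, b, \<gamma>) < 1" by (rule le_less_trans[rotated])
    then have "(a, b, \<gamma>) \<notin> \<Gamma>" using \<rho>(2) by (meson not_less)
    then have "upper_ineq (restrict u0 U) g (a, b, \<gamma>)" by (rule \<Gamma>(2)[OF c(1,2)])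
    then have "upper_ineq (restrict u0 U) G (a, b, \<gamma>)" by (rule upper_ineq_mono[OF _ c(1)]) (use c(2) G1 in auto)
    moreover have "\<gamma> a \<in> U" "\<gamma> b \<in> U" using c(2) is_curveD(1)[OF c(1)] by auto
    then have "restrict u0 U (\<gamma> a) = u0 (\<gamma> a)" "restrict u0 U (\<gamma> b) = u0 (\<gamma> b)" by simp_all
    ultimately show "upper_ineq u0 G (a, b, \<gamma>)" by (simp only: upper_ineq_def prod.case)
  next
    fix a b \<gamma> assume c: "is_curve (a, b, \<gamma>)" "line_integral G (a, b, \<gamma>) < 1"
    have "line_integral \<rho>0 (a, b, \<gamma>) \<le> line_integral G (a, b, \<gamma>)" by (rule line_integral_mono[OF c(1) G3(2)])
    with c(2) have "line_integral \<rho>0 (a, b, \<gamma>) < 1" by (rule le_less_trans[rotated])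
    then have "(a, b, \<gamma>) \<notin> \<Gamma>0" using \<rho>0(2) by (meson not_less)
    then have "upper_ineq u0 g0 (a, b, \<gamma>)" by (rule \<Gamma>0(2)[OF c(1)])
    then show "upper_ineq u0 (\<lambda>x. SUP k. ennreal (C * h k x)) (a, b, \<gamma>)"
      by (rule upper_ineq_mono[OF _ c(1)]) (rule G2)
  qed
  then obtain k where k: "\<And>x. x \<in> K \<Longrightarrow> 1/2 \<le> path_cost (h k) U x" by blast
  show thesis
  proof (rule that[OF h(1) \<open>m > 0\<close> h(2)])
    have "h k x powr p = F k x" for x using F0[of k x] p by (simp add: h_def powr_powr)
    then have "(\<integral>\<^sup>+x\<in>U. ennreal (h k x powr p) \<partial>lebesgue)
        \<le> ennreal \<tau> * emeasure lebesgue U + (\<integral>\<^sup>+x. f x \<partial>lebesgue) + ennreal \<tau>" using F(5)[OF U(3), of k] by simp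
    also have "\<dots> \<le> ennreal A + ennreal (4 * A) + ennreal A"
      using \<tau> V intf by (intro add_mono) (auto simp: ennreal_mult[symmetric] intro: ennreal_leI)
    also have "\<dots> = ennreal (6 * A)" using \<open>A > 0\<close> by (simp flip: ennreal_plus)
    finally show "(\<integral>\<^sup>+x\<in>ball w r. ennreal (h k x powr p) \<partial>lebesgue) \<le> ennreal (6 * A)" by (simp add: U_def)
    show "1/2 \<le> path_cost (h k) (ball w r) x" if "x \<in> K" for x using k[OF that] by (simp add: U_def)
  qed
qed

lemma abs_clamp_diff_le:
  fixes a b :: real
  shows "\<bar>max 0 (min 1 a) - max 0 (min 1 b)\<bar> \<le> \<bar>a - b\<bar>"
  by linarith

text \<open>The value 1 is reached on a neighbourhood of \<open>K\<close>, so that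
  \<open>1 - v\<close> vanishes near \<open>K\<close> and can enter a test function with compact
  support in the domain. In \<open>8 powr p\<close>, a factor 4 is the slope of the truncation and 2
  the local oscillation of the weight.\<close>

lemma smooth_competitor:
  fixes w :: "'a::euclidean_space"
  assumes p: "1 \<le> p" and K: "compact K" "K \<subseteq> ball w r" and A: "cap p K (ball w r) < ennreal A"
  obtains v where "v \<in> C0_infty (ball w r)" "\<exists>N. open N \<and> K \<subseteq> N \<and> (\<forall>x\<in>N. v x = 1)"
    "(\<integral>\<^sup>+x. ennreal (norm (gradient v x) powr p) \<partial>lebesgue) \<le> ennreal (8 powr p * (6 * A))"
proof -
  define U where "U = ball w r"
  obtain H :: "'a \<Rightarrow> real" and m where H: "continuous_on UNIV H" "m > 0" "\<And>x. m \<le> H x"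
    "(\<integral>\<^sup>+x\<in>U. ennreal (H x powr p) \<partial>lebesgue) \<le> ennreal (6 * A)"
    "\<And>x. x \<in> K \<Longrightarrow> 1/2 \<le> path_cost H U x"
    unfolding U_def using continuous_competitor[OF assms] by blast
  have H0: "0 \<le> H x" for x using H(3)[of x] H(2) by linarith
  have U: "open U" "U \<noteq> UNIV"
  proof -
    show "U \<noteq> UNIV" using bounded_ball[of w r] not_bounded_UNIV[where 'a='a] unfolding U_def by metis
  qed (simp add: U_def)
  define c where "c = path_cost H U"
  have c: "continuous_on UNIV c" unfolding c_def by (rule continuous_on_path_cost[OF U(2) H(1) H0])
  have c0: "c x = 0" if "x \<notin> U" for x unfolding c_def by (rule path_cost_eq_0[OF H(1) H0 that])
  \<comment> \<open>The truncation is linear between the levels 1/8 and 3/8 of \<open>c\<close>.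
    These stay away from the value 0 off \<open>U\<close> and from the values at least 1/2 on
    \<open>K\<close>, which leaves room for mollification at both ends.\<close>
  define v where "v x = max 0 (min 1 (4 * c x - 1/2))" for x
  have v: "continuous_on UNIV v" unfolding v_def by (intro continuous_intros c)
  define S where "S = {x. 1/8 \<le> c x}"
  have "closed S" unfolding S_def by (rule closed_Collect_le) (intro continuous_intros c)+
  have SU: "S \<subseteq> U" using c0 by (force simp: S_def)
  have "bounded S" by (rule bounded_subset[OF _ SU]) (simp add: U_def)
  with \<open>closed S\<close> have "compact S" by (simp add: compact_eq_bounded_closed)
  have vS: "v x = 0" if "x \<notin> S" for x using that by (simp add: v_def S_def)
  define N0 where "N0 = {x. 3/8 < c x}"
  have "open N0" unfolding N0_def by (rule open_Collect_less) (intro continuous_intros c)+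
  have KN0: "K \<subseteq> N0" using H(5) by (force simp: N0_def c_def)
  have vN0: "v x = 1" if "x \<in> N0" for x using that by (simp add: v_def N0_def)
  obtain d1 where d1: "d1 > 0" "(\<Union>x\<in>K. ball x d1) \<subseteq> N0"
    using compact_subset_open_imp_ball_epsilon_subset[OF K(1) \<open>open N0\<close> KN0] by blast
  obtain d2 where d2: "d2 > 0" "(\<Union>x\<in>S. cball x d2) \<subseteq> U"
    using compact_subset_open_imp_cball_epsilon_subset[OF \<open>compact S\<close> U(1) SU] by blast
  \<comment> \<open>Since \<open>m\<close> is a lower bound of \<open>H\<close>, the additive
    tolerance \<open>m\<close> becomes the multiplicative bound
    \<open>H q \<le> 2 * H x\<close>.\<close>
  have "uniformly_continuous_on (cball w (r + 2)) H"
    by (rule compact_uniformly_continuous[OF continuous_on_subset[OF H(1)]]) auto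
  then obtain d3 where d3: "d3 > 0" "\<And>x y. x \<in> cball w (r + 2) \<Longrightarrow> y \<in> cball w (r + 2) \<Longrightarrow> dist y x < d3 \<Longrightarrow> dist (H y) (H x) < m"
    using H(2) unfolding uniformly_continuous_on_def by metis
  \<comment> \<open>\<open>d1\<close> protects the plateau around \<open>K\<close>,
    \<open>d2\<close> the support, \<open>d3\<close> the comparison of weights. For
    \<open>d1\<close> the double radius is needed because \<open>v'\<close> averages around points
    that are already off \<open>K\<close> by up to \<open>d\<close>; for \<open>d3\<close> it is the
    radius in the gradient bound of \<open>mollification\<close>.\<close>
  define d where "d = min (min d1 d2) (min d3 1) / 2"
  have d: "d > 0" "2 * d \<le> d1" "d \<le> d2" "2 * d \<le> d3" "2 * d \<le> 1"
    using d1(1) d2(1) d3(1) by (auto simp: d_def)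
  obtain B0 where B0: "\<And>x. x \<in> U \<Longrightarrow> norm x \<le> B0"
    using bounded_ball[of w r] unfolding U_def bounded_iff by blast
  obtain v' where v': "\<And>k. Ck k v'"
    "\<And>x a. (\<And>y. y \<in> ball x d \<Longrightarrow> v y = a) \<Longrightarrow> v' x = a"
    "\<And>x B. 0 \<le> B \<Longrightarrow> (\<And>y z. y \<in> ball x (2 * d) \<Longrightarrow> z \<in> ball x (2 * d) \<Longrightarrow> \<bar>v y - v z\<bar> \<le> B * dist y z)
        \<Longrightarrow> norm (gradient v' x) \<le> B"
  proof (rule mollification[OF v _ d(1), of B0])
    fix x :: 'a assume "norm x > B0"
    then show "v x = 0" using B0[of x] SU by (intro vS) auto
  qed blast
  \<comment> \<open>The closed \<open>d\<close>-neighbourhood of \<open>S\<close>, written as the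
    image of a compact product.\<close>
  define S' where "S' = (\<lambda>(x, y). x + y) ` (S \<times> cball 0 d)"
  have "compact S'"
    unfolding S'_def by (intro compact_continuous_image compact_Times \<open>compact S\<close>)
      (auto intro!: continuous_intros simp: split_beta)
  have S'U: "S' \<subseteq> U"
  proof
    fix z assume "z \<in> S'"
    then obtain x y where "x \<in> S" "norm y \<le> d" "z = x + y" by (auto simp: S'_def)
    then have "z \<in> cball x d2" using d(3) by (simp add: dist_norm)
    then show "z \<in> U" using d2(2) \<open>x \<in> S\<close> by blast
  qed
  have suppv': "{x. v' x \<noteq> 0} \<subseteq> S'"
  proof
    fix x assume "x \<in> {x. v' x \<noteq> 0}"
    then obtain y where y: "y \<in> ball x d" "v y \<noteq> 0" using v'(2)[of x 0] by auto
    then have "y \<in> S" using vS by blast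
    moreover have "x - y \<in> cball 0 d" using y(1) by (simp add: dist_norm norm_minus_commute)
    ultimately show "x \<in> S'" unfolding S'_def by (intro image_eqI[of _ _ "(y, x - y)"]) auto
  qed
  have cl: "closure {x. v' x \<noteq> 0} \<subseteq> S'"
    by (rule closure_minimal[OF suppv' compact_imp_closed[OF \<open>compact S'\<close>]])
  have "compact (S' \<inter> closure {x. v' x \<noteq> 0})" using \<open>compact S'\<close> by (rule compact_Int_closed) simp
  also have "S' \<inter> closure {x. v' x \<noteq> 0} = closure {x. v' x \<noteq> 0}" using cl by auto
  finally have "compact (closure {x. v' x \<noteq> 0})" .
  then have mem: "v' \<in> C0_infty U" unfolding C0_infty_def using v'(1) cl S'U by auto
  have grad: "norm (gradient v' x) \<le> 8 * H x" if x: "x \<in> U" for x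
  proof (rule v'(3))
    show "0 \<le> 8 * H x" using H0 by simp
    fix y z assume yz: "y \<in> ball x (2 * d)" "z \<in> ball x (2 * d)"
    have seg: "closed_segment y z \<subseteq> ball x (2 * d)" using yz by (intro closed_segment_subset convex_ball)
    have "\<bar>c y - c z\<bar> \<le> (2 * H x) * dist y z"
      unfolding c_def
    proof (rule abs_path_cost_diff_le[OF U(2) H(1) H0])
      fix q assume "q \<in> closed_segment y z"
      then have q: "dist x q < 2 * d" using seg by auto
      then have "dist w q \<le> r + 2" using x d(5) dist_triangle[of w q x] by (simp add: U_def)
      then have "dist (H q) (H x) < m" using x q d(4) by (intro d3) (auto simp: U_def dist_commute)
      then show "H q \<le> 2 * H x" using H(3)[of x] by (simp add: dist_real_def)
    qed
    then show "\<bar>v y - v z\<bar> \<le> 8 * H x * dist y z"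
      using abs_clamp_diff_le[of "4 * c y - 1/2" "4 * c z - 1/2"] unfolding v_def by linarith
  qed
  show thesis
  proof (rule that[of v'])
    show "v' \<in> C0_infty (ball w r)" using mem by (simp add: U_def)
    show "\<exists>N. open N \<and> K \<subseteq> N \<and> (\<forall>x\<in>N. v' x = 1)"
    proof (intro exI[of _ "\<Union>x\<in>K. ball x d"] conjI ballI)
      show "K \<subseteq> (\<Union>x\<in>K. ball x d)" using d(1) by auto
      fix x assume "x \<in> (\<Union>x\<in>K. ball x d)"
      then obtain y where y: "y \<in> K" "dist y x < d" by auto
      show "v' x = 1"
      proof (rule v'(2))
        fix z assume "z \<in> ball x d"
        then have "dist y z < d1" using y d(2) dist_triangle[of y z x] by simp
        then have "z \<in> (\<Union>x\<in>K. ball x d1)" using y(1) by auto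
        then show "v z = 1" using d1(2) by (intro vN0) blast
      qed
    qed auto
    have "(\<integral>\<^sup>+x. ennreal (norm (gradient v' x) powr p) \<partial>lebesgue)
        \<le> (\<integral>\<^sup>+x. ennreal (8 powr p) * (ennreal (H x powr p) * indicator U x) \<partial>lebesgue)"
    proof (rule nn_integral_mono)
      fix x
      show "ennreal (norm (gradient v' x) powr p) \<le> ennreal (8 powr p) * (ennreal (H x powr p) * indicator U x)"
      proof (cases "x \<in> U")
        case True
        have "norm (gradient v' x) powr p \<le> (8 * H x) powr p"
          using grad[OF True] p by (intro powr_mono2) auto
        also have "\<dots> = 8 powr p * H x powr p" using H0[of x] by (simp add: powr_mult)
        finally show ?thesis using True by (simp add: ennreal_mult[symmetric] ennreal_leI)
      next
        case False
        then have "gradient v' x = 0"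
          using suppv' S'U by (intro gradient_eq_0[of "- S'" x v' 0]) (auto simp: compact_imp_closed[OF \<open>compact S'\<close>])
        then show ?thesis by simp
      qed
    qed
    also have "\<dots> = ennreal (8 powr p) * (\<integral>\<^sup>+x\<in>U. ennreal (H x powr p) \<partial>lebesgue)"
    proof (rule nn_integral_cmult)
      have "continuous_on UNIV (\<lambda>x. H x powr p)"
        using H0 p by (intro continuous_on_powr' H(1) continuous_intros) auto
      then have "(\<lambda>x. H x powr p) \<in> borel_measurable borel" by (rule borel_measurable_continuous_onI)
      then have "(\<lambda>x. ennreal (H x powr p) * indicator U x) \<in> borel_measurable borel"
        using borel_open[OF U(1)] by measurable
      then show "(\<lambda>x. ennreal (H x powr p) * indicator U x) \<in> borel_measurable lebesgue"
        by (simp add: measurable_completion)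
    qed
    also have "\<dots> \<le> ennreal (8 powr p) * ennreal (6 * A)" by (intro mult_left_mono H(4)) simp
    also have "\<dots> = ennreal (8 powr p * (6 * A))" by (simp add: ennreal_mult')
    finally show "(\<integral>\<^sup>+x. ennreal (norm (gradient v' x) powr p) \<partial>lebesgue) \<le> ennreal (8 powr p * (6 * A))" .
  qed
qed

section \<open>Cutoff functions and the upper capacity bound for balls\<close>

lemma smooth_cutoff:
  fixes w :: "'a::euclidean_space"
  assumes "r > 0"
  obtains \<phi> where "\<And>k. Ck k \<phi>" "\<And>x. x \<in> cball w r \<Longrightarrow> \<phi> x = 1" "\<And>x. dist w x \<ge> 15/8 * r \<Longrightarrow> \<phi> x = 0"
    "\<And>x. \<bar>\<phi> x\<bar> \<le> 1" "\<And>x. norm (gradient \<phi> x) \<le> 2 / r"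
proof -
  \<comment> \<open>The profile falls with slope 2/r between the radii 5r/4 and 7r/4. Mollifying at
    radius r/8 shifts these to 9r/8 > r and 15r/8 < 2r.\<close>
  define v where "v x = max 0 (min 1 (7/2 - 2 * dist w x / r))" for x
  have v: "continuous_on UNIV v" unfolding v_def using assms by (intro continuous_intros) auto
  have v0: "v x = 0" if "dist w x \<ge> 7/4 * r" for x using that assms by (simp add: v_def field_simps)
  have v1: "v x = 1" if "dist w x \<le> 5/4 * r" for x using that assms by (simp add: v_def field_simps)
  have lip: "\<bar>v x - v y\<bar> \<le> 2 / r * dist x y" for x y
  proof -
    have "\<bar>v x - v y\<bar> \<le> \<bar>(7/2 - 2 * dist w x / r) - (7/2 - 2 * dist w y / r)\<bar>"
      unfolding v_def by (rule abs_clamp_diff_le)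
    also have "(7/2 - 2 * dist w x / r) - (7/2 - 2 * dist w y / r) = 2 / r * (dist w y - dist w x)"
      by (simp add: algebra_simps)
    also have "\<bar>2 / r * (dist w y - dist w x)\<bar> = 2 / r * \<bar>dist w y - dist w x\<bar>"
      using assms by (simp only: abs_mult) simp
    also have "\<dots> \<le> 2 / r * dist x y"
      using assms dist_triangle[of w y x] dist_triangle[of w x y]
      by (intro mult_left_mono) (auto simp: abs_le_iff dist_commute)
    finally show ?thesis .
  qed
  have "r / 8 > 0" using assms by simp
  obtain \<phi> where \<phi>: "\<And>k. Ck k \<phi>"
    "\<And>x a. (\<And>y. y \<in> ball x (r / 8) \<Longrightarrow> v y = a) \<Longrightarrow> \<phi> x = a"
    "\<And>x B. 0 \<le> B \<Longrightarrow> (\<And>y z. y \<in> ball x (2 * (r / 8)) \<Longrightarrow> z \<in> ball x (2 * (r / 8)) \<Longrightarrow> \<bar>v y - v z\<bar> \<le> B * dist y z)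
        \<Longrightarrow> norm (gradient \<phi> x) \<le> B"
    "\<And>x B. (\<And>y. \<bar>v y\<bar> \<le> B) \<Longrightarrow> \<bar>\<phi> x\<bar> \<le> B"
  proof (rule mollification[OF v _ \<open>r / 8 > 0\<close>, of "norm w + 7/4 * r"])
    fix x :: 'a assume "norm x > norm w + 7/4 * r"
    then have "dist w x \<ge> 7/4 * r" using norm_triangle_sub[of x w] by (simp add: dist_norm norm_minus_commute)
    then show "v x = 0" by (rule v0)
  qed blast
  show thesis
  proof (rule that[of \<phi>, OF \<phi>(1)])
    show "\<phi> x = 1" if "x \<in> cball w r" for x
    proof (rule \<phi>(2))
      fix y assume "y \<in> ball x (r / 8)"
      then have "dist w y \<le> 5/4 * r" using that dist_triangle[of w y x] assms by simp
      then show "v y = 1" by (rule v1)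
    qed
    show "\<phi> x = 0" if "dist w x \<ge> 15/8 * r" for x
    proof (rule \<phi>(2))
      fix y assume "y \<in> ball x (r / 8)"
      then have "dist w y \<ge> 7/4 * r" using that dist_triangle[of w x y] by (simp add: dist_commute)
      then show "v y = 0" by (rule v0)
    qed
    show "\<bar>\<phi> x\<bar> \<le> 1" for x by (rule \<phi>(4)) (simp add: v_def)
    show "norm (gradient \<phi> x) \<le> 2 / r" for x by (rule \<phi>(3)) (use assms lip in auto)
  qed
qed

lemma cap_cball_upper:
  fixes w :: "'a::euclidean_space"
  assumes "r > 0" "p > 0"
  shows "cap p (cball w r) (ball w (2 * r)) \<le> ennreal ((2 / r) powr p) * emeasure lebesgue (ball w (2 * r))"
proof -
  obtain \<phi> where \<phi>: "\<And>k. Ck k \<phi>" "\<And>x. x \<in> cball w r \<Longrightarrow> \<phi> x = 1" "\<And>x. dist w x \<ge> 15/8 * r \<Longrightarrow> \<phi> x = 0"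
    "\<And>x. \<bar>\<phi> x\<bar> \<le> 1" "\<And>x. norm (gradient \<phi> x) \<le> 2 / r"
    using smooth_cutoff[OF assms(1)] by blast
  have "cap p (cball w r) (ball w (2 * r)) \<le> (\<integral>\<^sup>+x\<in>ball w (2 * r). ennreal (norm (gradient \<phi> x) powr p) \<partial>lebesgue)"
    by (rule cap_le_gradient[OF \<phi>(1)[of "Suc 0"] assms(2)]) (use assms \<phi>(2,3) in auto)
  also have "\<dots> \<le> (\<integral>\<^sup>+x. ennreal ((2 / r) powr p) * indicator (ball w (2 * r)) x \<partial>lebesgue)"
    by (intro nn_integral_mono mult_right_mono ennreal_leI powr_mono2) (use assms \<phi>(5) in auto)
  also have "\<dots> = ennreal ((2 / r) powr p) * emeasure lebesgue (ball w (2 * r))"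
    by (rule nn_integral_cmult_indicator) simp
  finally show ?thesis .
qed

section \<open>Capacity of a ball\<close>

lemma powr_ge_tangent:
  fixes s m p :: real
  assumes "1 \<le> p" "0 \<le> s" "0 < m"
  shows "m powr p + p * m powr (p - 1) * (s - m) \<le> s powr p"
proof (cases "s = 0")
  case True
  have "m powr p = m powr (p - 1) * m" using powr_mult_base[of m "p - 1"] assms by (simp add: mult.commute)
  then have "m powr p + p * m powr (p - 1) * (s - m) = (1 - p) * (m powr (p - 1) * m)"
    using True by (simp add: algebra_simps)
  also have "\<dots> \<le> 0" using assms by (intro mult_nonpos_nonneg) auto
  finally show ?thesis using True by simp
next
  case False
  define t where "t = s / m"
  have t: "t > 0" "s = t * m" using assms False by (auto simp: t_def)
  \<comment> \<open>Young's inequality gives Bernoulli's inequality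
    \<open>1 + p * (t - 1) \<le> t powr p\<close>; scaling by \<open>m powr p\<close> moves the
    point of tangency from 1 to \<open>m\<close>.\<close>
  have "(t powr p) powr (1 / p) * 1 powr (1 - 1 / p) \<le> 1 / p * t powr p + (1 - 1 / p) * 1"
    by (rule Youngs_inequality_0) (use assms t in auto)
  then have "t \<le> 1 / p * t powr p + (1 - 1 / p)" using assms t by (simp add: powr_powr)
  then have "p * t \<le> p * (1 / p * t powr p + (1 - 1 / p))" using assms(1) by (intro mult_left_mono) auto
  then have "1 + p * (t - 1) \<le> t powr p" using assms(1) by (simp add: algebra_simps)
  then have "m powr p * (1 + p * (t - 1)) \<le> m powr p * t powr p" by (intro mult_left_mono) auto
  moreover have "m powr p = m powr (p - 1) * m" using powr_mult_base[of m "p - 1"] assms by (simp add: mult.commute)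
  ultimately show ?thesis using assms t by (simp add: powr_mult algebra_simps)
qed

text \<open>Jensen's inequality: the tangent of t^p at the mean \<open>m\<close> is integrated, and
  its linear part cancels. The case \<open>m = 0\<close> is separate because the tangent is taken at
  a positive point.\<close>

lemma powr_integral_le:
  fixes s :: "real \<Rightarrow> real"
  assumes "1 \<le> p" and s: "continuous_on {0..1} s" "\<And>t. t \<in> {0..1} \<Longrightarrow> 0 \<le> s t"
  shows "(integral {0..1} s) powr p \<le> integral {0..1} (\<lambda>t. s t powr p)"
proof -
  define m where "m = integral {0..1} s"
  have int: "s integrable_on {0..1}" by (rule integrable_continuous_interval[OF s(1)])
  have cp: "continuous_on {0..1} (\<lambda>t. s t powr p)"
    by (intro continuous_on_powr' s(1) continuous_intros) (use s(2) assms(1) in auto)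
  have intp: "(\<lambda>t. s t powr p) integrable_on {0..1}" by (rule integrable_continuous_interval[OF cp])
  have "m \<ge> 0" unfolding m_def by (rule integral_nonneg[OF int s(2)])
  show ?thesis
  proof (cases "m = 0")
    case True
    then show ?thesis unfolding m_def[symmetric] by (auto intro!: integral_nonneg intp)
  next
    case False
    with \<open>m \<ge> 0\<close> have "m > 0" by simp
    have "integral {0..1} (\<lambda>t. m powr p + p * m powr (p - 1) * (s t - m)) \<le> integral {0..1} (\<lambda>t. s t powr p)"
      by (rule integral_le[OF _ intp])
        (use int s(2) powr_ge_tangent[OF assms(1) _ \<open>m > 0\<close>] in
          \<open>auto intro!: integrable_add integrable_on_mult_right integrable_diff\<close>)
    also have "integral {0..1} (\<lambda>t. m powr p + p * m powr (p - 1) * (s t - m))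
        = m powr p + p * m powr (p - 1) * (m - m)"
    proof (rule integral_unique)
      have c: "((\<lambda>_. a) has_integral a) {0..1::real}" for a :: real
        using has_integral_const_real[of a 0 1] by simp
      show "((\<lambda>t. m powr p + p * m powr (p - 1) * (s t - m)) has_integral
          m powr p + p * m powr (p - 1) * (m - m)) {0..1}"
        using integrable_integral[OF int] unfolding m_def[symmetric]
        by (intro has_integral_add has_integral_mult_right has_integral_diff c)
    qed
    finally show ?thesis by (simp add: m_def)
  qed
qed

text \<open>The fundamental theorem of calculus on the segment, followed by Jensen. The integral
  over the segment is kept, so that Fubini's theorem can be used after integrating over an end
  point.\<close>

lemma powr_diff_le_segment_integral:
  fixes u :: "'a::euclidean_space \<Rightarrow> real"
  assumes u: "Ck (Suc k) u" and p: "1 \<le> p"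
  shows "ennreal (\<bar>u y - u x\<bar> powr p) \<le> ennreal (norm (y - x) powr p) *
    (\<integral>\<^sup>+t\<in>{0..1}. ennreal (norm (gradient u (x + t *\<^sub>R (y - x))) powr p) \<partial>lborel)"
proof -
  define s where "s t = norm (gradient u (x + t *\<^sub>R (y - x)))" for t
  have cg: "continuous_on {0..1} (\<lambda>t. gradient u (x + t *\<^sub>R (y - x)))"
    by (rule continuous_on_compose2[OF continuous_on_gradient[OF u, of UNIV]]) (auto intro!: continuous_intros)
  have cs: "continuous_on {0..1} s" unfolding s_def by (intro continuous_intros cg)
  have "((\<lambda>t. u (x + t *\<^sub>R (y - x))) has_vector_derivative gradient u (x + t *\<^sub>R (y - x)) \<bullet> (y - x)) (at t within {0..1})" for t
  proof -
    have "((\<lambda>t. x + t *\<^sub>R (y - x)) has_derivative (\<lambda>h. h *\<^sub>R (y - x))) (at t within {0..1})"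
      by (auto intro!: derivative_eq_intros)
    from has_derivative_compose[OF this Ck_Suc_imp_has_derivative[OF u]]
    show ?thesis by (simp add: has_vector_derivative_def)
  qed
  from fundamental_theorem_of_calculus[OF _ this]
  have "((\<lambda>t. gradient u (x + t *\<^sub>R (y - x)) \<bullet> (y - x)) has_integral u y - u x) {0..1}" by simp
  then have I: "integral {0..1} (\<lambda>t. gradient u (x + t *\<^sub>R (y - x)) \<bullet> (y - x)) = u y - u x"
    "(\<lambda>t. gradient u (x + t *\<^sub>R (y - x)) \<bullet> (y - x)) integrable_on {0..1}" by (auto simp: has_integral_iff)
  have "norm (u y - u x) \<le> integral {0..1} (\<lambda>t. norm (y - x) * s t)"
    unfolding I(1)[symmetric]
  proof (rule integral_norm_bound_integral[OF I(2)])
    show "(\<lambda>t. norm (y - x) * s t) integrable_on {0..1}"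
      by (intro integrable_continuous_interval continuous_intros cs)
    show "norm (gradient u (x + t *\<^sub>R (y - x)) \<bullet> (y - x)) \<le> norm (y - x) * s t" for t
      using Cauchy_Schwarz_ineq2[of "gradient u (x + t *\<^sub>R (y - x))" "y - x"] by (simp add: s_def mult.commute)
  qed
  also have "\<dots> = norm (y - x) * integral {0..1} s" by simp
  finally have le: "\<bar>u y - u x\<bar> \<le> norm (y - x) * integral {0..1} s" by simp
  have s0: "0 \<le> integral {0..1} s"
    by (rule integral_nonneg[OF integrable_continuous_interval[OF cs]]) (simp add: s_def)
  have "\<bar>u y - u x\<bar> powr p \<le> (norm (y - x) * integral {0..1} s) powr p"
    using le p by (intro powr_mono2) auto
  also have "\<dots> = norm (y - x) powr p * (integral {0..1} s) powr p" using s0 by (simp add: powr_mult)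
  also have "\<dots> \<le> norm (y - x) powr p * integral {0..1} (\<lambda>t. s t powr p)"
    by (intro mult_left_mono powr_integral_le[OF p cs]) (auto simp: s_def)
  finally have "ennreal (\<bar>u y - u x\<bar> powr p) \<le> ennreal (norm (y - x) powr p) * ennreal (integral {0..1} (\<lambda>t. s t powr p))"
    by (simp add: ennreal_mult'[symmetric] ennreal_leI)
  also have "ennreal (integral {0..1} (\<lambda>t. s t powr p)) = (\<integral>\<^sup>+t\<in>{0..1}. ennreal (s t powr p) \<partial>lborel)"
    unfolding s_def using p
    by (intro nn_integral_continuous_interval[symmetric] continuous_on_norm_powr cg) auto
  finally show ?thesis by (simp add: s_def)
qed

lemma borel_measurable_gradient_powr:
  fixes u :: "'a::euclidean_space \<Rightarrow> real"
  assumes "Ck (Suc k) u" "p > 0"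
  shows "(\<lambda>x. ennreal (norm (gradient u x) powr p)) \<in> borel_measurable borel"
  using borel_measurable_continuous_onI[OF continuous_on_norm_powr[OF continuous_on_gradient[OF assms(1)] assms(2)]]
  by measurable

lemma nn_integral_lborel_translate:
  fixes f :: "'a::euclidean_space \<Rightarrow> ennreal"
  assumes "f \<in> borel_measurable borel"
  shows "(\<integral>\<^sup>+x. f (x + c) \<partial>lborel) = (\<integral>\<^sup>+x. f x \<partial>lborel)"
  using nn_integral_distr[of "(+) c" lborel borel f] assms by (simp add: lborel_distr_plus add.commute)

text \<open>Translation by a vector of length \<open>2 * s\<close> moves every point of the ball out of it.\<close>

lemma poincare_zero_boundary:
  fixes w :: "'a::euclidean_space"
  assumes v: "v \<in> C0_infty (ball w s)" and p: "1 \<le> p"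
  shows "(\<integral>\<^sup>+x. ennreal (\<bar>v x\<bar> powr p) \<partial>lebesgue)
    \<le> ennreal ((2 * s) powr p) * (\<integral>\<^sup>+x. ennreal (norm (gradient v x) powr p) \<partial>lebesgue)"
proof (cases "s > 0")
  case False
  have "{x. v x \<noteq> 0} \<subseteq> ball w s"
    using v closure_subset[of "{x. v x \<noteq> 0}"] unfolding C0_infty_def by blast
  moreover have "ball w s = {}" using False by simp
  ultimately have "v x = 0" for x by blast
  then show ?thesis by simp
next
  case True
  have Ck: "Ck (Suc 0) v" using v by (simp add: C0_infty_def del: Ck.simps)
  have v0: "v x = 0" if "x \<notin> ball w s" for x
    using v that closure_subset[of "{x. v x \<noteq> 0}"] by (auto simp: C0_infty_def)
  obtain b :: 'a where b: "b \<in> Basis" using nonempty_Basis by blast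
  define z where "z = (2 * s) *\<^sub>R b"
  have nz: "norm z = 2 * s" using b True by (simp add: z_def)
  define q where "q x = ennreal (norm (gradient v x) powr p)" for x
  have q: "q \<in> borel_measurable borel" unfolding q_def by (rule borel_measurable_gradient_powr[OF Ck]) (use p in simp)
  have pt: "ennreal (\<bar>v x\<bar> powr p) \<le> ennreal ((2 * s) powr p) * (\<integral>\<^sup>+t\<in>{0..1}. q (x + t *\<^sub>R z) \<partial>lborel)" for x
  proof (cases "x \<in> ball w s")
    case inside: True
    have "x + z \<notin> ball w s"
    proof
      assume "x + z \<in> ball w s"
      then have "dist x (x + z) < 2 * s" using inside dist_triangle[of x "x + z" w] by (simp add: dist_commute)
      then show False using nz by (simp add: dist_norm)
    qed
    then have "v (x + z) = 0" by (rule v0)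
    then show ?thesis
      using powr_diff_le_segment_integral[OF Ck p, of "x + z" x] nz by (simp add: q_def)
  qed (simp add: v0)
  have m: "(\<lambda>(x, t). q (x + t *\<^sub>R z) * indicator {0..1} t) \<in> borel_measurable (lborel \<Otimes>\<^sub>M lborel)"
  proof -
    have "(\<lambda>xt. fst xt + snd xt *\<^sub>R z) \<in> borel_measurable (borel :: ('a \<times> real) measure)"
      by (intro borel_measurable_continuous_onI continuous_intros)
    from measurable_compose[OF this q]
    have "(\<lambda>xt. q (fst xt + snd xt *\<^sub>R z)) \<in> borel_measurable (lborel \<Otimes>\<^sub>M lborel)"
      unfolding lborel_prod by simp
    then show ?thesis unfolding split_beta by measurable
  qed
  have "(\<integral>\<^sup>+x. ennreal (\<bar>v x\<bar> powr p) \<partial>lebesgue) = (\<integral>\<^sup>+x. ennreal (\<bar>v x\<bar> powr p) \<partial>lborel)"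
    by (rule nn_integral_completion)
  also have "\<dots> \<le> (\<integral>\<^sup>+x. ennreal ((2 * s) powr p) * (\<integral>\<^sup>+t. q (x + t *\<^sub>R z) * indicator {0..1} t \<partial>lborel) \<partial>lborel)"
    by (rule nn_integral_mono) (rule pt)
  also have "\<dots> = ennreal ((2 * s) powr p) * (\<integral>\<^sup>+x. (\<integral>\<^sup>+t. q (x + t *\<^sub>R z) * indicator {0..1} t \<partial>lborel) \<partial>lborel)"
    by (rule nn_integral_cmult) (use m in measurable)
  \<comment> \<open>After the exchange, translation invariance makes the inner integral independent
    of \<open>t\<close>.\<close>
  also have "(\<integral>\<^sup>+x. (\<integral>\<^sup>+t. q (x + t *\<^sub>R z) * indicator {0..1} t \<partial>lborel) \<partial>lborel)
      = (\<integral>\<^sup>+t. (\<integral>\<^sup>+x. q (x + t *\<^sub>R z) * indicator {0..1} t \<partial>lborel) \<partial>lborel)"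
    by (rule lborel_pair.Fubini'[OF m, symmetric])
  also have "\<dots> = (\<integral>\<^sup>+t. (\<integral>\<^sup>+x. q x \<partial>lborel) * indicator {0..1::real} t \<partial>lborel)"
  proof (rule nn_integral_cong)
    fix t :: real
    have m1: "(\<lambda>x. q (x + t *\<^sub>R z)) \<in> borel_measurable lborel"
      using measurable_compose[OF _ q, of "\<lambda>x. x + t *\<^sub>R z" borel]
      by (simp add: borel_measurable_continuous_onI continuous_intros)
    have "(\<integral>\<^sup>+x. q (x + t *\<^sub>R z) * indicator {0..1} t \<partial>lborel)
        = (\<integral>\<^sup>+x. q (x + t *\<^sub>R z) \<partial>lborel) * indicator {0..1} t"
      by (rule nn_integral_multc[OF m1])
    also have "(\<integral>\<^sup>+x. q (x + t *\<^sub>R z) \<partial>lborel) = (\<integral>\<^sup>+x. q x \<partial>lborel)"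
      by (rule nn_integral_lborel_translate[OF q])
    finally show "(\<integral>\<^sup>+x. q (x + t *\<^sub>R z) * indicator {0..1} t \<partial>lborel)
      = (\<integral>\<^sup>+x. q x \<partial>lborel) * indicator {0..1} t" .
  qed
  also have "\<dots> = (\<integral>\<^sup>+x. q x \<partial>lborel)" by (subst nn_integral_cmult_indicator) auto
  also have "\<dots> = (\<integral>\<^sup>+x. q x \<partial>lebesgue)" by (rule nn_integral_completion[symmetric])
  finally show ?thesis by (simp add: q_def)
qed

text \<open>A smooth competitor equals 1 on the ball, so the measure of the ball is at most the
  integral of its p-th power. The Poincare inequality on the double ball bounds that by
  \<open>(4 * r) powr p\<close> times the energy; \<open>8 powr p\<close> and 6 come from
  \<open>smooth_competitor\<close>.\<close>

lemma cap_cball_lower: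
  fixes w :: "'a::euclidean_space"
  assumes "r > 0" and p: "1 \<le> p"
  shows "ennreal (unit_ball_vol DIM('a) * r ^ DIM('a) / ((4 * r) powr p * 8 powr p * 6))
    \<le> cap p (cball w r) (ball w (2 * r))"
proof (rule ccontr)
  define A where "A = unit_ball_vol DIM('a) * r ^ DIM('a) / ((4 * r) powr p * 8 powr p * 6)"
  assume "\<not> ennreal (unit_ball_vol DIM('a) * r ^ DIM('a) / ((4 * r) powr p * 8 powr p * 6))
    \<le> cap p (cball w r) (ball w (2 * r))"
  then have less: "cap p (cball w r) (ball w (2 * r)) < ennreal A" by (simp add: A_def)
  have A0: "0 < A" using assms by (simp add: A_def)
  obtain B where B: "cap p (cball w r) (ball w (2 * r)) = ennreal B" "0 \<le> B" "B < A"
    using less by (cases "cap p (cball w r) (ball w (2 * r))") (auto simp: ennreal_less_iff)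
  have sub: "cball w r \<subseteq> ball w (2 * r)" using assms(1) by auto
  \<comment> \<open>The energy bound is not strict: with \<open>A\<close> in place of
    \<open>A'\<close> the chain would close in an equality rather than a contradiction.\<close>
  define A' where "A' = (A + B) / 2"
  have A': "B < A'" "A' < A" "0 < A'" using B A0 by (auto simp: A'_def)
  have "cap p (cball w r) (ball w (2 * r)) < ennreal A'" using B A' by (simp add: ennreal_less_iff)
  then obtain v where v: "v \<in> C0_infty (ball w (2 * r))" "\<exists>N. open N \<and> cball w r \<subseteq> N \<and> (\<forall>x\<in>N. v x = 1)"
    "(\<integral>\<^sup>+x. ennreal (norm (gradient v x) powr p) \<partial>lebesgue) \<le> ennreal (8 powr p * (6 * A'))"
    using smooth_competitor[OF p compact_cball sub] by blast
  have "ennreal (unit_ball_vol DIM('a) * r ^ DIM('a)) = (\<integral>\<^sup>+x. indicator (ball w r) x \<partial>lebesgue)"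
    using assms by (simp add: emeasure_ball)
  also have "\<dots> \<le> (\<integral>\<^sup>+x. ennreal (\<bar>v x\<bar> powr p) \<partial>lebesgue)"
  proof (rule nn_integral_mono)
    fix x
    have "v x = 1" if "x \<in> ball w r" using v(2) that ball_subset_cball[of w r] by blast
    then show "indicator (ball w r) x \<le> ennreal (\<bar>v x\<bar> powr p)" by (auto simp: indicator_def)
  qed
  also have "\<dots> \<le> ennreal ((2 * (2 * r)) powr p) * (\<integral>\<^sup>+x. ennreal (norm (gradient v x) powr p) \<partial>lebesgue)"
    by (rule poincare_zero_boundary[OF v(1) p])
  also have "\<dots> \<le> ennreal ((2 * (2 * r)) powr p) * ennreal (8 powr p * (6 * A'))"
    by (intro mult_left_mono v) simp
  also have "\<dots> = ennreal ((4 * r) powr p * (8 powr p * (6 * A')))" by (simp add: ennreal_mult')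
  finally have "unit_ball_vol DIM('a) * r ^ DIM('a) \<le> (4 * r) powr p * (8 powr p * (6 * A'))"
    using A' by (subst (asm) ennreal_le_iff) auto
  also have "\<dots> < (4 * r) powr p * (8 powr p * (6 * A))"
    using A' assms by (intro mult_strict_left_mono) auto
  also have "\<dots> = unit_ball_vol DIM('a) * r ^ DIM('a)" using assms by (simp add: A_def)
  finally show False by simp
qed

section \<open>From fatness to the Hardy inequality\<close>

lemma nn_integral_lborel_affine:
  fixes f :: "'a::euclidean_space \<Rightarrow> ennreal" and c :: real
  assumes [measurable]: "f \<in> borel_measurable borel" and c: "c > 0"
  shows "(\<integral>\<^sup>+x. f x \<partial>lborel) = ennreal (c ^ DIM('a)) * (\<integral>\<^sup>+x. f (z + c *\<^sub>R x) \<partial>lborel)"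
proof -
  have "(\<integral>\<^sup>+x. f x \<partial>lborel)
      = (\<integral>\<^sup>+x. f x \<partial>density (distr lborel borel (\<lambda>x. z + c *\<^sub>R x)) (\<lambda>_. ennreal (\<bar>c\<bar> ^ DIM('a))))"
    using c lborel_affine[of c z] by simp
  then show ?thesis using c
    by (simp add: nn_integral_density nn_integral_distr nn_integral_cmult)
qed

lemma nn_integral_ball_le_maximal:
  fixes x :: "'a::euclidean_space"
  assumes "0 < r" "r \<le> R"
  shows "(\<integral>\<^sup>+y\<in>ball x r. ennreal \<bar>f y\<bar> \<partial>lebesgue) \<le> restricted_maximal R f x * emeasure lebesgue (ball x r)"
proof -
  define I where "I = (\<integral>\<^sup>+y\<in>ball x r. ennreal \<bar>f y\<bar> \<partial>lebesgue)"
  define m where "m = emeasure lebesgue (ball x r)"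
  have m: "m \<noteq> 0" "m \<noteq> top"
  proof -
    have "unit_ball_vol (real DIM('a)) \<noteq> 0" by (rule less_imp_neq[THEN not_sym, OF unit_ball_vol_pos]) simp
    then show "m \<noteq> 0" using assms by (simp add: m_def emeasure_ball)
    show "m \<noteq> top" using assms by (simp add: m_def emeasure_ball)
  qed
  have "I / m \<le> restricted_maximal R f x"
    unfolding restricted_maximal_def I_def m_def by (rule SUP_upper) (use assms in auto)
  then have "I / m * m \<le> restricted_maximal R f x * m" by (rule mult_right_mono) simp
  moreover have "I / m * m = I" 
  proof -
    have "I / m * m = I * (m / m)" by (rule ennreal_divide_times)
    also have "m / m = 1" using m by (intro ennreal_divide_self) (auto simp: less_top)
    finally show ?thesis by simp
  qed
  ultimately show ?thesis by (simp add: I_def m_def)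
qed

text \<open>The segment estimate is integrated over the ball. For fixed \<open>t\<close> the map
  from \<open>y\<close> to \<open>x + t *\<^sub>R (y - x)\<close> carries the ball of radius
  \<open>R\<close> onto that of radius \<open>t * R\<close>, and the Jacobian cancels the smaller
  measure; hence every \<open>t > 0\<close> gives the same bound.\<close>

lemma nn_integral_ball_diff_le_maximal:
  fixes u :: "'a::euclidean_space \<Rightarrow> real"
  assumes u: "Ck (Suc k) u" and p: "1 \<le> p" and R: "0 < R"
  shows "(\<integral>\<^sup>+y\<in>ball x R. ennreal (\<bar>u y - u x\<bar> powr p) \<partial>lebesgue)
    \<le> ennreal (R powr p) * (restricted_maximal R (\<lambda>y. norm (gradient u y) powr p) x * emeasure lebesgue (ball x R))"
proof -
  define M where "M = restricted_maximal R (\<lambda>y. norm (gradient u y) powr p) x"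
  define q where "q x = ennreal (norm (gradient u x) powr p)" for x
  have q: "q \<in> borel_measurable borel" unfolding q_def by (rule borel_measurable_gradient_powr[OF u]) (use p in simp)
  define B where "B = ball x R"
  have m: "(\<lambda>(y, t). q (x + t *\<^sub>R (y - x)) * indicator {0..1} t * indicator B y)
      \<in> borel_measurable (lborel \<Otimes>\<^sub>M (lborel :: real measure))"
  proof -
    have "(\<lambda>yt. x + snd yt *\<^sub>R (fst yt - x)) \<in> borel_measurable (borel :: ('a \<times> real) measure)"
      by (intro borel_measurable_continuous_onI continuous_intros)
    from measurable_compose[OF this q]
    have "(\<lambda>yt. q (x + snd yt *\<^sub>R (fst yt - x))) \<in> borel_measurable (lborel \<Otimes>\<^sub>M (lborel :: real measure))"
      unfolding lborel_prod by simp
    moreover have "B \<in> sets borel" by (simp add: B_def)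
    ultimately show ?thesis unfolding split_beta by measurable
  qed
  have inner: "(\<integral>\<^sup>+y. q (x + t *\<^sub>R (y - x)) * indicator B y \<partial>lborel) \<le> M * emeasure lborel B"
    if t: "0 < t" "t \<le> 1" for t
  proof -
    define c where "c = ennreal (t ^ DIM('a))"
    have c: "c \<noteq> 0" "c \<noteq> top" using t by (auto simp: c_def)
    define Bt where "Bt = ball x (t * R)"
    have ind: "indicator Bt (((1 - t) *\<^sub>R x) + t *\<^sub>R y) = (indicator B y :: ennreal)" for y
    proof -
      have "x - ((1 - t) *\<^sub>R x + t *\<^sub>R y) = t *\<^sub>R (x - y)" by (simp add: algebra_simps)
      then have "dist x ((1 - t) *\<^sub>R x + t *\<^sub>R y) = t * dist x y" using t by (simp add: dist_norm)
      then show ?thesis using t by (simp add: Bt_def B_def indicator_def)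
    qed
    have eq: "(1 - t) *\<^sub>R x + t *\<^sub>R y = x + t *\<^sub>R (y - x)" for y by (simp add: algebra_simps)
    have mq: "(\<lambda>z. q z * indicator Bt z) \<in> borel_measurable borel"
      using q by (intro borel_measurable_times_ennreal borel_measurable_indicator) (auto simp: Bt_def)
    have "c * (\<integral>\<^sup>+y. q (x + t *\<^sub>R (y - x)) * indicator B y \<partial>lborel) = (\<integral>\<^sup>+z. q z * indicator Bt z \<partial>lborel)"
      using nn_integral_lborel_affine[OF mq t(1), of "(1 - t) *\<^sub>R x"] by (simp only: c_def ind) (simp only: eq)
    also have "\<dots> = (\<integral>\<^sup>+z\<in>Bt. ennreal \<bar>norm (gradient u z) powr p\<bar> \<partial>lebesgue)"
      by (simp add: q_def nn_integral_completion)
    also have "\<dots> \<le> M * emeasure lebesgue Bt"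
      unfolding M_def Bt_def by (rule nn_integral_ball_le_maximal) (use t R in \<open>auto simp: mult_left_le_one_le\<close>)
    also have "emeasure lebesgue Bt = c * emeasure lborel B"
      using R t by (simp add: Bt_def B_def c_def emeasure_ball ennreal_mult[symmetric] power_mult_distrib mult_ac)
    finally have "c * (\<integral>\<^sup>+y. q (x + t *\<^sub>R (y - x)) * indicator B y \<partial>lborel) \<le> c * (M * emeasure lborel B)"
      by (simp add: mult_ac)
    then show ?thesis using c by (simp add: ennreal_mult_le_mult_iff)
  qed
  have "(\<integral>\<^sup>+y\<in>B. ennreal (\<bar>u y - u x\<bar> powr p) \<partial>lebesgue) = (\<integral>\<^sup>+y\<in>B. ennreal (\<bar>u y - u x\<bar> powr p) \<partial>lborel)"
    by (rule nn_integral_completion)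
  also have "\<dots> \<le> (\<integral>\<^sup>+y. ennreal (R powr p) * (\<integral>\<^sup>+t. q (x + t *\<^sub>R (y - x)) * indicator {0..1} t * indicator B y \<partial>lborel) \<partial>lborel)"
  proof (rule nn_integral_mono)
    fix y
    show "ennreal (\<bar>u y - u x\<bar> powr p) * indicator B y
        \<le> ennreal (R powr p) * (\<integral>\<^sup>+t. q (x + t *\<^sub>R (y - x)) * indicator {0..1} t * indicator B y \<partial>lborel)"
    proof (cases "y \<in> B")
      case True
      have "ennreal (\<bar>u y - u x\<bar> powr p) \<le> ennreal (norm (y - x) powr p) * (\<integral>\<^sup>+t\<in>{0..1}. q (x + t *\<^sub>R (y - x)) \<partial>lborel)"
        unfolding q_def by (rule powr_diff_le_segment_integral[OF u p])
      also have "\<dots> \<le> ennreal (R powr p) * (\<integral>\<^sup>+t\<in>{0..1}. q (x + t *\<^sub>R (y - x)) \<partial>lborel)"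
        using True p by (intro mult_right_mono ennreal_leI powr_mono2) (auto simp: B_def dist_norm norm_minus_commute)
      finally show ?thesis using True by simp
    qed simp
  qed
  also have "\<dots> = ennreal (R powr p) * (\<integral>\<^sup>+y. (\<integral>\<^sup>+t. q (x + t *\<^sub>R (y - x)) * indicator {0..1} t * indicator B y \<partial>lborel) \<partial>lborel)"
    by (rule nn_integral_cmult) (use m in measurable)
  also have "(\<integral>\<^sup>+y. (\<integral>\<^sup>+t. q (x + t *\<^sub>R (y - x)) * indicator {0..1} t * indicator B y \<partial>lborel) \<partial>lborel)
      = (\<integral>\<^sup>+t. (\<integral>\<^sup>+y. q (x + t *\<^sub>R (y - x)) * indicator {0..1} t * indicator B y \<partial>lborel) \<partial>lborel)"
    by (rule lborel_pair.Fubini'[OF m, symmetric])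
  also have "\<dots> \<le> (\<integral>\<^sup>+t. M * emeasure lborel B * indicator {0..1::real} t \<partial>lborel)"
  proof (rule nn_integral_mono_AE)
    \<comment> \<open>At \<open>t = 0\<close> the map collapses the ball to a point; this single
      parameter is dropped.\<close>
    show "AE t in lborel. (\<integral>\<^sup>+y. q (x + t *\<^sub>R (y - x)) * indicator {0..1} t * indicator B y \<partial>lborel)
        \<le> M * emeasure lborel B * indicator {0..1} t"
      using AE_lborel_singleton[of "0::real"]
    proof eventually_elim
      case (elim t)
      show ?case
      proof (cases "t \<in> {0..1}")
        case True
        then have "0 < t" "t \<le> 1" using elim by auto
        from inner[OF this] True show ?thesis by simp
      qed simp
    qed
  qed
  also have "\<dots> = M * emeasure lborel B" by (subst nn_integral_cmult_indicator) auto
  finally show ?thesis by (simp add: B_def M_def mult_left_mono)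
qed

lemma add_powr_le:
  fixes a b p :: real
  assumes "0 \<le> a" "0 \<le> b" "0 \<le> p"
  shows "(a + b) powr p \<le> 2 powr p * (a powr p + b powr p)"
proof -
  have "(a + b) powr p \<le> (2 * max a b) powr p" using assms by (intro powr_mono2) auto
  also have "\<dots> = 2 powr p * max a b powr p" using assms by (simp add: powr_mult)
  also have "max a b powr p \<le> a powr p + b powr p" by (auto simp: max_def)
  finally show ?thesis by (simp add: mult_left_mono)
qed

text \<open>The frontier of an open set lies outside it, so a nearest frontier point belongs to the
  complement; conversely, the segment from \<open>x\<close> to an outside point meets the
  frontier.\<close>

lemma infdist_frontier_props:
  fixes \<Omega> :: "'a::euclidean_space set"
  assumes "open \<Omega>" "\<Omega> \<noteq> UNIV" "x \<in> \<Omega>"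
  shows "0 < infdist x (frontier \<Omega>)"
    and "\<exists>w. w \<notin> \<Omega> \<and> dist x w = infdist x (frontier \<Omega>)"
    and "\<And>w. w \<notin> \<Omega> \<Longrightarrow> infdist x (frontier \<Omega>) \<le> dist x w"
proof -
  have ne: "frontier \<Omega> \<noteq> {}" using assms frontier_eq_empty[of \<Omega>] by auto
  have disj: "frontier \<Omega> \<inter> \<Omega> = {}" using assms(1) by (simp add: frontier_def interior_open Diff_Int_distrib2)
  obtain w where w: "w \<in> frontier \<Omega>" "infdist x (frontier \<Omega>) = dist x w"
    using infdist_attains_inf[OF frontier_closed ne] by metis
  then have "w \<notin> \<Omega>" using disj by blast
  with w show "\<exists>w. w \<notin> \<Omega> \<and> dist x w = infdist x (frontier \<Omega>)" by auto
  show "0 < infdist x (frontier \<Omega>)" using w \<open>w \<notin> \<Omega>\<close> assms(3) by auto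
  fix w assume "w \<notin> \<Omega>"
  then have "closed_segment x w \<inter> \<Omega> \<noteq> {}" "closed_segment x w - \<Omega> \<noteq> {}" using assms(3) by auto
  from connected_Int_frontier[OF connected_segment(1) this]
  obtain z where z: "z \<in> closed_segment x w" "z \<in> frontier \<Omega>" by blast
  have "infdist x (frontier \<Omega>) \<le> dist x z" by (rule infdist_le[OF z(2)])
  also have "\<dots> \<le> dist x w" using dist_in_closed_segment[OF z(1)] by (simp add: dist_commute)
  finally show "infdist x (frontier \<Omega>) \<le> dist x w" .
qed

text \<open>The test function for the capacity is \<open>\<eta> (1 - u / u(x))\<close>, which is \<open>1\<close> on the complement of \<open>\<Omega>\<close>
  near the boundary point \<open>w\<close> closest to \<open>x\<close>. Subtracting the value \<open>u(x)\<close> rather than a mean value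
  makes \<open>nn_integral_ball_diff_le_maximal\<close> sufficient in place of a Poincare inequality.\<close>

lemma fat_imp_hardy_estimate:
  fixes \<Omega> :: "'a::euclidean_space set"
  assumes p: "1 \<le> p" and \<Omega>: "open \<Omega>" "\<Omega> \<noteq> UNIV" and "c\<^sub>0 > 0"
    and fat: "\<And>x r. x \<in> - \<Omega> \<Longrightarrow> r > 0 \<Longrightarrow>
      ennreal c\<^sub>0 * cap p (cball x r) (ball x (2 * r)) \<le> cap p (- \<Omega> \<inter> cball x r) (ball x (2 * r))"
    and u: "u \<in> C0_infty \<Omega>" and x: "x \<in> \<Omega>"
    and d: "d = infdist x (frontier \<Omega>)"
    and m: "restricted_maximal (2 * d) (\<lambda>y. norm (gradient u y) powr p) x = ennreal m" "0 \<le> m"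
  shows "\<bar>u x\<bar> powr p \<le> 2 powr p * (8 powr p + 1) * 4 ^ DIM('a) * 2 powr p * 8 powr p * 6 / c\<^sub>0 * d powr p * m"
proof (cases "u x = 0")
  case True
  then show ?thesis using \<open>c\<^sub>0 > 0\<close> m by simp
next
  case False
  define a where "a = u x"
  define n where "n = DIM('a)"
  define \<omega> where "\<omega> = unit_ball_vol (real n)"
  have "\<omega> > 0" by (simp add: \<omega>_def)
  have "a \<noteq> 0" using False by (simp add: a_def)
  have "d > 0" using infdist_frontier_props(1)[OF \<Omega> x] by (simp add: d)
  obtain w where w: "w \<notin> \<Omega>" "dist x w = d" using infdist_frontier_props(2)[OF \<Omega> x] d by auto
  have Cu: "Ck k u" for k using u by (simp add: C0_infty_def)
  have u0: "u y = 0" if "y \<notin> \<Omega>" for y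
    using u that closure_subset[of "{x. u x \<noteq> 0}"] by (auto simp: C0_infty_def)
  \<comment> \<open>At scale \<open>d/2\<close> the cutoff is 1 on the ball to which fatness is
    applied and vanishes off its double \<open>ball w d\<close>.\<close>
  obtain \<eta> where \<eta>: "\<And>k. Ck k \<eta>" "\<And>x. x \<in> cball w (d/2) \<Longrightarrow> \<eta> x = 1" "\<And>x. dist w x \<ge> 15/8 * (d/2) \<Longrightarrow> \<eta> x = 0"
    "\<And>x. \<bar>\<eta> x\<bar> \<le> 1" "\<And>x. norm (gradient \<eta> x) \<le> 2 / (d/2)"
    using smooth_cutoff[of "d/2" w] \<open>d > 0\<close> by auto
  define s where "s y = 1 + (- 1 / a) * u y" for y
  define v where "v y = \<eta> y * s y" for y
  have Cv: "Ck k v" for k unfolding v_def s_def by (intro Ck_mult Ck_add Ck_const \<eta>(1) Cu)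
  have grad: "gradient v y = \<eta> y *\<^sub>R ((- 1 / a) *\<^sub>R gradient u y) + s y *\<^sub>R gradient \<eta> y" for y
  proof -
    have "(s has_derivative (\<lambda>h. ((- 1 / a) *\<^sub>R gradient u y) \<bullet> h)) (at y)"
      unfolding s_def using Ck_Suc_imp_has_derivative[OF Cu, of y] \<open>a \<noteq> 0\<close>
      by (auto intro!: derivative_eq_intros)
    from has_derivative_mult_inner[OF Ck_Suc_imp_has_derivative[OF \<eta>(1)] this]
    show ?thesis unfolding v_def by (rule has_derivative_imp_gradient)
  qed
  \<comment> \<open>Multiplying by \<open>\<bar>a\<bar>\<close> turns \<open>\<bar>s y\<bar>\<close>
    into the difference \<open>\<bar>u y - a\<bar>\<close>, which the maximal function controls;
    \<open>4 / d\<close> is the gradient bound of the cutoff.\<close>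
  have ptw: "\<bar>a\<bar> powr p * norm (gradient v y) powr p
      \<le> 2 powr p * ((4 / d) powr p * \<bar>u y - a\<bar> powr p + norm (gradient u y) powr p)" for y
  proof -
    have as: "\<bar>a\<bar> * \<bar>s y\<bar> = \<bar>u y - a\<bar>"
      using \<open>a \<noteq> 0\<close> unfolding abs_mult[symmetric] by (simp add: s_def algebra_simps abs_minus_commute)
    have "norm (gradient v y) \<le> \<bar>\<eta> y\<bar> * (norm (gradient u y) / \<bar>a\<bar>) + \<bar>s y\<bar> * norm (gradient \<eta> y)"
      unfolding grad by (rule order_trans[OF norm_triangle_ineq]) simp
    also have "\<dots> \<le> 1 * (norm (gradient u y) / \<bar>a\<bar>) + \<bar>s y\<bar> * (4 / d)"
      by (intro add_mono mult_right_mono mult_left_mono) (use \<eta>(4,5) in auto)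
    finally have "\<bar>a\<bar> * norm (gradient v y) \<le> \<bar>a\<bar> * (norm (gradient u y) / \<bar>a\<bar> + \<bar>s y\<bar> * (4 / d))"
      by (intro mult_left_mono) auto
    also have "\<dots> = (4 / d) * \<bar>u y - a\<bar> + norm (gradient u y)"
      using \<open>a \<noteq> 0\<close> as[symmetric] by (simp add: algebra_simps)
    finally have "(\<bar>a\<bar> * norm (gradient v y)) powr p \<le> ((4 / d) * \<bar>u y - a\<bar> + norm (gradient u y)) powr p"
      using p by (intro powr_mono2) auto
    also have "\<dots> \<le> 2 powr p * (((4 / d) * \<bar>u y - a\<bar>) powr p + norm (gradient u y) powr p)"
      using \<open>d > 0\<close> p by (intro add_powr_le) auto
    finally show ?thesis using \<open>d > 0\<close> by (simp only: powr_mult)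
  qed
  define W where "W = ball w d"
  define B where "B = ball x (2 * d)"
  \<comment> \<open>The origin of the radius \<open>2 * d\<close> of the maximal function:
    \<open>w\<close> has distance \<open>d\<close> from \<open>x\<close>.\<close>
  have WB: "W \<subseteq> B"
  proof
    fix y assume "y \<in> W"
    then show "y \<in> B" using w(2) dist_triangle[of x y w] by (simp add: W_def B_def)
  qed
  have capv: "cap p (- \<Omega> \<inter> cball w (d/2)) W \<le> (\<integral>\<^sup>+y\<in>W. ennreal (norm (gradient v y) powr p) \<partial>lebesgue)"
  proof (rule cap_le_gradient[OF Cv[of "Suc 0"]])
    show "- \<Omega> \<inter> cball w (d/2) \<subseteq> W" using \<open>d > 0\<close> by (auto simp: W_def)
    show "v y = 0" if "y \<notin> W" for y using that \<open>d > 0\<close> by (simp add: v_def W_def \<eta>(3))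
    show "v y = 1" if "y \<in> - \<Omega> \<inter> cball w (d/2)" for y using that \<eta>(2)[of y] u0[of y] by (simp add: v_def s_def)
  qed (use p in \<open>auto simp: W_def\<close>)
  define \<kappa> where "\<kappa> = \<omega> * (d/2) ^ n / ((4 * (d/2)) powr p * 8 powr p * 6)"
  have "\<kappa> > 0" using \<open>\<omega> > 0\<close> \<open>d > 0\<close> by (simp add: \<kappa>_def)
  have "ennreal (c\<^sub>0 * \<kappa>) = ennreal c\<^sub>0 * ennreal \<kappa>" using \<open>c\<^sub>0 > 0\<close> by (simp add: ennreal_mult')
  also have "\<dots> \<le> ennreal c\<^sub>0 * cap p (cball w (d/2)) (ball w (2 * (d/2)))"
    unfolding \<kappa>_def \<omega>_def n_def using \<open>d > 0\<close> p by (intro mult_left_mono cap_cball_lower) auto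
  also have "\<dots> \<le> cap p (- \<Omega> \<inter> cball w (d/2)) W"
    using fat[of w "d/2"] w(1) \<open>d > 0\<close> by (simp add: W_def)
  also note capv
  finally have "ennreal (\<bar>a\<bar> powr p) * ennreal (c\<^sub>0 * \<kappa>)
      \<le> ennreal (\<bar>a\<bar> powr p) * (\<integral>\<^sup>+y\<in>W. ennreal (norm (gradient v y) powr p) \<partial>lebesgue)"
    by (rule mult_left_mono) simp
  also have "\<dots> = (\<integral>\<^sup>+y. ennreal (\<bar>a\<bar> powr p) * (ennreal (norm (gradient v y) powr p) * indicator W y) \<partial>lebesgue)"
  proof (rule nn_integral_cmult[symmetric])
    have "(\<lambda>y. ennreal (norm (gradient v y) powr p)) \<in> borel_measurable borel"
      by (rule borel_measurable_gradient_powr[OF Cv[of "Suc 0"]]) (use p in simp)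
    then have "(\<lambda>y. ennreal (norm (gradient v y) powr p) * indicator W y) \<in> borel_measurable borel"
      by (intro borel_measurable_times_ennreal borel_measurable_indicator) (auto simp: W_def)
    then show "(\<lambda>y. ennreal (norm (gradient v y) powr p) * indicator W y) \<in> borel_measurable lebesgue"
      by (simp add: measurable_completion)
  qed
  also have "\<dots> \<le> (\<integral>\<^sup>+y. ennreal (2 powr p * (4 / d) powr p) * (ennreal (\<bar>u y - a\<bar> powr p) * indicator B y)
      + ennreal (2 powr p) * (ennreal \<bar>norm (gradient u y) powr p\<bar> * indicator B y) \<partial>lebesgue)"
  proof (rule nn_integral_mono)
    fix y
    show "ennreal (\<bar>a\<bar> powr p) * (ennreal (norm (gradient v y) powr p) * indicator W y)
       \<le> ennreal (2 powr p * (4 / d) powr p) * (ennreal (\<bar>u y - a\<bar> powr p) * indicator B y)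
      + ennreal (2 powr p) * (ennreal \<bar>norm (gradient u y) powr p\<bar> * indicator B y)"
    proof (cases "y \<in> W")
      case True
      then have "y \<in> B" using WB by blast
      have "ennreal (\<bar>a\<bar> powr p * norm (gradient v y) powr p)
        \<le> ennreal (2 powr p * (4 / d) powr p * \<bar>u y - a\<bar> powr p + 2 powr p * norm (gradient u y) powr p)"
        using ptw[of y] by (intro ennreal_leI) (simp add: algebra_simps)
      with True \<open>y \<in> B\<close> show ?thesis by (simp add: ennreal_mult' ennreal_plus)
    qed simp
  qed
  also have "\<dots> = ennreal (2 powr p * (4 / d) powr p) * (\<integral>\<^sup>+y\<in>B. ennreal (\<bar>u y - a\<bar> powr p) \<partial>lebesgue)
      + ennreal (2 powr p) * (\<integral>\<^sup>+y\<in>B. ennreal \<bar>norm (gradient u y) powr p\<bar> \<partial>lebesgue)"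
  proof -
    have "continuous_on UNIV (\<lambda>y. norm (u y - a) powr p)"
      by (rule continuous_on_norm_powr) (use p Ck_imp_continuous[OF Cu] in \<open>auto intro!: continuous_intros\<close>)
    then have "(\<lambda>y. \<bar>u y - a\<bar> powr p) \<in> borel_measurable borel" by (intro borel_measurable_continuous_onI) simp
    then have "(\<lambda>y. ennreal (\<bar>u y - a\<bar> powr p) * indicator B y) \<in> borel_measurable borel"
      by (intro borel_measurable_times_ennreal borel_measurable_indicator) (auto simp: B_def)
    then have m1: "(\<lambda>y. ennreal (\<bar>u y - a\<bar> powr p) * indicator B y) \<in> borel_measurable lebesgue"
      by (simp add: measurable_completion)
    have "(\<lambda>y. ennreal (norm (gradient u y) powr p)) \<in> borel_measurable borel"
      by (rule borel_measurable_gradient_powr[OF Cu[of "Suc 0"]]) (use p in simp)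
    then have "(\<lambda>y. ennreal \<bar>norm (gradient u y) powr p\<bar> * indicator B y) \<in> borel_measurable borel"
      by (intro borel_measurable_times_ennreal borel_measurable_indicator) (auto simp: B_def)
    then have m2: "(\<lambda>y. ennreal \<bar>norm (gradient u y) powr p\<bar> * indicator B y) \<in> borel_measurable lebesgue"
      by (simp add: measurable_completion)
    show ?thesis
      by (subst nn_integral_add[OF borel_measurable_times_ennreal[OF _ m1] borel_measurable_times_ennreal[OF _ m2]])
        (simp_all only: nn_integral_cmult[OF m1] nn_integral_cmult[OF m2], simp_all)
  qed
  also have "\<dots> \<le> ennreal (2 powr p * (4 / d) powr p) * (ennreal ((2 * d) powr p) * (ennreal m * emeasure lebesgue B))
      + ennreal (2 powr p) * (ennreal m * emeasure lebesgue B)"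
    using nn_integral_ball_diff_le_maximal[OF Cu[of "Suc 0"] p, of "2 * d" x]
      nn_integral_ball_le_maximal[where r="2 * d" and R="2 * d" and x=x and f="\<lambda>y. norm (gradient u y) powr p"] \<open>d > 0\<close>
    by (intro add_mono mult_left_mono) (simp_all add: m B_def a_def)
  also have "emeasure lebesgue B = ennreal (\<omega> * (2 * d) ^ n)"
    using \<open>d > 0\<close> by (simp add: B_def \<omega>_def n_def emeasure_ball)
  also have "ennreal (2 powr p * (4 / d) powr p) * (ennreal ((2 * d) powr p) * (ennreal m * ennreal (\<omega> * (2 * d) ^ n)))
      + ennreal (2 powr p) * (ennreal m * ennreal (\<omega> * (2 * d) ^ n))
    = ennreal (2 powr p * (4 / d) powr p * ((2 * d) powr p * (m * (\<omega> * (2 * d) ^ n))) + 2 powr p * (m * (\<omega> * (2 * d) ^ n)))"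
    using m(2) \<open>d > 0\<close> \<open>\<omega> > 0\<close> by (simp add: ennreal_mult ennreal_plus)
  finally have "ennreal (\<bar>a\<bar> powr p * (c\<^sub>0 * \<kappa>))
    \<le> ennreal (2 powr p * (4 / d) powr p * ((2 * d) powr p * (m * (\<omega> * (2 * d) ^ n))) + 2 powr p * (m * (\<omega> * (2 * d) ^ n)))"
    by (simp add: ennreal_mult')
  then have "\<bar>a\<bar> powr p * (c\<^sub>0 * \<kappa>)
    \<le> 2 powr p * (4 / d) powr p * ((2 * d) powr p * (m * (\<omega> * (2 * d) ^ n))) + 2 powr p * (m * (\<omega> * (2 * d) ^ n))"
    using m(2) \<open>d > 0\<close> \<open>\<omega> > 0\<close> by (subst (asm) ennreal_le_iff) auto
  also have "\<dots> = 2 powr p * ((4 / d) powr p * (2 * d) powr p + 1) * (m * (\<omega> * (2 * d) ^ n))"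
    by (simp add: algebra_simps)
  also have "(4 / d) powr p * (2 * d) powr p = 8 powr p"
    using \<open>d > 0\<close> by (simp add: powr_mult[symmetric])
  finally have main: "\<bar>a\<bar> powr p * (c\<^sub>0 * \<kappa>) \<le> 2 powr p * (8 powr p + 1) * (m * (\<omega> * (2 * d) ^ n))" .
  \<comment> \<open>The average is over a ball of radius \<open>2 * d\<close>, the capacity over one
    of radius \<open>d/2\<close>; their ratio produces \<open>4 ^ n\<close>.\<close>
  have dn: "(2 * d) ^ n = 4 ^ n * (d/2) ^ n" 
    using power_mult_distrib[of 4 "d/2" n] by simp
  have \<kappa>d: "\<kappa> * (2 powr p * d powr p * 8 powr p * 6) = \<omega> * (d/2) ^ n"
    using \<open>d > 0\<close> by (simp add: \<kappa>_def powr_mult)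
  define Z where "Z = 2 powr p * (8 powr p + 1) * 4 ^ n * (2 powr p * d powr p * 8 powr p * 6) * m"
  have "2 powr p * (8 powr p + 1) * (m * (\<omega> * (2 * d) ^ n)) = 2 powr p * (8 powr p + 1) * m * 4 ^ n * (\<omega> * (d/2) ^ n)"
    unfolding dn by (simp only: mult_ac)
  also have "\<dots> = \<kappa> * Z" unfolding \<kappa>d[symmetric] Z_def by (simp only: mult_ac)
  finally have "\<kappa> * (\<bar>a\<bar> powr p * c\<^sub>0) \<le> \<kappa> * Z" using main by (simp add: mult_ac)
  then have "\<bar>a\<bar> powr p * c\<^sub>0 \<le> Z" using \<open>\<kappa> > 0\<close> by simp
  then have "\<bar>a\<bar> powr p \<le> Z / c\<^sub>0" using \<open>c\<^sub>0 > 0\<close> by (simp add: pos_le_divide_eq)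
  also have "Z / c\<^sub>0 = 2 powr p * (8 powr p + 1) * 4 ^ DIM('a) * 2 powr p * 8 powr p * 6 / c\<^sub>0 * d powr p * m"
    by (simp add: Z_def n_def mult_ac)
  finally show ?thesis by (simp add: a_def)
qed

lemma uniformly_fat_imp_pointwise_hardy:
  fixes \<Omega> :: "'a::euclidean_space set"
  assumes p: "1 \<le> p" and \<Omega>: "open \<Omega>" "\<Omega> \<noteq> UNIV" and fat: "uniformly_fat p (- \<Omega>)"
  shows "pointwise_hardy p \<Omega>"
proof -
  obtain c\<^sub>0 :: real where c0: "c\<^sub>0 > 0" "\<And>x r. x \<in> - \<Omega> \<Longrightarrow> r > 0 \<Longrightarrow>
      ennreal c\<^sub>0 * cap p (cball x r) (ball x (2 * r)) \<le> cap p (- \<Omega> \<inter> cball x r) (ball x (2 * r))"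
    using fat unfolding uniformly_fat_def by blast
  define Q where "Q = 2 powr p * (8 powr p + 1) * 4 ^ DIM('a) * 2 powr p * 8 powr p * 6 / c\<^sub>0"
  have "Q > 0" using c0(1) by (auto simp: Q_def intro!: divide_pos_pos mult_pos_pos add_pos_pos)
  show ?thesis unfolding pointwise_hardy_def
  proof (intro exI[of _ "Q powr (1 / p)"] conjI ballI)
    show "0 < Q powr (1 / p)" using \<open>Q > 0\<close> by simp
    fix u x assume u: "u \<in> C0_infty \<Omega>" and x: "x \<in> \<Omega>"
    define d where "d = infdist x (frontier \<Omega>)"
    have "d > 0" using infdist_frontier_props(1)[OF \<Omega> x] by (simp add: d_def)
    define M where "M = restricted_maximal (2 * d) (\<lambda>y. norm (gradient u y) powr p) x"
    show "ennreal \<bar>u x\<bar> \<le> ennreal (Q powr (1 / p) * infdist x (frontier \<Omega>)) *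
       ennreal_powr (restricted_maximal (2 * infdist x (frontier \<Omega>)) (\<lambda>y. norm (gradient u y) powr p) x) (1 / p)"
      unfolding d_def[symmetric] M_def[symmetric]
    proof (cases M)
      case (real m)
      have "\<bar>u x\<bar> powr p \<le> Q * d powr p * m"
        unfolding Q_def
        by (rule fat_imp_hardy_estimate[OF p \<Omega> c0 u x d_def]) (use real in \<open>auto simp: M_def\<close>)
      then have "(\<bar>u x\<bar> powr p) powr (1 / p) \<le> (Q * d powr p * m) powr (1 / p)"
        using p by (intro powr_mono2) auto
      also have "\<dots> = Q powr (1 / p) * d * m powr (1 / p)"
        using p \<open>Q > 0\<close> \<open>d > 0\<close> real(1) by (simp add: powr_mult powr_powr)
      finally have "\<bar>u x\<bar> \<le> Q powr (1 / p) * d * m powr (1 / p)" using p by (simp add: powr_powr)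
      then show "ennreal \<bar>u x\<bar> \<le> ennreal (Q powr (1 / p) * d) * ennreal_powr M (1 / p)"
        using real \<open>d > 0\<close> by (simp add: ennreal_mult[symmetric] ennreal_leI)
    next
      \<comment> \<open>The right-hand side is infinite, as its factor
        \<open>Q powr (1 / p) * d\<close> is positive.\<close>
      case top
      then show "ennreal \<bar>u x\<bar> \<le> ennreal (Q powr (1 / p) * d) * ennreal_powr M (1 / p)"
        using \<open>d > 0\<close> \<open>Q > 0\<close> by (simp add: ennreal_powr_def ennreal_mult_top)
    qed
  qed
qed

section \<open>From the Hardy inequality to fatness\<close>

text \<open>A weak-type estimate: disjoint balls each carry mass at least \<open>T\<close> times
  their measure, and their fivefold enlargements, 5^n times as large, cover \<open>S\<close>. The
  bound \<open>B\<close> on the radii is what the covering lemma asks for.\<close>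

lemma vitali_emeasure_bound:
  fixes S :: "'a::euclidean_space set" and q :: "'a \<Rightarrow> ennreal"
  assumes S: "S \<in> sets lebesgue" and q: "q \<in> borel_measurable lebesgue"
    and r: "\<And>x. x \<in> S \<Longrightarrow> 0 < r x \<and> r x \<le> B"
    and T: "\<And>x. x \<in> S \<Longrightarrow> T * emeasure lebesgue (ball x (r x)) \<le> (\<integral>\<^sup>+y\<in>ball x (r x). q y \<partial>lebesgue)"
  shows "T * emeasure lebesgue S \<le> ennreal (5 ^ DIM('a)) * (\<integral>\<^sup>+y. q y \<partial>lebesgue)"
proof -
  have "S \<subseteq> (\<Union>x\<in>S. ball x (r x))" using r by auto
  from Vitali_covering_lemma_balls[OF this r]
  obtain C where C: "countable C" "C \<subseteq> S" "pairwise (\<lambda>i j. disjnt (ball i (r i)) (ball j (r j))) C"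
    "S \<subseteq> (\<Union>x\<in>C. ball x (5 * r x))" by blast
  define N where "N = density lebesgue q"
  define I where "I = to_nat_on C ` C"
  define c where "c n = from_nat_into C n" for n
  have c: "c n \<in> C" "to_nat_on C (c n) = n" if "n \<in> I" for n
    using that C(1) by (auto simp: I_def c_def)
  have surj: "\<exists>n\<in>I. c n = x" if "x \<in> C" for x
    using that C(1) by (auto simp: I_def c_def)
  define D where "D n = (if n \<in> I then ball (c n) (r (c n)) else {})" for n
  define D5 where "D5 n = (if n \<in> I then ball (c n) (5 * r (c n)) else {})" for n
  have D: "D n \<in> sets lebesgue" "D5 n \<in> sets lebesgue" for n by (simp_all add: D_def D5_def)
  have disj: "disjoint_family D"
    unfolding disjoint_family_on_def
  proof (intro ballI impI)
    fix i j :: nat assume "i \<noteq> j"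
    show "D i \<inter> D j = {}"
    proof (cases "i \<in> I \<and> j \<in> I")
      case True
      then have "c i \<noteq> c j" using c(2)[of i] c(2)[of j] \<open>i \<noteq> j\<close> by auto
      then have "disjnt (ball (c i) (r (c i))) (ball (c j) (r (c j)))"
        using C(3) c(1)[of i] c(1)[of j] True by (auto simp: pairwise_def)
      then show ?thesis using True by (simp add: D_def disjnt_def)
    qed (auto simp: D_def)
  qed
  have each: "T * emeasure lebesgue (D5 n) \<le> ennreal (5 ^ DIM('a)) * emeasure N (D n)" for n
  proof (cases "n \<in> I")
    case True
    define x where "x = c n"
    have xS: "x \<in> S" using c(1)[OF True] C(2) by (auto simp: x_def)
    then have rx: "0 < r x" using r by auto
    have "emeasure lebesgue (ball x (5 * r x)) = ennreal (5 ^ DIM('a)) * emeasure lebesgue (ball x (r x))"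
      using rx by (simp add: emeasure_ball ennreal_mult[symmetric] power_mult_distrib mult_ac)
    then have "T * emeasure lebesgue (D5 n) = ennreal (5 ^ DIM('a)) * (T * emeasure lebesgue (ball x (r x)))"
      using True by (simp add: D5_def x_def[symmetric] mult_ac)
    also have "\<dots> \<le> ennreal (5 ^ DIM('a)) * (\<integral>\<^sup>+y\<in>ball x (r x). q y \<partial>lebesgue)"
      by (intro mult_left_mono T xS) simp
    also have "(\<integral>\<^sup>+y\<in>ball x (r x). q y \<partial>lebesgue) = emeasure N (D n)"
      unfolding N_def using True by (subst emeasure_density[OF q]) (simp_all add: D_def x_def)
    finally show ?thesis .
  qed (simp add: D5_def)
  have "S \<subseteq> (\<Union>n. D5 n)"
  proof
    fix y assume "y \<in> S"
    then obtain x where x: "x \<in> C" "y \<in> ball x (5 * r x)" using C(4) by blast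
    then obtain n where "n \<in> I" "c n = x" using surj by blast
    with x show "y \<in> (\<Union>n. D5 n)" by (auto simp: D5_def)
  qed
  then have "emeasure lebesgue S \<le> emeasure lebesgue (\<Union>n. D5 n)"
    by (rule emeasure_mono) (use D in auto)
  also have "\<dots> \<le> (\<Sum>n. emeasure lebesgue (D5 n))"
    by (rule emeasure_subadditive_countably) (use D in auto)
  finally have "T * emeasure lebesgue S \<le> T * (\<Sum>n. emeasure lebesgue (D5 n))" by (rule mult_left_mono) simp
  also have "\<dots> = (\<Sum>n. T * emeasure lebesgue (D5 n))" by simp
  also have "\<dots> \<le> (\<Sum>n. ennreal (5 ^ DIM('a)) * emeasure N (D n))" by (intro suminf_le each) auto
  also have "\<dots> = ennreal (5 ^ DIM('a)) * (\<Sum>n. emeasure N (D n))" by simp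
  also have "(\<Sum>n. emeasure N (D n)) = emeasure N (\<Union>n. D n)"
    by (rule suminf_emeasure) (use D disj in \<open>auto simp: N_def\<close>)
  also have "\<dots> \<le> emeasure N (space N)" by (rule emeasure_space)
  also have "\<dots> = (\<integral>\<^sup>+y. q y \<partial>lebesgue)"
    unfolding N_def by (subst emeasure_density[OF q]) auto
  finally show ?thesis by (simp add: mult_left_mono)
qed

text \<open>The Hardy inequality is applied to \<open>\<phi> (1 - v)\<close>. Every point of \<open>ball w (R/6)\<close> either satisfies
  \<open>v > 1/2\<close>, controlled by the Poincare inequality, or is the centre of a ball on which the mean of
  \<open>|\<nabla>v|\<^sup>p\<close> is large, controlled by the Vitali covering lemma.\<close>

lemma hardy_imp_measure_bound:
  fixes \<Omega> :: "'a::euclidean_space set"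
  assumes p: "1 \<le> p" and \<Omega>: "open \<Omega>" "\<Omega> \<noteq> UNIV" and "C > 0"
    and hardy: "\<And>u x. u \<in> C0_infty \<Omega> \<Longrightarrow> x \<in> \<Omega> \<Longrightarrow>
       ennreal \<bar>u x\<bar> \<le> ennreal (C * infdist x (frontier \<Omega>)) *
         ennreal_powr (restricted_maximal (2 * infdist x (frontier \<Omega>)) (\<lambda>y. norm (gradient u y) powr p) x) (1 / p)"
    and w: "w \<notin> \<Omega>" and R: "R > 0" and A: "A > 0"
    and less: "cap p (- \<Omega> \<inter> cball w R) (ball w (2 * R)) < ennreal A"
  shows "unit_ball_vol DIM('a) * (R / 6) ^ DIM('a)
    \<le> (5 ^ DIM('a) * (2 * C / 3) powr p + 8 powr p) * 8 powr p * 6 * R powr p * A"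
proof -
  define K where "K = - \<Omega> \<inter> cball w R"
  have K: "compact K" "K \<subseteq> ball w (2 * R)" using \<Omega>(1) R by (auto simp: K_def closed_Compl intro!: closed_Int_compact)
  obtain v where v: "v \<in> C0_infty (ball w (2 * R))" "\<exists>N. open N \<and> K \<subseteq> N \<and> (\<forall>x\<in>N. v x = 1)"
    "(\<integral>\<^sup>+x. ennreal (norm (gradient v x) powr p) \<partial>lebesgue) \<le> ennreal (8 powr p * (6 * A))"
    using smooth_competitor[OF p K less[folded K_def]] by blast
  obtain N where N: "open N" "K \<subseteq> N" "\<And>x. x \<in> N \<Longrightarrow> v x = 1" using v(2) by blast
  have Cv: "Ck k v" for k using v(1) by (simp add: C0_infty_def)
  obtain \<phi> where \<phi>: "\<And>k. Ck k \<phi>" "\<And>x. x \<in> cball w (R/2) \<Longrightarrow> \<phi> x = 1" "\<And>x. dist w x \<ge> 15/8 * (R/2) \<Longrightarrow> \<phi> x = 0"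
    "\<And>x. \<bar>\<phi> x\<bar> \<le> 1" "\<And>x. norm (gradient \<phi> x) \<le> 2 / (R/2)"
    using smooth_cutoff[OF half_gt_zero[OF R], of w] by blast
  \<comment> \<open>The cutoff vanishes beyond radius 15/16 R < R. Up to that radius the complement
    of \<open>\<Omega>\<close> lies in \<open>K\<close>, near which \<open>1 - v\<close> vanishes;
    so the support stays in \<open>\<Omega>\<close>.\<close>
  define u where "u x = \<phi> x * (1 + (- 1) * v x)" for x
  have Cu: "Ck k u" for k unfolding u_def by (intro Ck_mult Ck_add Ck_const \<phi>(1) Cv)
  have u1: "u x = 1 - v x" if "x \<in> ball w (R/2)" for x using \<phi>(2)[of x] that by (simp add: u_def)
  have u_mem: "u \<in> C0_infty \<Omega>"
    unfolding C0_infty_def mem_Collect_eq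
  proof (intro conjI allI Cu)
    have sub: "closure {x. u x \<noteq> 0} \<subseteq> cball w (15/16 * R)"
    proof (rule closure_minimal)
      show "{x. u x \<noteq> 0} \<subseteq> cball w (15/16 * R)"
      proof (rule subsetI, rule ccontr)
        fix x assume "x \<in> {x. u x \<noteq> 0}" "x \<notin> cball w (15/16 * R)"
        then show False using \<phi>(3)[of x] by (simp add: u_def)
      qed
    qed simp
    have "compact (cball w (15/16 * R) \<inter> closure {x. u x \<noteq> 0})" by (intro compact_Int_closed) auto
    also have "cball w (15/16 * R) \<inter> closure {x. u x \<noteq> 0} = closure {x. u x \<noteq> 0}" using sub by auto
    finally show "compact (closure {x. u x \<noteq> 0})" .
    show "closure {x. u x \<noteq> 0} \<subseteq> \<Omega>"
    proof (rule subsetI, rule ccontr)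
      fix y assume y: "y \<in> closure {x. u x \<noteq> 0}" "y \<notin> \<Omega>"
      then have "dist w y \<le> 15/16 * R" using sub by auto
      then have "y \<in> N" using y(2) N(2) R by (auto simp: K_def)
      moreover have "N \<inter> {x. u x \<noteq> 0} = {}" using N(3) by (auto simp: u_def)
      then have "N \<inter> closure {x. u x \<noteq> 0} = {}" using open_Int_closure_eq_empty[OF N(1)] by blast
      ultimately show False using y(1) by blast
    qed
  qed
  have grad: "norm (gradient u y) = norm (gradient v y)" if "y \<in> ball w (R/2)" for y
  proof -
    have "((\<lambda>y. 1 - v y) has_derivative (\<lambda>h. (- gradient v y) \<bullet> h)) (at y)"
      using Ck_Suc_imp_has_derivative[OF Cv, of y] by (auto intro!: derivative_eq_intros)
    then have "(u has_derivative (\<lambda>h. (- gradient v y) \<bullet> h)) (at y)"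
      by (rule has_derivative_transform_within_open[OF _ open_ball that]) (simp add: u1)
    then have "gradient u y = - gradient v y" by (rule has_derivative_imp_gradient)
    then show ?thesis by simp
  qed
  define q where "q x = ennreal (norm (gradient v x) powr p)" for x
  have q: "q \<in> borel_measurable lebesgue"
    unfolding q_def using borel_measurable_gradient_powr[OF Cv[of "Suc 0"], of p] p
    by (simp add: measurable_completion)
  define E where "E = (\<integral>\<^sup>+x. q x \<partial>lebesgue)"
  have E: "E \<le> ennreal (8 powr p * (6 * A))" using v(3) by (simp add: E_def q_def)
  \<comment> \<open>If the maximal function at a point of \<open>S\<close> were at most
    \<open>T\<close>, the Hardy inequality with \<open>d < R/6\<close> would give |u(x)| \<le> 3 d /
    (2 R) < 1/4, too small for \<open>v x \<le> 1/2\<close>.\<close>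
  define T where "T = (3 / (2 * C * R)) powr p"
  have "T > 0" using \<open>C > 0\<close> R by (simp add: T_def)
  \<comment> \<open>As \<open>w \<notin> \<Omega>\<close>, points of \<open>S\<close> have boundary
    distance below R/6, so the balls in their maximal function have radius below R/3 and stay in
    \<open>ball w (R/2)\<close>, where \<open>u\<close> is \<open>1 - v\<close>.\<close>
  define S where "S = ball w (R/6) \<inter> \<Omega> \<inter> {x. v x \<le> 1/2}"
  have S: "S \<in> sets lebesgue"
  proof -
    have "closed {x. v x \<le> 1/2}" by (intro closed_Collect_le Ck_imp_continuous[OF Cv] continuous_intros)
    then have "S \<in> sets borel" unfolding S_def using \<Omega>(1) by (intro sets.Int borel_open borel_closed) auto
    then show ?thesis by simp
  qed
  have pick: "\<exists>r. 0 < r \<and> r \<le> R/3 \<and> ennreal T * emeasure lebesgue (ball x r) \<le> (\<integral>\<^sup>+y\<in>ball x r. q y \<partial>lebesgue)"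
    if x: "x \<in> S" for x
  proof (rule ccontr)
    assume "\<not> ?thesis"
    then have neg: "(\<integral>\<^sup>+y\<in>ball x r. q y \<partial>lebesgue) \<le> ennreal T * emeasure lebesgue (ball x r)" if "0 < r" "r \<le> R/3" for r
      using that by (meson not_le less_imp_le)
    define d where "d = infdist x (frontier \<Omega>)"
    have x': "x \<in> \<Omega>" "dist w x < R/6" "v x \<le> 1/2" using x by (auto simp: S_def)
    have d: "0 < d" "d < R/6"
      using infdist_frontier_props(1)[OF \<Omega> x'(1)] infdist_frontier_props(3)[OF \<Omega> x'(1) w] x'(2)
      by (auto simp: d_def dist_commute)
    have "restricted_maximal (2 * d) (\<lambda>y. norm (gradient u y) powr p) x \<le> ennreal T"
      unfolding restricted_maximal_def
    proof (rule SUP_least)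
      fix r assume "r \<in> {0<..2 * d}"
      then have r: "0 < r" "r < R/3" using d by auto
      have "(\<integral>\<^sup>+y\<in>ball x r. ennreal \<bar>norm (gradient u y) powr p\<bar> \<partial>lebesgue) = (\<integral>\<^sup>+y\<in>ball x r. q y \<partial>lebesgue)"
      proof (rule nn_integral_cong)
        fix y
        have "y \<in> ball w (R/2)" if "y \<in> ball x r"
          using that r x'(2) dist_triangle[of w y x] by simp
        then show "ennreal \<bar>norm (gradient u y) powr p\<bar> * indicator (ball x r) y = q y * indicator (ball x r) y"
          using grad[of y] by (auto simp: q_def indicator_def)
      qed
      also have "\<dots> \<le> ennreal T * emeasure lebesgue (ball x r)" by (rule neg) (use r in auto)
      finally have "(\<integral>\<^sup>+y\<in>ball x r. ennreal \<bar>norm (gradient u y) powr p\<bar> \<partial>lebesgue) / emeasure lebesgue (ball x r)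
          \<le> ennreal T * emeasure lebesgue (ball x r) / emeasure lebesgue (ball x r)" by (rule divide_right_mono_ennreal)
      also have "\<dots> = ennreal T"
      proof (rule mult_divide_eq_ennreal)
        have "unit_ball_vol (real DIM('a)) \<noteq> 0" by (rule less_imp_neq[THEN not_sym, OF unit_ball_vol_pos]) simp
        then show "emeasure lebesgue (ball x r) \<noteq> 0" using r by (simp add: emeasure_ball)
        show "emeasure lebesgue (ball x r) \<noteq> top" using r by (simp add: emeasure_ball)
      qed
      finally show "(\<integral>\<^sup>+y\<in>ball x r. ennreal \<bar>norm (gradient u y) powr p\<bar> \<partial>lebesgue) / emeasure lebesgue (ball x r) \<le> ennreal T" .
    qed
    then have "ennreal_powr (restricted_maximal (2 * d) (\<lambda>y. norm (gradient u y) powr p) x) (1 / p) \<le> ennreal_powr (ennreal T) (1 / p)"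
      using p by (intro ennreal_powr_mono) auto
    also have "\<dots> = ennreal (3 / (2 * C * R))"
      using \<open>T > 0\<close> p \<open>C > 0\<close> R by (simp add: T_def powr_powr)
    finally have "ennreal (C * d) * ennreal_powr (restricted_maximal (2 * d) (\<lambda>y. norm (gradient u y) powr p) x) (1 / p)
        \<le> ennreal (C * d) * ennreal (3 / (2 * C * R))" by (rule mult_left_mono) simp
    with hardy[OF u_mem x'(1)] have "ennreal \<bar>u x\<bar> \<le> ennreal (C * d) * ennreal (3 / (2 * C * R))"
      unfolding d_def[symmetric] by (rule order_trans)
    also have "\<dots> = ennreal (C * d * (3 / (2 * C * R)))"
      using \<open>C > 0\<close> d R by (intro ennreal_mult[symmetric]) auto
    finally have "\<bar>u x\<bar> \<le> C * d * (3 / (2 * C * R))" using \<open>C > 0\<close> d R by (subst (asm) ennreal_le_iff) auto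
    also have "\<dots> = d * 3 / (2 * R)" using \<open>C > 0\<close> by simp
    also have "\<dots> < 1/2" using d R by (simp add: field_simps)
    finally have "\<bar>u x\<bar> < 1/2" .
    moreover have "u x = 1 - v x" using x'(2) R by (intro u1) simp
    ultimately show False using x'(3) by linarith
  qed
  then obtain r where r: "\<And>x. x \<in> S \<Longrightarrow> 0 < r x \<and> r x \<le> R/3"
    "\<And>x. x \<in> S \<Longrightarrow> ennreal T * emeasure lebesgue (ball x (r x)) \<le> (\<integral>\<^sup>+y\<in>ball x (r x). q y \<partial>lebesgue)"
    by metis
  have boundS: "ennreal T * emeasure lebesgue S \<le> ennreal (5 ^ DIM('a)) * E"
    unfolding E_def by (rule vitali_emeasure_bound[OF S q r])
  define P where "P = {x. 1/2 < v x}"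
  have P: "P \<in> sets lebesgue"
  proof -
    have "open P" unfolding P_def by (intro open_Collect_less Ck_imp_continuous[OF Cv] continuous_intros)
    then show ?thesis by simp
  qed
  \<comment> \<open>Chebyshev's inequality at level 1/2 gives \<open>2 powr p\<close>; with the
    Poincare factor \<open>(4 * R) powr p\<close> this makes
    \<open>8 powr p * R powr p\<close>.\<close>
  have "emeasure lebesgue P = (\<integral>\<^sup>+x. indicator P x \<partial>lebesgue)" using P by simp
  also have "\<dots> \<le> (\<integral>\<^sup>+x. ennreal (2 powr p) * ennreal (\<bar>v x\<bar> powr p) \<partial>lebesgue)"
  proof (rule nn_integral_mono)
    fix x
    show "indicator P x \<le> ennreal (2 powr p) * ennreal (\<bar>v x\<bar> powr p)"
    proof (cases "x \<in> P")
      case True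
      then have "1 \<le> (2 * \<bar>v x\<bar>) powr p" using p by (intro ge_one_powr_ge_zero) (auto simp: P_def)
      then show ?thesis using True by (simp add: ennreal_mult[symmetric] powr_mult)
    qed simp
  qed
  also have "\<dots> = ennreal (2 powr p) * (\<integral>\<^sup>+x. ennreal (\<bar>v x\<bar> powr p) \<partial>lebesgue)"
  proof (rule nn_integral_cmult)
    have "continuous_on UNIV (\<lambda>x. norm (v x) powr p)"
      by (rule continuous_on_norm_powr[OF Ck_imp_continuous[OF Cv]]) (use p in simp)
    then have "(\<lambda>x. \<bar>v x\<bar> powr p) \<in> borel_measurable borel" by (intro borel_measurable_continuous_onI) simp
    then have "(\<lambda>x. ennreal (\<bar>v x\<bar> powr p)) \<in> borel_measurable borel" by measurable
    then show "(\<lambda>x. ennreal (\<bar>v x\<bar> powr p)) \<in> borel_measurable lebesgue" by (simp add: measurable_completion)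
  qed
  also have "\<dots> \<le> ennreal (2 powr p) * (ennreal ((2 * (2 * R)) powr p) * E)"
    unfolding E_def q_def by (intro mult_left_mono poincare_zero_boundary[OF v(1) p]) simp
  also have "\<dots> = ennreal (8 powr p * R powr p) * E"
    using R by (simp add: mult.assoc[symmetric] ennreal_mult[symmetric] powr_mult[symmetric])
  finally have boundP: "emeasure lebesgue P \<le> ennreal (8 powr p * R powr p) * E" .
  have "ball w (R/6) \<subseteq> S \<union> P"
  proof
    fix x assume x: "x \<in> ball w (R/6)"
    show "x \<in> S \<union> P"
    proof (cases "x \<in> \<Omega>")
      case False
      then have "x \<in> N" using x R N(2) by (auto simp: K_def)
      then show ?thesis using N(3) by (simp add: P_def)
    qed (use x in \<open>auto simp: S_def P_def\<close>)
  qed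
  then have "emeasure lebesgue (ball w (R/6)) \<le> emeasure lebesgue (S \<union> P)" using S P by (intro emeasure_mono) auto
  also have "\<dots> \<le> emeasure lebesgue S + emeasure lebesgue P" using S P by (rule emeasure_subadditive)
  finally have "ennreal T * emeasure lebesgue (ball w (R/6)) \<le> ennreal T * (emeasure lebesgue S + emeasure lebesgue P)"
    by (rule mult_left_mono) simp
  also have "\<dots> \<le> ennreal (5 ^ DIM('a)) * E + ennreal T * (ennreal (8 powr p * R powr p) * E)"
    unfolding distrib_left by (intro add_mono boundS mult_left_mono boundP) simp
  also have "\<dots> = ennreal (5 ^ DIM('a) + T * (8 powr p * R powr p)) * E"
    using \<open>T > 0\<close> by (simp add: ennreal_plus ennreal_mult distrib_right mult.assoc)
  also have "\<dots> \<le> ennreal (5 ^ DIM('a) + T * (8 powr p * R powr p)) * ennreal (8 powr p * (6 * A))"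
    by (intro mult_left_mono E) simp
  also have "\<dots> = ennreal ((5 ^ DIM('a) + T * (8 powr p * R powr p)) * (8 powr p * (6 * A)))"
    using A \<open>T > 0\<close> by (intro ennreal_mult[symmetric]) auto
  finally have "ennreal (T * (unit_ball_vol DIM('a) * (R/6) ^ DIM('a)))
      \<le> ennreal ((5 ^ DIM('a) + T * (8 powr p * R powr p)) * (8 powr p * (6 * A)))"
    using R \<open>T > 0\<close> by (simp add: emeasure_ball ennreal_mult)
  then have le: "T * (unit_ball_vol DIM('a) * (R/6) ^ DIM('a)) \<le> (5 ^ DIM('a) + T * (8 powr p * R powr p)) * (8 powr p * (6 * A))"
    using A \<open>T > 0\<close> by (subst (asm) ennreal_le_iff) auto
  \<comment> \<open>Multiplying the first summand by this 1 makes \<open>T\<close> a common factor,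
    which then cancels.\<close>
  have TR: "T * ((2 * C / 3) powr p * R powr p) = 1"
    using \<open>C > 0\<close> R by (simp add: T_def powr_mult[symmetric])
  define Y where "Y = (5 ^ DIM('a) * (2 * C / 3) powr p + 8 powr p) * 8 powr p * 6 * R powr p * A"
  have "(5 ^ DIM('a) + T * (8 powr p * R powr p)) * (8 powr p * (6 * A))
      = (5 ^ DIM('a) * (T * ((2 * C / 3) powr p * R powr p)) + T * (8 powr p * R powr p)) * (8 powr p * (6 * A))"
    unfolding TR by simp
  also have "\<dots> = T * Y" unfolding Y_def by (simp only: algebra_simps)
  finally have "T * (unit_ball_vol DIM('a) * (R/6) ^ DIM('a)) \<le> T * Y" using le by simp
  then show ?thesis using \<open>T > 0\<close> by (simp add: Y_def)
qed

text \<open>If fatness failed at one ball, the upper bound for the capacity of a ball would turn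
  \<open>hardy_imp_measure_bound\<close> into a bound of a positive quantity by half of
  itself.\<close>

lemma pointwise_hardy_imp_uniformly_fat:
  fixes \<Omega> :: "'a::euclidean_space set"
  assumes p: "1 \<le> p" and \<Omega>: "open \<Omega>" "\<Omega> \<noteq> UNIV" and hardy: "pointwise_hardy p \<Omega>"
  shows "uniformly_fat p (- \<Omega>)"
proof -
  obtain C :: real where C: "C > 0" "\<And>u x. u \<in> C0_infty \<Omega> \<Longrightarrow> x \<in> \<Omega> \<Longrightarrow>
       ennreal \<bar>u x\<bar> \<le> ennreal (C * infdist x (frontier \<Omega>)) *
         ennreal_powr (restricted_maximal (2 * infdist x (frontier \<Omega>)) (\<lambda>y. norm (gradient u y) powr p) x) (1 / p)"
    using hardy unfolding pointwise_hardy_def by blast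
  define n where "n = DIM('a)"
  define \<omega> where "\<omega> = unit_ball_vol (real n)"
  have "\<omega> > 0" by (simp add: \<omega>_def)
  define Q where "Q = (5 ^ n * (2 * C / 3) powr p + 8 powr p) * 8 powr p * 6"
  have "Q > 0" using C(1) by (simp add: Q_def add_pos_pos)
  \<comment> \<open>\<open>12 ^ n\<close> is the ratio of \<open>(2 * R) ^ n\<close> to
    \<open>(R / 6) ^ n\<close>, \<open>2 powr p\<close> is what remains of
    \<open>R powr p * (2 / R) powr p\<close>, and the factor 2 leaves the contradictory 1/2.\<close>
  define c\<^sub>0 where "c\<^sub>0 = 1 / (2 * (12 ^ n * Q * 2 powr p))"
  have c0: "c\<^sub>0 > 0" using \<open>Q > 0\<close> by (simp add: c\<^sub>0_def)
  show ?thesis unfolding uniformly_fat_def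
  proof (intro exI[of _ c\<^sub>0] conjI ballI allI impI c0)
    fix w and R :: real assume w: "w \<in> - \<Omega>" and R: "R > 0"
    define A where "A = c\<^sub>0 * ((2 / R) powr p * (\<omega> * (2 * R) ^ n))"
    have "A > 0" using c0 R \<open>\<omega> > 0\<close> by (simp add: A_def)
    show "ennreal c\<^sub>0 * cap p (cball w R) (ball w (2 * R)) \<le> cap p (- \<Omega> \<inter> cball w R) (ball w (2 * R))"
    proof (rule ccontr)
      assume "\<not> ?thesis"
      then have "cap p (- \<Omega> \<inter> cball w R) (ball w (2 * R)) < ennreal c\<^sub>0 * cap p (cball w R) (ball w (2 * R))" by simp
      also have "\<dots> \<le> ennreal c\<^sub>0 * (ennreal ((2 / R) powr p) * emeasure lebesgue (ball w (2 * R)))"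
        using R p by (intro mult_left_mono cap_cball_upper) auto
      also have "\<dots> = ennreal A"
        using R c0 \<open>\<omega> > 0\<close> by (simp add: A_def emeasure_ball ennreal_mult \<omega>_def n_def)
      finally have "\<omega> * (R / 6) ^ n \<le> Q * R powr p * A"
        using hardy_imp_measure_bound[OF p \<Omega> C, of w R A] w R \<open>A > 0\<close> by (simp add: \<omega>_def n_def Q_def)
      also have "Q * R powr p * A = Q * c\<^sub>0 * (R powr p * (2 / R) powr p) * \<omega> * (2 * R) ^ n"
        by (simp add: A_def mult_ac)
      also have "R powr p * (2 / R) powr p = 2 powr p" using R by (simp add: powr_mult[symmetric])
      also have "(2 * R) ^ n = 12 ^ n * (R / 6) ^ n" using power_mult_distrib[of 12 "R / 6" n] by simp
      also have "Q * c\<^sub>0 * 2 powr p * \<omega> * (12 ^ n * (R / 6) ^ n) = (12 ^ n * Q * 2 powr p * c\<^sub>0) * (\<omega> * (R / 6) ^ n)"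
        by (simp only: mult_ac)
      also have "12 ^ n * Q * 2 powr p * c\<^sub>0 = 1/2" using \<open>Q > 0\<close> by (simp add: c\<^sub>0_def)
      finally show False using \<open>\<omega> > 0\<close> R by (simp add: mult_le_cancel_right)
    qed
  qed
qed

theorem theorem1p1:
  fixes \<Omega> :: "(real ^ 'n) set" and p :: real
  assumes "1 \<le> p"
    and "open \<Omega>" and "connected \<Omega>" and "\<Omega> \<noteq> {}" and "\<Omega> \<noteq> UNIV"
  shows "pointwise_hardy p \<Omega> \<longleftrightarrow> uniformly_fat p (- \<Omega>)"
  using pointwise_hardy_imp_uniformly_fat[OF assms(1,2,5)]
    uniformly_fat_imp_pointwise_hardy[OF assms(1,2,5)] by blast

end
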